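(* Let $(V;\rho)$ be a representation of a $3$-Lie algebra $(\mathfrak g,[\cdot,\cdot,\cdot]_{\mathfrak g})$, and let $T:V\to\mathfrak g$ be an embedding tensor on $\mathfrak g$ with respect to $(V;\rho)$. Then the graded vector space $C^*(V,\mathfrak g)$ carries an $L_\infty$-algebra structure (the twisted $L_\infty$-algebra structure) given by $$l_1^T(P)=\tfrac12\{T,T,P\},\quad l_2^T(P,Q)=\{T,P,Q\},\quad l_3^T(P,Q,R)=\{P,Q,R\},\quad l_k^T=0\ (k\ge4),$$ for $P\in C^p(V,\mathfrak g)$, $Q\in C^q(V,\mathfrak g)$, $R\in C^r(V,\mathfrak g)$.
   Context: All vector spaces are over an algebraically closed field $\mathbb K$ of characteristic $0$. A $3$-Lie algebra is a vector space $\mathfrak g$ with a skew-symmetric trilinear bracket $[\cdot,\cdot,\cdot]_{\mathfrak g}$ such that $[x_1,x_2,[x_3,x_4,x_5]_{\mathfrak g}]_{\mathfrak g}=[[x_1,x_2,x_3]_{\mathfrak g},x_4,x_5]_{\mathfrak g}+[x_3,[x_1,x_2,x_4]_{\mathfrak g},x_5]_{\mathfrak g}+[x_3,x_4,[x_1,x_2,x_5]_{\mathfrak g}]_{\mathfrak g}$ for all $x_i\in\mathfrak g$. A representation of $\mathfrak g$ on a vector space $V$ is a linear map $\rho:\wedge^2\mathfrak g\to\mathfrak{gl}(V)$ such that for all $x_i\in\mathfrak g$: $\rho(x_1,x_2)\rho(x_3,x_4)=\rho([x_1,x_2,x_3]_{\mathfrak g},x_4)+\rho(x_3,[x_1,x_2,x_4]_{\mathfrak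 g})+\rho(x_3,x_4)\rho(x_1,x_2)$ and $\rho(x_1,[x_2,x_3,x_4]_{\mathfrak g})=\rho(x_3,x_4)\rho(x_1,x_2)-\rho(x_2,x_4)\rho(x_1,x_3)+\rho(x_2,x_3)\rho(x_1,x_4)$. An embedding tensor on $\mathfrak g$ with respect to $(V;\rho)$ is a linear map $T:V\to\mathfrak g$ with $[Tu,Tv,Tw]_{\mathfrak g}=T(\rho(Tu,Tv)w)$ for all $u,v,w\in V$. Graded Lie algebra $C^*(W,W)$. For a vector space $W$, $C^n(W,W)=\mathrm{Hom}((\otimes^2W)^{\otimes n}\otimes W,W)$ has degree $n\ge0$ and $C^*(W,W)=\bigoplus_{n\ge0}C^n(W,W)$. For $P\in C^p(W,W)$, $Q\in C^q(W,W)$, $[P,Q]_{\mathsf{3Leib}}=P\circ Q-(-1)^{pq}Q\circ P$, where for $\mathfrak X_i=x_i\otimes y_i\in\otimes^2W$ and $x\in W$, $(P\circ Q)(\mathfrak X_1,\dots,\mathfrak X_{p+q},x)$ $=\sum_{k=1}^p(-1)^{(k-1)q}\sum_{\sigma\in S(k-1,q)}(-1)^\sigma P\big(\mathfrak X_{\sigma(1)},\dots,\mathfrak X_{\sigma(k-1)},Q(\mathfrak X_{\sigma(k)},\dots,\mathfrak X_{\sigma(k+q-1)},x_{k+q})\otimes y_{k+q},\mathfrak X_{k+q+1},\dots,\mathfrak X_{p+q},x\big)$ $+\sum_{k=1}^p(-1)^{(k-1)q}\sum_{\sigma\in S(k-1,q)}(-1)^\sigma P\big(\mathfrak X_{\sigma(1)},\dots,\mathfrak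 X_{\sigma(k-1)},x_{k+q}\otimes Q(\mathfrak X_{\sigma(k)},\dots,\mathfrak X_{\sigma(k+q-1)},y_{k+q}),\mathfrak X_{k+q+1},\dots,\mathfrak X_{p+q},x\big)$ $+\sum_{\sigma\in S(p,q)}(-1)^{pq}(-1)^\sigma P\big(\mathfrak X_{\sigma(1)},\dots,\mathfrak X_{\sigma(p)},Q(\mathfrak X_{\sigma(p+1)},\dots,\mathfrak X_{\sigma(p+q)},x)\big)$, with $S(i,j)$ the set of $(i,j)$-shuffles and $(-1)^\sigma$ the sign of $\sigma$. Trilinear bracket on $C^*(V,\mathfrak g)$. Let $\mu$ denote $[\cdot,\cdot,\cdot]_{\mathfrak g}$ and let $\mu\boxplus\rho\in C^1(\mathfrak g\oplus V,\mathfrak g\oplus V)$ be $(\mu\boxplus\rho)(x+u,y+v,z+w)=[x,y,z]_{\mathfrak g}+\rho(x,y)w$. Let $C^n(V,\mathfrak g)=\mathrm{Hom}((\otimes^2V)^{\otimes n}\otimes V,\mathfrak g)$ (degree $n$), $C^*(V,\mathfrak g)=\bigoplus_{n\ge0}C^n(V,\mathfrak g)$, regarded as a subspace of $C^*(\mathfrak g\oplus V,\mathfrak g\oplus V)$ by precomposing every argument with the projection $\mathfrak g\oplus V\to V$ and postcomposing with the inclusion of $\mathfrak g$. Put $\{P,Q,R\}=[[[\mu\boxplus\rho,P]_{\mathsf{3Leib}},Q]_{\mathsf{3Leib}},R]_{\mathsf{3Leib}}\in C^{p+q+r+1}(V,\mathfrak g)$. An $L_\infty$-algebra is a $\mathbb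 Z$-graded vector space $\mathfrak h$ with linear maps $l_k:\otimes^k\mathfrak h\to\mathfrak h$ ($k\ge1$) of degree $1$ that are graded symmetric, $l_n(x_{\sigma(1)},\dots,x_{\sigma(n)})=\varepsilon(\sigma)l_n(x_1,\dots,x_n)$ for $\sigma\in\mathbb S_n$, and satisfy, for all $n\ge1$ and homogeneous $x_i$, $\sum_{i=1}^n\sum_{\sigma\in\mathbb S_{(i,n-i)}}\varepsilon(\sigma)l_{n-i+1}(l_i(x_{\sigma(1)},\dots,x_{\sigma(i)}),x_{\sigma(i+1)},\dots,x_{\sigma(n)})=0$, where $\varepsilon(\sigma)$ is the Koszul sign and $\mathbb S_{(i,n-i)}$ the set of $(i,n-i)$-shuffles. *)

theory Defs
  imports
    "HOL-Computational_Algebra.Polynomial"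
    "HOL-Combinatorics.Permutations"
    "HOL-Library.Function_Algebras"
    "HOL-Analysis.Product_Vector"
begin

section \<open>3-Lie algebras, representations and embedding tensors\<close>

locale three_Lie_algebra = vector_space scale
  for scale :: "'k::field \<Rightarrow> 'g::ab_group_add \<Rightarrow> 'g" +
  fixes bracket :: "'g \<Rightarrow> 'g \<Rightarrow> 'g \<Rightarrow> 'g"
  assumes bracket_linear:
      "Vector_Spaces.linear scale scale (\<lambda>x. bracket x y z)"
      "Vector_Spaces.linear scale scale (\<lambda>y. bracket x y z)"
      "Vector_Spaces.linear scale scale (\<lambda>z. bracket x y z)"
    and bracket_skew:
      "bracket x y z = - bracket y x z"
      "bracket x y z = - bracket x z y"
    and fundamental_identity:
      "bracket x1 x2 (bracket x3 x4 x5) =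
         bracket (bracket x1 x2 x3) x4 x5
       + bracket x3 (bracket x1 x2 x4) x5
       + bracket x3 x4 (bracket x1 x2 x5)"

text \<open>
  A linear map from the second exterior power of \<open>\<gg>\<close> is an alternating bilinear map.
\<close>

locale three_Lie_representation =
  three_Lie_algebra scaleG bracket + V: vector_space scaleV
  for scaleG :: "'k::field \<Rightarrow> 'g::ab_group_add \<Rightarrow> 'g"
    and bracket :: "'g \<Rightarrow> 'g \<Rightarrow> 'g \<Rightarrow> 'g"
    and scaleV :: "'k \<Rightarrow> 'v::ab_group_add \<Rightarrow> 'v" +
  fixes \<rho> :: "'g \<Rightarrow> 'g \<Rightarrow> 'v \<Rightarrow> 'v"
  assumes rho_linear:
      "Vector_Spaces.linear scaleV scaleV (\<rho> x y)"
      "Vector_Spaces.linear scaleG scaleV (\<lambda>x. \<rho> x y v)"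
      "Vector_Spaces.linear scaleG scaleV (\<lambda>y. \<rho> x y v)"
    and rho_alternating: "\<rho> x x v = 0"
    and rho_commutator:
      "\<rho> x1 x2 (\<rho> x3 x4 v) =
         \<rho> (bracket x1 x2 x3) x4 v + \<rho> x3 (bracket x1 x2 x4) v + \<rho> x3 x4 (\<rho> x1 x2 v)"
    and rho_bracket:
      "\<rho> x1 (bracket x2 x3 x4) v =
         \<rho> x3 x4 (\<rho> x1 x2 v) - \<rho> x2 x4 (\<rho> x1 x3 v) + \<rho> x2 x3 (\<rho> x1 x4 v)"

locale embedding_tensor = three_Lie_representation scaleG bracket scaleV \<rho>
  for scaleG :: "'k::field \<Rightarrow> 'g::ab_group_add \<Rightarrow> 'g"
    and bracket :: "'g \<Rightarrow> 'g \<Rightarrow> 'g \<Rightarrow> 'g"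
    and scaleV :: "'k \<Rightarrow> 'v::ab_group_add \<Rightarrow> 'v"
    and \<rho> :: "'g \<Rightarrow> 'g \<Rightarrow> 'v \<Rightarrow> 'v" +
  fixes T :: "'v \<Rightarrow> 'g"
  assumes T_linear: "Vector_Spaces.linear scaleV scaleG T"
    and T_embedding: "bracket (T u) (T v) (T w) = T (\<rho> (T u) (T v) w)"


section \<open>Shuffles and Koszul signs\<close>

text \<open>Permutations act on the 0-based positions \<open>0, \<dots>, i + j - 1\<close>.\<close>

definition shuffle_perms :: "nat \<Rightarrow> nat \<Rightarrow> (nat \<Rightarrow> nat) set" where
  "shuffle_perms i j =
     {\<sigma>. \<sigma> permutes {..<i + j} \<and> strict_mono_on {..<i} \<sigma> \<and> strict_mono_on {i..<i + j} \<sigma>}"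

text \<open>
  The sign \<open>\<epsilon>(\<sigma>)\<close> in \<open>x\<^bsub>\<sigma> 0\<^esub> \<odot> \<dots> \<odot> x\<^bsub>\<sigma> (n - 1)\<^esub> = \<epsilon>(\<sigma>) (x\<^sub>0 \<odot> \<dots> \<odot> x\<^bsub>n - 1\<^esub>)\<close>, where \<open>x\<^sub>i\<close> has degree \<open>d i\<close>:
  one factor for each inversion of \<open>\<sigma>\<close>.
\<close>

definition koszul_sign :: "nat \<Rightarrow> (nat \<Rightarrow> int) \<Rightarrow> (nat \<Rightarrow> nat) \<Rightarrow> int" where
  "koszul_sign n d \<sigma> =
     (\<Prod>(i, j) \<in> {(i, j). i < j \<and> j < n \<and> \<sigma> j < \<sigma> i}.
        if odd (d (\<sigma> i) * d (\<sigma> j)) then -1 else 1)"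


section \<open>\<open>L\<^sub>\<infinity>\<close>-algebras\<close>

text \<open>
  The underlying space is the internal direct sum of the subspaces \<open>H i\<close>, and need not be the
  whole ambient vector space.
\<close>

locale graded_vector_space = vector_space scale
  for scale :: "'k::field \<Rightarrow> 'h::ab_group_add \<Rightarrow> 'h" +
  fixes H :: "int \<Rightarrow> 'h set"
  assumes subspace_component: "subspace (H i)"
    and components_independent:
      "\<lbrakk>finite I; \<And>i. i \<in> I \<Longrightarrow> x i \<in> H i; (\<Sum>i\<in>I. x i) = 0; i \<in> I\<rbrakk> \<Longrightarrow> x i = 0"
begin

definition total_space :: "'h set" where
  "total_space = span (\<Union>i. H i)"

end

text \<open>
  The operation \<open>l\<^sub>k\<close> is the restriction of \<open>l\<close> to lists of length \<open>k\<close>; the value at the empty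
  list is irrelevant. Linear maps on the \<open>k\<close>-th tensor power are given as \<open>k\<close>-linear maps.
\<close>

locale L_infinity_algebra = graded_vector_space scale H
  for scale :: "'k::field \<Rightarrow> 'h::ab_group_add \<Rightarrow> 'h"
    and H :: "int \<Rightarrow> 'h set" +
  fixes l :: "'h list \<Rightarrow> 'h"
  assumes l_add:
      "\<lbrakk>set xs \<subseteq> total_space; i < length xs; y \<in> total_space; z \<in> total_space\<rbrakk>
        \<Longrightarrow> l (xs[i := y + z]) = l (xs[i := y]) + l (xs[i := z])"
    and l_scale:
      "\<lbrakk>set xs \<subseteq> total_space; i < length xs; y \<in> total_space\<rbrakk>
        \<Longrightarrow> l (xs[i := scale c y]) = scale c (l (xs[i := y]))"
    and l_degree:
      "\<lbrakk>xs \<noteq> []; \<And>i. i < length xs \<Longrightarrow> xs ! i \<in> H (d i)\<rbrakk>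
        \<Longrightarrow> l xs \<in> H ((\<Sum>i<length xs. d i) + 1)"
    and l_graded_symmetric:
      "\<lbrakk>xs \<noteq> []; \<And>i. i < length xs \<Longrightarrow> xs ! i \<in> H (d i); \<sigma> permutes {..<length xs}\<rbrakk>
        \<Longrightarrow> l (permute_list \<sigma> xs) = scale (of_int (koszul_sign (length xs) d \<sigma>)) (l xs)"
    and l_jacobi:
      "\<lbrakk>xs \<noteq> []; \<And>i. i < length xs \<Longrightarrow> xs ! i \<in> H (d i)\<rbrakk>
        \<Longrightarrow> (\<Sum>i=1..length xs. \<Sum>\<sigma>\<in>shuffle_perms i (length xs - i).
              scale (of_int (koszul_sign (length xs) d \<sigma>))
                (l (l (take i (permute_list \<sigma> xs)) # drop i (permute_list \<sigma> xs)))) = 0"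


section \<open>Cochains and the graded Lie bracket\<close>

text \<open>
  A pair \<open>(x, y)\<close> in the list argument stands for the decomposable tensor \<open>x \<otimes> y\<close>. An element of
  the direct sum \<open>C\<^sup>*(V, W)\<close> is one function on lists of arbitrary length, whose component of
  degree \<open>n\<close> is its restriction to lists of length \<open>n\<close>; homogeneous elements of degree \<open>n\<close> vanish
  on all other lengths.
\<close>

type_synonym ('v, 'w) cochain = "('v \<times> 'v) list \<Rightarrow> 'v \<Rightarrow> 'w"

definition cochains ::
  "('k::field \<Rightarrow> 'v::ab_group_add \<Rightarrow> 'v) \<Rightarrow> ('k \<Rightarrow> 'w::ab_group_add \<Rightarrow> 'w) \<Rightarrow> nat
    \<Rightarrow> ('v, 'w) cochain set" where
  "cochains s\<^sub>1 s\<^sub>2 n =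
     {P. (\<forall>X x. length X \<noteq> n \<longrightarrow> P X x = 0) \<and>
         (\<forall>X. length X = n \<longrightarrow> Vector_Spaces.linear s\<^sub>1 s\<^sub>2 (P X)) \<and>
         (\<forall>X x i a b. length X = n \<longrightarrow> i < n \<longrightarrow>
            Vector_Spaces.linear s\<^sub>1 s\<^sub>2 (\<lambda>y. P (X[i := (y, b)]) x) \<and>
            Vector_Spaces.linear s\<^sub>1 s\<^sub>2 (\<lambda>y. P (X[i := (a, y)]) x))}"

definition cochain_scale ::
  "('k \<Rightarrow> 'w \<Rightarrow> 'w) \<Rightarrow> 'k \<Rightarrow> ('v, 'w) cochain \<Rightarrow> ('v, 'w) cochain" where
  "cochain_scale s c P = (\<lambda>X x. s c (P X x))"

text \<open>
  \<open>P \<circ> Q\<close> for \<open>P\<close> of degree \<open>p\<close> and \<open>Q\<close> of degree \<open>q\<close>, evaluated at lists \<open>X\<close> of length \<open>p + q\<close>.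
  The summation index \<open>k\<close> is 0-based, so it plays the role of the usual \<open>k - 1\<close>.
\<close>

definition circ ::
  "('k::field \<Rightarrow> 'w::ab_group_add \<Rightarrow> 'w) \<Rightarrow> nat \<Rightarrow> nat
    \<Rightarrow> ('w, 'w) cochain \<Rightarrow> ('w, 'w) cochain \<Rightarrow> ('w, 'w) cochain" where
  "circ s p q P Q = (\<lambda>X x.
     (\<Sum>k<p. s ((-1) ^ (k * q)) (\<Sum>\<sigma>\<in>shuffle_perms k q. s (of_int (sign \<sigma>))
        (let Y = permute_list \<sigma> (take (k + q) X); (a, b) = X ! (k + q)
         in P (take k Y @ [(Q (drop k Y) a, b)] @ drop (k + q + 1) X) x)))
   + (\<Sum>k<p. s ((-1) ^ (k * q)) (\<Sum>\<sigma>\<in>shuffle_perms k q. s (of_int (sign \<sigma>))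
        (let Y = permute_list \<sigma> (take (k + q) X); (a, b) = X ! (k + q)
         in P (take k Y @ [(a, Q (drop k Y) b)] @ drop (k + q + 1) X) x)))
   + (\<Sum>\<sigma>\<in>shuffle_perms p q. s ((-1) ^ (p * q)) (s (of_int (sign \<sigma>))
        (let Y = permute_list \<sigma> X in P (take p Y) (Q (drop p Y) x)))))"

text \<open>
  The bilinear extension to the direct sum of
  \<open>[P, Q] = P \<circ> Q - (-1)\<^bsup>pq\<^esup> Q \<circ> P\<close>: its component of degree \<open>n\<close> collects the brackets of
  the components of degrees \<open>p\<close> and \<open>q\<close> with \<open>p + q = n\<close>. Note that \<open>circ s p q P Q\<close> evaluates
  \<open>P\<close> only at lists of length \<open>p\<close> and \<open>Q\<close> only at lists of length \<open>q\<close>.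
\<close>

definition bracket_3Leib ::
  "('k::field \<Rightarrow> 'w::ab_group_add \<Rightarrow> 'w)
    \<Rightarrow> ('w, 'w) cochain \<Rightarrow> ('w, 'w) cochain \<Rightarrow> ('w, 'w) cochain" where
  "bracket_3Leib s P Q = (\<lambda>X x.
     \<Sum>p\<le>length X. let q = length X - p in
       circ s p q P Q X x - s ((-1) ^ (p * q)) (circ s q p Q P X x))"


section \<open>The twisted operations\<close>

abbreviation scale_sum ::
  "('k::field \<Rightarrow> 'g::ab_group_add \<Rightarrow> 'g) \<Rightarrow> ('k \<Rightarrow> 'v::ab_group_add \<Rightarrow> 'v)
    \<Rightarrow> 'k \<Rightarrow> 'g \<times> 'v \<Rightarrow> 'g \<times> 'v" where
  "scale_sum \<equiv> module_prod.scale"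

definition semidirect_cochain ::
  "('g::ab_group_add \<Rightarrow> 'g \<Rightarrow> 'g \<Rightarrow> 'g) \<Rightarrow> ('g \<Rightarrow> 'g \<Rightarrow> 'v::ab_group_add \<Rightarrow> 'v)
    \<Rightarrow> ('g \<times> 'v, 'g \<times> 'v) cochain" where
  "semidirect_cochain \<mu> \<rho> = (\<lambda>X (z, w). case X of
       [((x, u), (y, v))] \<Rightarrow> (\<mu> x y z, \<rho> x y w)
     | _ \<Rightarrow> 0)"

text \<open>The inclusion of \<open>C\<^sup>*(V, \<gg>)\<close> into \<open>C\<^sup>*(\<gg> \<oplus> V, \<gg> \<oplus> V)\<close>.\<close>

definition lift_cochain ::
  "('v, 'g) cochain \<Rightarrow> ('g::ab_group_add \<times> 'v, 'g \<times> 'v::ab_group_add) cochain" where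
  "lift_cochain P = (\<lambda>X x. (P (map (map_prod snd snd) X) (snd x), 0))"

definition graded_cochains ::
  "('k::field \<Rightarrow> 'g::ab_group_add \<Rightarrow> 'g) \<Rightarrow> ('k \<Rightarrow> 'v::ab_group_add \<Rightarrow> 'v)
    \<Rightarrow> int \<Rightarrow> ('g \<times> 'v, 'g \<times> 'v) cochain set" where
  "graded_cochains scaleG scaleV i =
     (if i < 0 then {0} else lift_cochain ` cochains scaleV scaleG (nat i))"

definition cochain_of_map :: "('v \<Rightarrow> 'g::zero) \<Rightarrow> ('v, 'g) cochain" where
  "cochain_of_map T = (\<lambda>X v. if X = [] then T v else 0)"

definition tri_bracket ::
  "('k::field \<Rightarrow> 'g::ab_group_add \<Rightarrow> 'g) \<Rightarrow> ('g \<Rightarrow> 'g \<Rightarrow> 'g \<Rightarrow> 'g)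
    \<Rightarrow> ('k \<Rightarrow> 'v::ab_group_add \<Rightarrow> 'v) \<Rightarrow> ('g \<Rightarrow> 'g \<Rightarrow> 'v \<Rightarrow> 'v)
    \<Rightarrow> ('g \<times> 'v, 'g \<times> 'v) cochain \<Rightarrow> ('g \<times> 'v, 'g \<times> 'v) cochain
    \<Rightarrow> ('g \<times> 'v, 'g \<times> 'v) cochain \<Rightarrow> ('g \<times> 'v, 'g \<times> 'v) cochain" where
  "tri_bracket scaleG \<mu> scaleV \<rho> P Q R =
     (let br = bracket_3Leib (scale_sum scaleG scaleV)
      in br (br (br (semidirect_cochain \<mu> \<rho>) P) Q) R)"

fun twisted_operations ::
  "('k::field \<Rightarrow> 'g::ab_group_add \<Rightarrow> 'g) \<Rightarrow> ('g \<Rightarrow> 'g \<Rightarrow> 'g \<Rightarrow> 'g)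
    \<Rightarrow> ('k \<Rightarrow> 'v::ab_group_add \<Rightarrow> 'v) \<Rightarrow> ('g \<Rightarrow> 'g \<Rightarrow> 'v \<Rightarrow> 'v) \<Rightarrow> ('v \<Rightarrow> 'g)
    \<Rightarrow> ('g \<times> 'v, 'g \<times> 'v) cochain list \<Rightarrow> ('g \<times> 'v, 'g \<times> 'v) cochain" where
  "twisted_operations scaleG \<mu> scaleV \<rho> T [P] =
     cochain_scale (scale_sum scaleG scaleV) (1 / 2)
       (tri_bracket scaleG \<mu> scaleV \<rho>
          (lift_cochain (cochain_of_map T)) (lift_cochain (cochain_of_map T)) P)"
| "twisted_operations scaleG \<mu> scaleV \<rho> T [P, Q] =
     tri_bracket scaleG \<mu> scaleV \<rho> (lift_cochain (cochain_of_map T)) P Q"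
| "twisted_operations scaleG \<mu> scaleV \<rho> T [P, Q, R] =
     tri_bracket scaleG \<mu> scaleV \<rho> P Q R"
| "twisted_operations scaleG \<mu> scaleV \<rho> T _ = 0"

end

theory Submission
  imports Defs
begin

text \<open>
  Let \<open>W = \<gg> \<oplus> V\<close> and \<open>\<Delta> = \<mu> \<boxplus> \<rho>\<close>. The result is an instance of the construction of higher
  derived brackets, which applies for three reasons.

  First, \<open>[\<cdot>, \<cdot>]\<close> is a graded Lie bracket on \<open>C\<^sup>*(W, W)\<close>. The composition \<open>P \<circ> Q\<close>, although defined
  by shuffles, obeys a short recursion on the list of arguments (\<open>leib_comp\<close>, \<open>circ_eq_leib_comp\<close>),
  and from this recursion it is seen to be a graded pre-Lie product (\<open>pre_Lie_identity\<close>). The bracket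
  is its graded commutator and hence satisfies the Jacobi identity (\<open>bracket_jacobi\<close>).

  Second, there is an additional weight on \<open>C\<^sup>*(W, W)\<close>, the number of inputs from \<open>\<gg>\<close> minus the number
  of outputs in \<open>\<gg>\<close>. It is additive for the bracket, nothing has weight below \<open>-1\<close>
  (\<open>low_weight_zero\<close>), and \<open>C\<^sup>*(V, \<gg>)\<close> is exactly the part of weight \<open>-1\<close>
  (\<open>graded_cochains_eq_bigraded\<close>). So \<open>C\<^sup>*(V, \<gg>)\<close> is an abelian subalgebra, and since \<open>\<Delta>\<close> has weight
  \<open>2\<close>, brackets of \<open>\<Delta>\<close> with three elements of \<open>C\<^sup>*(V, \<gg>)\<close> lie in \<open>C\<^sup>*(V, \<gg>)\<close> again.

  Third, \<open>[\<Delta>, \<Delta>] = 0\<close> by the fundamental identity and the properties of a representation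
  (\<open>br_semidirect_cochain\<close>), and \<open>[[[\<Delta>, T], T], T] = 0\<close> by the defining property of an embedding
  tensor (\<open>br_T_lift_three\<close>). Applying the derivation \<open>[\<cdot>, T]\<close> repeatedly to the first equation shows
  that \<open>\<delta>\<^sub>0 + \<delta>\<^sub>1 + \<delta>\<^sub>2\<close> with \<open>\<delta>\<^sub>0 = [[\<Delta>, T], T] / 2\<close>, \<open>\<delta>\<^sub>1 = [\<Delta>, T]\<close> and \<open>\<delta>\<^sub>2 = \<Delta>\<close> is a
  Maurer-Cartan element (\<open>Maurer_Cartan_twisted_family\<close>).

  The operations in question are \<open>l\<^sub>k(x\<^sub>1, \<dots>, x\<^sub>k) = [\<dots>[\<delta>\<^bsub>k-1\<^esub>, x\<^sub>1], \<dots>, x\<^sub>k]\<close>. Their graded symmetry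
  comes from the commutativity of the \<open>x\<^sub>i\<close>. Bracketing the Maurer-Cartan equation of weight \<open>n - 1\<close>
  with \<open>x\<^sub>1, \<dots>, x\<^sub>n\<close> and expanding by the Leibniz rule gives a sum over splittings of the arguments,
  in which the weights leave only the terms of the \<open>n\<close>-th generalized Jacobi identity, each of them
  twice (\<open>derived_jacobi\<close>).
\<close>

section \<open>Permutations, inversions and signs\<close>

text \<open>
  Signs act on every abelian group, without reference to a ground field. Only the parity of the
  exponent matters, so exponents can be computed with integer degrees, negative ones included.
\<close>

definition signed :: "int \<Rightarrow> 'v::ab_group_add \<Rightarrow> 'v" where
  "signed z v = (if even z then v else - v)"

lemma signed_simps [simp]:
  "signed 0 v = v" "signed 1 v = - v" "signed z 0 = 0"
  by (simp_all add: signed_def)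

lemma signed_signed: "signed y (signed z v) = signed (y + z) v"
  by (auto simp: signed_def)

lemma signed_cong: "even (y - z) \<Longrightarrow> signed y v = signed z v"
  by (auto simp: signed_def)

lemma signed_add: "signed z (u + v) = signed z u + signed z v"
  by (simp add: signed_def)

lemma signed_diff: "signed z (u - v) = signed z u - signed z v"
  by (simp add: signed_def)

lemma signed_sum: "signed z (\<Sum>i\<in>I. f i) = (\<Sum>i\<in>I. signed z (f i))"
  by (simp add: signed_def sum_negf)

lemma signed_apply: "signed z P X = signed z (P X)"
  by (simp add: signed_def)

definition inversions :: "nat \<Rightarrow> (nat \<Rightarrow> nat) \<Rightarrow> (nat \<times> nat) set" where
  "inversions n \<sigma> = {(i, j). i < j \<and> j < n \<and> \<sigma> j < \<sigma> i}"

lemma finite_inversions: "finite (inversions n \<sigma>)"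
  by (rule finite_subset[of _ "{..<n} \<times> {..<n}"]) (auto simp: inversions_def)

text \<open>
  Exchanging the two values at a descent renumbers all other inversions and removes exactly the one
  given by the descent itself.
\<close>

lemma inversions_descent:
  assumes "Suc k < n" "\<sigma> (Suc k) < \<sigma> k"
  defines "t \<equiv> transpose k (Suc k)"
  shows "inversions n \<sigma> = insert (k, Suc k) (map_prod t t ` inversions n (\<sigma> \<circ> t))"
    and "(k, Suc k) \<notin> map_prod t t ` inversions n (\<sigma> \<circ> t)"
proof -
  have tt: "t (t x) = x" for x
    by (simp add: t_def)
  have t_less: "t i < t j" if "i < j" "(i, j) \<noteq> (k, Suc k)" for i j
    using that by (auto simp: t_def transpose_def)
  have t_bound: "t i < n \<longleftrightarrow> i < n" for i
    using assms(1) by (auto simp: t_def transpose_def)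
  have mem: "(i, j) \<in> map_prod t t ` A \<longleftrightarrow> (t i, t j) \<in> A" for i j A
  proof
    assume "(i, j) \<in> map_prod t t ` A"
    then show "(t i, t j) \<in> A"
      by (auto simp: tt)
  next
    assume "(t i, t j) \<in> A"
    then have "map_prod t t (t i, t j) \<in> map_prod t t ` A"
      by (rule imageI)
    then show "(i, j) \<in> map_prod t t ` A"
      by (simp add: tt)
  qed
  show "(k, Suc k) \<notin> map_prod t t ` inversions n (\<sigma> \<circ> t)"
    unfolding mem by (simp add: inversions_def t_def)
  show "inversions n \<sigma> = insert (k, Suc k) (map_prod t t ` inversions n (\<sigma> \<circ> t))"
  proof (intro set_eqI)
    fix p :: "nat \<times> nat"
    obtain i j where p: "p = (i, j)"
      by force
    have "(i, j) \<in> inversions n \<sigma> \<longleftrightarrow> (t i, t j) \<in> inversions n (\<sigma> \<circ> t)" if "(i, j) \<noteq> (k, Suc k)"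
    proof -
      have "i < j \<longleftrightarrow> t i < t j" if "\<sigma> j < \<sigma> i"
      proof
        show "t i < t j" if "i < j"
          using t_less that \<open>(i, j) \<noteq> (k, Suc k)\<close> by blast
        assume "t i < t j"
        moreover have "(t i, t j) \<noteq> (k, Suc k)"
        proof
          assume "(t i, t j) = (k, Suc k)"
          then have "i = Suc k" "j = k"
            by (auto simp: t_def transpose_def split: if_splits)
          with that assms(2) show False
            by simp
        qed
        ultimately show "i < j"
          using t_less[of "t i" "t j"] by (simp add: tt)
      qed
      then show ?thesis
        by (auto simp: inversions_def tt t_bound)
    qed
    moreover have "(k, Suc k) \<in> inversions n \<sigma>"
      using assms by (simp add: inversions_def)
    ultimately show "p \<in> inversions n \<sigma> \<longleftrightarrow> p \<in> insert (k, Suc k) (map_prod t t ` inversions n (\<sigma> \<circ> t))"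
      unfolding p insert_iff mem by auto
  qed
qed

lemma koszul_sign_descent:
  assumes "Suc k < n" "\<sigma> (Suc k) < \<sigma> k"
  shows "koszul_sign n d \<sigma> = (if odd (d (\<sigma> k) * d (\<sigma> (Suc k))) then - 1 else 1) *
    koszul_sign n d (\<sigma> \<circ> transpose k (Suc k))"
proof -
  define t where "t = transpose k (Suc k)"
  have "inj_on (map_prod t t) A" for A
    by (rule inj_on_subset[of _ UNIV]) (auto intro!: prod.inj_map simp: t_def)
  note inv = inversions_descent[OF assms, folded t_def] this
  have "koszul_sign n d \<sigma> = (\<Prod>(i, j)\<in>inversions n \<sigma>. if odd (d (\<sigma> i) * d (\<sigma> j)) then -1 else 1)"
    by (simp add: koszul_sign_def inversions_def)
  also have "\<dots> = (if odd (d (\<sigma> k) * d (\<sigma> (Suc k))) then -1 else 1) *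
      (\<Prod>(i, j)\<in>map_prod t t ` inversions n (\<sigma> \<circ> t). if odd (d (\<sigma> i) * d (\<sigma> j)) then -1 else 1)"
    by (subst inv(1), subst prod.insert) (use inv(2) finite_inversions in auto)
  also have "(\<Prod>(i, j)\<in>map_prod t t ` inversions n (\<sigma> \<circ> t). if odd (d (\<sigma> i) * d (\<sigma> j)) then -1 else 1)
      = koszul_sign n d (\<sigma> \<circ> t)"
    by (subst prod.reindex[OF inv(3)]) (simp add: koszul_sign_def inversions_def case_prod_unfold)
  finally show ?thesis
    by (simp add: t_def)
qed

lemma koszul_sign_id [simp]: "koszul_sign n d id = 1" "koszul_sign n d (\<lambda>x. x) = 1"
proof -
  have "{(i, j). i < j \<and> j < n \<and> j < i} = {}"
    by auto
  then show "koszul_sign n d id = 1" "koszul_sign n d (\<lambda>x. x) = 1"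
    unfolding koszul_sign_def id_def by (simp_all only: prod.empty)
qed

lemma permutes_without_descent_eq_id:
  assumes "\<sigma> permutes {..<n}" "\<And>k. Suc k < n \<Longrightarrow> \<sigma> k \<le> \<sigma> (Suc k)"
  shows "\<sigma> = id"
proof -
  have "sorted (map \<sigma> [0..<n])"
    by (rule sorted_iff_nth_Suc[THEN iffD2]) (use assms(2) in auto)
  moreover have "distinct (map \<sigma> [0..<n])"
    using permutes_inj_on[OF assms(1)] by (simp add: distinct_map)
  moreover have "set (map \<sigma> [0..<n]) = set [0..<n]"
    using permutes_image[OF assms(1)] by (simp add: atLeast0LessThan)
  ultimately have "map \<sigma> [0..<n] = [0..<n]"
    using sorted_distinct_set_unique by (metis distinct_upt sorted_upt)
  then have "\<sigma> x = x" if "x < n" for x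
    using that by (metis add_0 length_upt diff_zero nth_map nth_upt)
  then show ?thesis
    using assms(1) by (auto simp: fun_eq_iff permutes_def)
qed

text \<open>
  Bubble sort: removing a descent lowers the number of inversions, so that every permutation is
  reduced to the identity by removing descents one at a time. Graded symmetry therefore only needs
  to be checked for two neighbouring arguments.
\<close>

lemma permutes_descent_induct [consumes 1, case_names id descent]:
  assumes "\<sigma> permutes {..<n}"
    and "P id"
    and "\<And>\<sigma> k. \<lbrakk>\<sigma> permutes {..<n}; Suc k < n; \<sigma> (Suc k) < \<sigma> k;
      P (\<sigma> \<circ> transpose k (Suc k))\<rbrakk> \<Longrightarrow> P \<sigma>"
  shows "P \<sigma>"
  using assms(1)
proof (induction "card (inversions n \<sigma>)" arbitrary: \<sigma> rule: less_induct)
  case less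
  show ?case
  proof (cases "\<exists>k. Suc k < n \<and> \<sigma> (Suc k) < \<sigma> k")
    case True
    then obtain k where k: "Suc k < n" "\<sigma> (Suc k) < \<sigma> k"
      by blast
    define t where "t = transpose k (Suc k)"
    have "inj_on (map_prod t t) A" for A
      by (rule inj_on_subset[of _ UNIV]) (auto intro!: prod.inj_map simp: t_def)
    then have "card (inversions n \<sigma>) = Suc (card (inversions n (\<sigma> \<circ> t)))"
      using inversions_descent[OF k, folded t_def] finite_inversions[of n "\<sigma> \<circ> t"]
      by (simp add: card_image)
    moreover have "\<sigma> \<circ> t permutes {..<n}"
      using k(1) less.prems by (intro permutes_compose permutes_swap_id) (auto simp: t_def permutes_swap_id)
    ultimately show ?thesis
      using less k assms(3)[of \<sigma> k] by (simp add: t_def)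
  next
    case False
    then have "\<sigma> = id"
      by (intro permutes_without_descent_eq_id[OF less.prems]) (meson not_le)
    then show ?thesis
      using assms(2) by simp
  qed
qed

text \<open>
  If all degrees are odd, every inversion contributes a factor \<open>-1\<close>, so that removing a descent
  changes both signs. This lets the Koszul-signed sums below also describe the ordinary signs in the
  composition of cochains, where each argument from \<open>W \<otimes> W\<close> counts as odd.
\<close>

lemma sign_eq_koszul_sign:
  assumes "\<sigma> permutes {..<n}"
  shows "sign \<sigma> = koszul_sign n (\<lambda>_. 1) \<sigma>"
  using assms
proof (induction rule: permutes_descent_induct)
  case (descent \<sigma> k)
  have "sign (\<sigma> \<circ> transpose k (Suc k)) = - sign \<sigma>"
    using descent(1) by (subst sign_compose) (auto simp: sign_swap_id permutation_swap_id
        intro: permutes_imp_permutation[of "{..<n}"])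
  then show ?case
    using descent koszul_sign_descent[of k n \<sigma> "\<lambda>_. 1"] unfolding o_def by simp
qed simp_all

section \<open>Signed sums over shuffles\<close>

text \<open>
  The sum of \<open>F U W\<close> over all splittings of a list into complementary subsequences \<open>U\<close> and \<open>W\<close>,
  with the Koszul sign of rearranging the list into \<open>U @ W\<close>. In the second summand the first entry
  goes to \<open>W\<close> and has to be moved past all of \<open>U\<close>. Sums over shuffles become accessible to
  induction on lists in this form.
\<close>

fun split_sum ::
  "('b \<Rightarrow> int) \<Rightarrow> ('b list \<Rightarrow> 'b list \<Rightarrow> 'v::ab_group_add) \<Rightarrow> 'b list \<Rightarrow> 'v" where
  "split_sum e F [] = F [] []"
| "split_sum e F (x # xs) =
     split_sum e (\<lambda>U W. F (x # U) W) xs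
   + split_sum e (\<lambda>U W. signed (e x * sum_list (map e U)) (F U (x # W))) xs"

lemma split_sum_cong:
  assumes "\<And>U W. \<lbrakk>set U \<subseteq> set xs; set W \<subseteq> set xs; length U + length W = length xs;
      sum_list (map e U) + sum_list (map e W) = sum_list (map e xs)\<rbrakk> \<Longrightarrow> F U W = G U W"
  shows "split_sum e F xs = split_sum e G xs"
  using assms
proof (induction xs arbitrary: F G)
  case (Cons x xs)
  have "split_sum e (\<lambda>U W. F (x # U) W) xs = split_sum e (\<lambda>U W. G (x # U) W) xs"
    by (intro Cons.IH Cons.prems) auto
  moreover have "split_sum e (\<lambda>U W. signed (e x * sum_list (map e U)) (F U (x # W))) xs
      = split_sum e (\<lambda>U W. signed (e x * sum_list (map e U)) (G U (x # W))) xs"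
    by (intro Cons.IH arg_cong[of _ _ "signed _"] Cons.prems) auto
  ultimately show ?case
    by simp
qed simp

lemma split_sum_hom:
  assumes "\<And>u v. h (u + v) = h u + h v"
  shows "h (split_sum e F xs) = split_sum e (\<lambda>U W. h (F U W)) xs"
proof -
  have "h 0 = 0"
    using assms[of 0 0] by simp
  then have "h (- u) = - h u" for u
    using assms[of u "- u"] by (simp add: eq_neg_iff_add_eq_0 add.commute)
  then have "h (signed z u) = signed z (h u)" for z u
    by (simp add: signed_def)
  then show ?thesis
    by (induction xs arbitrary: F) (simp_all add: assms)
qed

lemma split_sum_signed: "signed z (split_sum e F xs) = split_sum e (\<lambda>U W. signed z (F U W)) xs"
  by (rule split_sum_hom) (rule signed_add)

lemma split_sum_0 [simp]: "split_sum e (\<lambda>U W. 0) xs = 0"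
  by (induction xs) simp_all

lemma split_sum_add:
  "split_sum e (\<lambda>U W. F U W + G U W) xs = split_sum e F xs + split_sum e G xs"
  by (induction xs arbitrary: F G) (simp_all add: signed_add algebra_simps)

lemma split_sum_sum:
  "split_sum e (\<lambda>U W. \<Sum>i\<in>I. F i U W) xs = (\<Sum>i\<in>I. split_sum e (F i) xs)"
  by (induction xs arbitrary: F) (simp_all add: signed_sum sum.distrib)

lemma split_sum_map:
  "split_sum e F (map f xs) = split_sum (e \<circ> f) (\<lambda>U W. F (map f U) (map f W)) xs"
  by (induction xs arbitrary: F) (simp_all add: o_def)

text \<open>
  The splittings \<open>(U, W)\<close> and \<open>(W, U)\<close> differ by the sign of moving the whole of \<open>U\<close> past \<open>W\<close>.
\<close>

lemma split_sum_swap: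
  "split_sum e F xs =
     split_sum e (\<lambda>U W. signed (sum_list (map e U) * sum_list (map e W)) (F W U)) xs"
proof (induction xs arbitrary: F)
  case (Cons x xs)
  have "split_sum e F (x # xs) =
      split_sum e (\<lambda>U W. signed (sum_list (map e U) * sum_list (map e W)) (F (x # W) U)) xs
    + split_sum e (\<lambda>U W. signed (sum_list (map e U) * sum_list (map e W))
        (signed (e x * sum_list (map e W)) (F W (x # U)))) xs"
    by (simp add: Cons.IH[of "\<lambda>U W. F (x # U) W"]
      Cons.IH[of "\<lambda>U W. signed (e x * sum_list (map e U)) (F U (x # W))"])
  also have "\<dots> = split_sum e (\<lambda>U W. signed (sum_list (map e U) * sum_list (map e W)) (F W U)) (x # xs)"
    by (simp add: signed_signed, subst add.commute, intro arg_cong2[of _ _ _ _ "(+)"] split_sum_cong signed_cong)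
      (auto simp: algebra_simps)
  finally show ?case .
qed simp

text \<open>
  The exponent of the Koszul sign that moves the entries with positions in \<open>A\<close> in front of those
  with positions in \<open>B\<close>.
\<close>

definition crossing_degree :: "(nat \<Rightarrow> int) \<Rightarrow> nat set \<Rightarrow> nat set \<Rightarrow> int" where
  "crossing_degree d A B = (\<Sum>(a, b)\<in>{(a, b). a \<in> A \<and> b \<in> B \<and> b < a}. d a * d b)"

lemma finite_crossings: "finite A \<Longrightarrow> finite B \<Longrightarrow> finite {(a, b). a \<in> A \<and> b \<in> B \<and> b < (a::nat)}"
  by (rule finite_subset[of _ "A \<times> B"]) auto

lemma crossing_degree_insert_left:
  assumes "finite A" "\<forall>b\<in>B. x < b" "x \<notin> A"
  shows "crossing_degree d (insert x A) B = crossing_degree d A B"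
  using assms unfolding crossing_degree_def by (intro sum.cong) auto

lemma crossing_degree_insert_right:
  assumes "finite A" "finite B" "\<forall>a\<in>A. x < a" "x \<notin> B"
  shows "crossing_degree d A (insert x B) = d x * (\<Sum>a\<in>A. d a) + crossing_degree d A B"
proof -
  have "{(a, b). a \<in> A \<and> b \<in> insert x B \<and> b < a} =
      (\<lambda>a. (a, x)) ` A \<union> {(a, b). a \<in> A \<and> b \<in> B \<and> b < a}"
    using assms by auto
  then have "crossing_degree d A (insert x B) =
      (\<Sum>(a, b)\<in>(\<lambda>a. (a, x)) ` A. d a * d b) + crossing_degree d A B"
    unfolding crossing_degree_def using assms finite_crossings[of A B]
    by (auto intro!: sum.union_disjoint)
  also have "(\<Sum>(a, b)\<in>(\<lambda>a. (a, x)) ` A. d a * d b) = d x * (\<Sum>a\<in>A. d a)"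
    by (subst sum.reindex) (auto simp: inj_on_def sum_distrib_left mult.commute)
  finally show ?thesis .
qed

lemma sorted_list_of_set_insert_less:
  assumes "finite A" "\<forall>a\<in>A. x < a"
  shows "sorted_list_of_set (insert x A) = x # sorted_list_of_set (A::nat set)"
proof -
  have "x \<notin> A"
    using assms(2) by blast
  then have "sorted_list_of_set (insert x A) = insort x (sorted_list_of_set A)"
    using assms(1) by simp
  also have "\<dots> = x # sorted_list_of_set A"
    using assms by (intro insort_is_Cons) (simp add: less_imp_le)
  finally show ?thesis .
qed

text \<open>
  The entries of an increasing list are distinct, so a splitting is the same as the subset of entries
  that it puts into the first part.
\<close>

lemma split_sum_eq_sum_Pow:
  assumes "sorted_wrt (<) xs"
  shows "split_sum d F xs = (\<Sum>A\<in>Pow (set xs). signed (crossing_degree d A (set xs - A))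
    (F (sorted_list_of_set A) (sorted_list_of_set (set xs - A))))"
  using assms
proof (induction xs arbitrary: F)
  case Nil
  show ?case
    by (simp add: crossing_degree_def)
next
  case (Cons x xs)
  let ?B = "set xs"
  let ?G = "\<lambda>A. signed (crossing_degree d A (set (x # xs) - A))
    (F (sorted_list_of_set A) (sorted_list_of_set (set (x # xs) - A)))"
  have x: "x \<notin> ?B" "\<And>A. A \<subseteq> ?B \<Longrightarrow> \<forall>a\<in>A. x < a"
    using Cons.prems by auto
  have fin: "finite A" if "A \<subseteq> ?B" for A
    using that finite_subset by blast
  have "(\<Sum>A\<in>Pow (set (x # xs)). ?G A) = (\<Sum>A\<in>Pow ?B. ?G A) + (\<Sum>A\<in>insert x ` Pow ?B. ?G A)"
    unfolding list.set Pow_insert using x by (intro sum.union_disjoint) auto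
  also have "(\<Sum>A\<in>insert x ` Pow ?B. ?G A) = (\<Sum>A\<in>Pow ?B. ?G (insert x A))"
    using x(1) by (subst sum.reindex) (auto intro!: inj_onI simp: insert_eq_iff subset_iff)
  also have "\<dots> = (\<Sum>A\<in>Pow ?B. signed (crossing_degree d A (?B - A))
    (F (x # sorted_list_of_set A) (sorted_list_of_set (?B - A))))"
  proof (intro sum.cong refl)
    fix A assume A: "A \<in> Pow ?B"
    then have eq: "set (x # xs) - insert x A = ?B - A"
      using x by auto
    show "?G (insert x A) = signed (crossing_degree d A (?B - A))
      (F (x # sorted_list_of_set A) (sorted_list_of_set (?B - A)))"
      unfolding eq using A x fin
      by (subst crossing_degree_insert_left)
        (auto simp: sorted_list_of_set_insert_less simp del: sorted_list_of_set_insert_remove)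
  qed
  also have "\<dots> = split_sum d (\<lambda>U W. F (x # U) W) xs"
    using Cons by simp
  also have "(\<Sum>A\<in>Pow ?B. ?G A) = (\<Sum>A\<in>Pow ?B. signed (crossing_degree d A (?B - A))
    (signed (d x * sum_list (map d (sorted_list_of_set A)))
      (F (sorted_list_of_set A) (x # sorted_list_of_set (?B - A)))))"
  proof (intro sum.cong refl)
    fix A assume A: "A \<in> Pow ?B"
    then have eq: "set (x # xs) - A = insert x (?B - A)"
      using x by auto
    have "sum_list (map d (sorted_list_of_set A)) = (\<Sum>a\<in>A. d a)"
      using A fin[of A] by (simp add: sum_list_distinct_conv_sum_set)
    moreover have "sorted_list_of_set (insert x (?B - A)) = x # sorted_list_of_set (?B - A)"
      using x by (intro sorted_list_of_set_insert_less) auto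
    moreover have "crossing_degree d A (insert x (?B - A)) = d x * (\<Sum>a\<in>A. d a) + crossing_degree d A (?B - A)"
      using A x fin[of A] by (intro crossing_degree_insert_right) auto
    ultimately show "?G A = signed (crossing_degree d A (?B - A))
      (signed (d x * sum_list (map d (sorted_list_of_set A)))
        (F (sorted_list_of_set A) (x # sorted_list_of_set (?B - A))))"
      unfolding eq by (simp only: signed_signed add.commute)
  qed
  also have "\<dots> = split_sum d (\<lambda>U W. signed (d x * sum_list (map d U)) (F U (x # W))) xs"
    using Cons by simp
  finally show ?case
    by (simp add: add.commute)
qed

text \<open>
  A shuffle is increasing on each of its two blocks and is therefore determined by the set of values
  that it takes on the first block, which can be any set of the right size.
\<close>

lemma bij_betw_shuffle_perms:
  "bij_betw (\<lambda>\<sigma>. \<sigma> ` {..<i}) (shuffle_perms i j) {A. A \<subseteq> {..<i + j} \<and> card A = i}"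
  (is "bij_betw ?f ?S ?T")
  and map_shuffle_perms:
  "\<sigma> \<in> shuffle_perms i j \<Longrightarrow> map \<sigma> [0..<i] = sorted_list_of_set (\<sigma> ` {..<i})"
  "\<sigma> \<in> shuffle_perms i j \<Longrightarrow> map \<sigma> [i..<i + j] = sorted_list_of_set ({..<i + j} - \<sigma> ` {..<i})"
proof -
  have map1: "map \<sigma> [0..<i] = sorted_list_of_set (\<sigma> ` {..<i})"
    and map2: "map \<sigma> [i..<i + j] = sorted_list_of_set ({..<i + j} - \<sigma> ` {..<i})"
    if \<sigma>: "\<sigma> \<in> shuffle_perms i j" for \<sigma>
  proof -
    have perm: "\<sigma> permutes {..<i + j}"
      and mono: "strict_mono_on {..<i} \<sigma>" "strict_mono_on {i..<i + j} \<sigma>"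
      using \<sigma> by (auto simp: shuffle_perms_def)
    have inj: "inj \<sigma>"
      using perm by (rule permutes_inj)
    have "sorted_wrt (<) (map \<sigma> [0..<i])" "sorted_wrt (<) (map \<sigma> [i..<i + j])"
      using mono by (auto simp: sorted_wrt_iff_nth_less strict_mono_on_def)
    then have srt: "sorted (map \<sigma> [0..<i])" "distinct (map \<sigma> [0..<i])"
       "sorted (map \<sigma> [i..<i + j])" "distinct (map \<sigma> [i..<i + j])"
      by (simp_all add: strict_sorted_iff)
    show "map \<sigma> [0..<i] = sorted_list_of_set (\<sigma> ` {..<i})"
      using srt by (intro sorted_distinct_set_unique) (auto simp: atLeast0LessThan)
    have "{i..<i + j} = {..<i + j} - {..<i}"
      by auto
    then have "\<sigma> ` {i..<i + j} = {..<i + j} - \<sigma> ` {..<i}"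
      using permutes_image[OF perm] image_set_diff[OF inj, of "{..<i + j}" "{..<i}"] by simp
    then show "map \<sigma> [i..<i + j] = sorted_list_of_set ({..<i + j} - \<sigma> ` {..<i})"
      using srt by (intro sorted_distinct_set_unique) (auto simp: atLeast0LessThan)
  qed
  then show "\<sigma> \<in> shuffle_perms i j \<Longrightarrow> map \<sigma> [0..<i] = sorted_list_of_set (\<sigma> ` {..<i})"
    "\<sigma> \<in> shuffle_perms i j \<Longrightarrow> map \<sigma> [i..<i + j] = sorted_list_of_set ({..<i + j} - \<sigma> ` {..<i})"
    by blast+
  show "bij_betw ?f ?S ?T"
    unfolding bij_betw_def
  proof (intro conjI equalityI subsetI)
    show "inj_on ?f ?S"
    proof (rule inj_onI)
      fix \<sigma> \<tau> assume st: "\<sigma> \<in> ?S" "\<tau> \<in> ?S" "?f \<sigma> = ?f \<tau>"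
      have "map \<sigma> ([0..<i] @ [i..<i + j]) = map \<tau> ([0..<i] @ [i..<i + j])"
        using map1[OF st(1)] map1[OF st(2)] map2[OF st(1)] map2[OF st(2)] st(3) by simp
      then have "\<sigma> x = \<tau> x" if "x < i + j" for x
        using that by (auto simp: map_eq_conv)
      moreover have "\<sigma> x = \<tau> x" if "\<not> x < i + j" for x
        using st that by (auto simp: shuffle_perms_def permutes_def)
      ultimately show "\<sigma> = \<tau>"
        by (intro ext) blast
    qed
  next
    fix A assume "A \<in> ?f ` ?S"
    then obtain \<sigma> where \<sigma>: "\<sigma> \<in> ?S" "A = ?f \<sigma>"
      by blast
    have perm: "\<sigma> permutes {..<i + j}"
      using \<sigma> by (auto simp: shuffle_perms_def)
    have "?f \<sigma> \<subseteq> {..<i + j}"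
      using permutes_image[OF perm] by fastforce
    moreover have "card (?f \<sigma>) = i"
      using permutes_inj[OF perm] by (subst card_image) (auto intro: inj_on_subset)
    ultimately show "A \<in> ?T"
      using \<sigma> by simp
  next
    fix A assume "A \<in> ?T"
    then have A: "A \<subseteq> {..<i + j}" "card A = i" "finite A"
      using finite_subset by auto
    define B where "B = {..<i + j} - A"
    have B: "finite B" "card B = j"
      using A by (simp_all add: B_def card_Diff_subset)
    define L where "L = sorted_list_of_set A @ sorted_list_of_set B"
    have AB: "A \<union> B = {..<i + j}" "A \<inter> B = {}"
      using A(1) by (auto simp: B_def)
    have L: "length L = i + j" "set L = {..<i + j}" "distinct L"
      using A(2,3) B AB by (simp_all add: L_def)
    define \<sigma> where "\<sigma> x = (if x < i + j then L ! x else x)" for x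
    have "bij_betw (nth L) {..<i + j} {..<i + j}"
      by (rule bij_betw_nth) (simp_all add: L)
    then have "bij_betw \<sigma> {..<i + j} {..<i + j}"
      by (rule bij_betw_cong[THEN iffD1, rotated]) (simp add: \<sigma>_def)
    then have "\<sigma> permutes {..<i + j}"
      by (rule bij_imp_permutes) (simp add: \<sigma>_def)
    moreover have "strict_mono_on {..<i} \<sigma>"
    proof (rule strict_mono_onI)
      fix r s assume "r \<in> {..<i}" "s \<in> {..<i}" "r < s"
      then show "\<sigma> r < \<sigma> s"
        using A sorted_wrt_nth_less[OF strict_sorted_list_of_set[of A], of r s]
        by (simp add: \<sigma>_def L_def nth_append)
    qed
    moreover have "strict_mono_on {i..<i + j} \<sigma>"
    proof (rule strict_mono_onI)
      fix r s assume "r \<in> {i..<i + j}" "s \<in> {i..<i + j}" "r < s"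
      then show "\<sigma> r < \<sigma> s"
        using A B sorted_wrt_nth_less[OF strict_sorted_list_of_set[of B], of "r - i" "s - i"]
        by (simp add: \<sigma>_def L_def nth_append)
    qed
    ultimately have "\<sigma> \<in> ?S"
      by (simp add: shuffle_perms_def)
    moreover have "A = ?f \<sigma>"
    proof -
      have "set (sorted_list_of_set A) = nth (sorted_list_of_set A) ` {..<i}"
        using A by (metis length_sorted_list_of_set nth_image take_all_iff le_refl atLeast0LessThan)
      also have "\<dots> = ?f \<sigma>"
        using A by (intro image_cong) (simp_all add: \<sigma>_def L_def nth_append)
      finally show ?thesis
        using A by simp
    qed
    ultimately show "A \<in> ?f ` ?S"
      by blast
  qed
qed

text \<open>
  The inversions of a shuffle pair an element of the first block with one of the second.
\<close>

lemma koszul_sign_shuffle_perms: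
  assumes "\<sigma> \<in> shuffle_perms i j"
  shows "koszul_sign (i + j) d \<sigma> =
    (if odd (crossing_degree d (\<sigma> ` {..<i}) ({..<i + j} - \<sigma> ` {..<i})) then -1 else 1)"
proof -
  have perm: "\<sigma> permutes {..<i + j}"
    and mono: "strict_mono_on {..<i} \<sigma>" "strict_mono_on {i..<i + j} \<sigma>"
    using assms by (auto simp: shuffle_perms_def)
  have inj: "inj \<sigma>"
    using perm by (rule permutes_inj)
  have compl: "{..<i + j} - \<sigma> ` {..<i} = \<sigma> ` {i..<i + j}"
  proof -
    have "{i..<i + j} = {..<i + j} - {..<i}"
      by auto
    then show ?thesis
      using permutes_image[OF perm] image_set_diff[OF inj, of "{..<i + j}" "{..<i}"] by simp
  qed
  have inv: "x < i \<and> i \<le> y" if "x < y" "y < i + j" "\<sigma> y < \<sigma> x" for x y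
  proof (rule ccontr)
    assume "\<not> (x < i \<and> i \<le> y)"
    then have "\<sigma> x < \<sigma> y"
      using that strict_mono_onD[OF mono(1), of x y] strict_mono_onD[OF mono(2), of x y] by auto
    with that show False
      by simp
  qed
  let ?C = "{(a, b). a \<in> \<sigma> ` {..<i} \<and> b \<in> \<sigma> ` {i..<i + j} \<and> b < a}"
  have img: "?C = map_prod \<sigma> \<sigma> ` inversions (i + j) \<sigma>"
    using inv by (fastforce simp: inversions_def)
  have "koszul_sign (i + j) d \<sigma> =
      (\<Prod>(x, y)\<in>inversions (i + j) \<sigma>. if odd (d (\<sigma> x) * d (\<sigma> y)) then -1 else 1)"
    by (simp add: koszul_sign_def inversions_def)
  also have "\<dots> = (\<Prod>(a, b)\<in>?C. if odd (d a * d b) then -1 else 1)"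
    unfolding img by (subst prod.reindex)
      (auto intro: inj_on_subset[OF prod.inj_map[OF inj inj]] simp: case_prod_unfold)
  also have "\<dots> = (if odd (\<Sum>(a, b)\<in>?C. d a * d b) then -1 else 1)"
  proof -
    have "finite C \<Longrightarrow> (\<Prod>(a, b)\<in>C. if odd (d a * d b) then -1 else 1 :: int) =
      (if odd (\<Sum>(a, b)\<in>C. d a * d b) then -1 else 1)" for C
      by (induction C rule: finite_induct) (auto simp del: even_mult_iff)
    then show ?thesis
      using finite_crossings[of "\<sigma> ` {..<i}" "\<sigma> ` {i..<i + j}"] by blast
  qed
  finally show ?thesis
    unfolding compl crossing_degree_def .
qed

context vector_space
begin

lemma scale_sign: "scale (of_int (if odd z then -1 else 1)) v = signed z v"
  by (simp add: signed_def)

lemma scale_minus_one_power: "scale ((- 1) ^ n) v = signed (int n) v"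
  by (simp add: signed_def)

text \<open>
  Both sides are sums over the subsets of size \<open>i\<close>. Working with positions rather than with the
  entries themselves makes the increasing list \<open>[0..<i + j]\<close> available even if entries repeat.
\<close>

lemma sum_shuffle_perms:
  "(\<Sum>\<sigma>\<in>shuffle_perms i j. scale (of_int (koszul_sign (i + j) d \<sigma>))
      (F (map \<sigma> [0..<i]) (map \<sigma> [i..<i + j]))) =
   split_sum d (\<lambda>U W. if length U = i then F U W else 0) [0..<i + j]"
proof -
  let ?n = "{..<i + j}"
  let ?G = "\<lambda>A. signed (crossing_degree d A (?n - A))
    (F (sorted_list_of_set A) (sorted_list_of_set (?n - A)))"
  have "split_sum d (\<lambda>U W. if length U = i then F U W else 0) [0..<i + j] =
      (\<Sum>A\<in>Pow ?n. if card A = i then ?G A else 0)"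
    by (subst split_sum_eq_sum_Pow)
      (auto simp: atLeast0LessThan finite_subset intro!: sum.cong)
  also have "\<dots> = (\<Sum>A\<in>{A. A \<subseteq> ?n \<and> card A = i}. ?G A)"
    by (intro sum.mono_neutral_cong_right) auto
  also have "\<dots> = (\<Sum>\<sigma>\<in>shuffle_perms i j. ?G (\<sigma> ` {..<i}))"
    by (rule sum.reindex_bij_betw[symmetric, OF bij_betw_shuffle_perms])
  also have "\<dots> = (\<Sum>\<sigma>\<in>shuffle_perms i j. scale (of_int (koszul_sign (i + j) d \<sigma>))
      (F (map \<sigma> [0..<i]) (map \<sigma> [i..<i + j])))"
    by (intro sum.cong refl)
      (simp add: koszul_sign_shuffle_perms map_shuffle_perms scale_sign[symmetric] del: of_int_minus)
  finally show ?thesis ..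
qed

end

section \<open>Derived brackets in a bigraded Lie algebra\<close>

text \<open>
  The first index of \<open>B i k\<close> is the degree, which governs all signs; the second one is a weight,
  which is additive for the bracket but does not enter any sign. The set \<open>C\<close> contains sums of
  elements of different degrees as well, for which only bilinearity is available. As the weights are
  bounded below by \<open>-1\<close>, the part of weight \<open>-1\<close> is an abelian subalgebra, and it is this part that
  is going to carry an \<open>L\<^sub>\<infinity>\<close>-structure.
\<close>

locale bigraded_Lie_algebra = vector_space scale
  for scale :: "'k::field_char_0 \<Rightarrow> 'h::ab_group_add \<Rightarrow> 'h" +
  fixes C :: "'h set" and B :: "int \<Rightarrow> int \<Rightarrow> 'h set" and br :: "'h \<Rightarrow> 'h \<Rightarrow> 'h"
  assumes subspace_C: "subspace C"
    and subspace_B: "subspace (B i k)"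
    and B_subset_C: "B i k \<subseteq> C"
    and B_independent:
      "\<lbrakk>finite I; \<And>i. i \<in> I \<Longrightarrow> f i \<in> B i k; (\<Sum>i\<in>I. f i) = 0; i \<in> I\<rbrakk> \<Longrightarrow> f i = 0"
    and B_low_weight: "\<lbrakk>k \<le> - 2; x \<in> B i k\<rbrakk> \<Longrightarrow> x = 0"
    and br_closed: "\<lbrakk>x \<in> C; y \<in> C\<rbrakk> \<Longrightarrow> br x y \<in> C"
    and br_add_left: "\<lbrakk>x \<in> C; x' \<in> C; y \<in> C\<rbrakk> \<Longrightarrow> br (x + x') y = br x y + br x' y"
    and br_add_right: "\<lbrakk>x \<in> C; y \<in> C; y' \<in> C\<rbrakk> \<Longrightarrow> br x (y + y') = br x y + br x y'"
    and br_scale_left: "\<lbrakk>x \<in> C; y \<in> C\<rbrakk> \<Longrightarrow> br (scale c x) y = scale c (br x y)"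
    and br_scale_right: "\<lbrakk>x \<in> C; y \<in> C\<rbrakk> \<Longrightarrow> br x (scale c y) = scale c (br x y)"
    and br_B: "\<lbrakk>x \<in> B i k; y \<in> B j l\<rbrakk> \<Longrightarrow> br x y \<in> B (i + j) (k + l)"
    and br_antisym: "\<lbrakk>x \<in> B i k; y \<in> B j l\<rbrakk> \<Longrightarrow> br x y = - signed (i * j) (br y x)"
    and br_jacobi: "\<lbrakk>x \<in> B i k; y \<in> B j l; z \<in> B m n\<rbrakk>
      \<Longrightarrow> br (br x y) z = br x (br y z) + signed (j * m) (br (br x z) y)"
begin

lemma B_in_C: "x \<in> B i k \<Longrightarrow> x \<in> C"
  using B_subset_C by blast

lemma signed_eq_scale: "signed z x = scale (if even z then 1 else - 1) x"
  by (simp add: signed_def)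

lemma C_zero [simp]: "0 \<in> C" and C_add: "x \<in> C \<Longrightarrow> y \<in> C \<Longrightarrow> x + y \<in> C"
  and C_scale: "x \<in> C \<Longrightarrow> scale c x \<in> C"
  using subspace_C by (auto simp: subspace_def)

lemma C_signed: "x \<in> C \<Longrightarrow> signed z x \<in> C"
  by (simp add: signed_eq_scale C_scale)

lemma br_zero [simp]: "x \<in> C \<Longrightarrow> br 0 x = 0" "x \<in> C \<Longrightarrow> br x 0 = 0"
  using br_scale_left[of 0 x 0] br_scale_right[of x 0 0] by simp_all

lemma br_weight_minus_one: "x \<in> B i (- 1) \<Longrightarrow> y \<in> B j (- 1) \<Longrightarrow> br x y = 0"
  using br_B[of x i "-1" y j "-1"] B_low_weight[of "-2"] by simp

lemma foldl_br_C: "u \<in> C \<Longrightarrow> set xs \<subseteq> C \<Longrightarrow> foldl br u xs \<in> C"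
  by (induction xs arbitrary: u) (auto simp: br_closed)

lemma foldl_br_zero: "set xs \<subseteq> C \<Longrightarrow> foldl br 0 xs = 0"
  by (induction xs) auto

lemma foldl_br_add:
  "\<lbrakk>u \<in> C; v \<in> C; set xs \<subseteq> C\<rbrakk> \<Longrightarrow> foldl br (u + v) xs = foldl br u xs + foldl br v xs"
  by (induction xs arbitrary: u v) (auto simp: br_add_left br_closed)

lemma foldl_br_scale:
  "\<lbrakk>u \<in> C; set xs \<subseteq> C\<rbrakk> \<Longrightarrow> foldl br (scale c u) xs = scale c (foldl br u xs)"
  by (induction xs arbitrary: u) (auto simp: br_scale_left br_closed)

lemma foldl_br_signed:
  "\<lbrakk>u \<in> C; set xs \<subseteq> C\<rbrakk> \<Longrightarrow> foldl br (signed z u) xs = signed z (foldl br u xs)"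
  by (simp only: signed_eq_scale foldl_br_scale)

lemma foldl_br_sum:
  "\<lbrakk>\<And>i. i \<in> I \<Longrightarrow> u i \<in> C; set xs \<subseteq> C\<rbrakk>
    \<Longrightarrow> foldl br (\<Sum>i\<in>I. u i) xs = (\<Sum>i\<in>I. foldl br (u i) xs)"
proof (induction I rule: infinite_finite_induct)
  case (insert i I)
  have "(\<Sum>i\<in>I. u i) \<in> C"
    using insert subspace_sum[OF subspace_C, of I u] by simp
  with insert show ?case
    by (simp add: foldl_br_add)
qed (simp_all add: foldl_br_zero)

lemma foldl_br_B:
  "\<lbrakk>u \<in> B i k; \<And>m. m \<in> set U \<Longrightarrow> a m \<in> B (d m) (- 1)\<rbrakk>
    \<Longrightarrow> foldl br u (map a U) \<in> B (i + sum_list (map d U)) (k - int (length U))"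
proof (induction U arbitrary: u i k)
  case (Cons m U)
  have "br u (a m) \<in> B (i + d m) (k + - 1)"
    using Cons.prems by (intro br_B) auto
  from Cons.IH[OF this] Cons.prems show ?case
    by (simp add: algebra_simps)
qed simp

text \<open>
  The Leibniz rule for iterated brackets: each of the elements \<open>a m\<close> is absorbed either by \<open>u\<close> or
  by \<open>v\<close>, and those that go to \<open>u\<close> have to be moved past \<open>v\<close>.
\<close>

lemma foldl_br_of_br:
  assumes "u \<in> B i k" "v \<in> B j l" "\<And>m. m \<in> set xs \<Longrightarrow> a m \<in> B (d m) (- 1)"
  shows "foldl br (br u v) (map a xs) =
    split_sum d (\<lambda>U W. signed (j * sum_list (map d U))
      (br (foldl br u (map a U)) (foldl br v (map a W)))) xs"
  using assms
proof (induction xs arbitrary: u v i j k l)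
  case (Cons m xs)
  have am: "a m \<in> B (d m) (- 1)"
    using Cons.prems by simp
  have sub: "set (map a xs) \<subseteq> C"
    using Cons.prems B_in_C by fastforce
  have C: "u \<in> C" "v \<in> C" "a m \<in> C"
    using Cons.prems am B_in_C by blast+
  have "foldl br (br u v) (map a (m # xs)) =
      foldl br (br u (br v (a m)) + signed (j * d m) (br (br u (a m)) v)) (map a xs)"
    using br_jacobi[OF Cons.prems(1,2) am] by simp
  also have "\<dots> = foldl br (br u (br v (a m))) (map a xs)
      + signed (j * d m) (foldl br (br (br u (a m)) v) (map a xs))"
    using C sub by (simp add: foldl_br_add foldl_br_signed br_closed C_signed)
  also have "foldl br (br u (br v (a m))) (map a xs) =
    split_sum d (\<lambda>U W. signed (d m * sum_list (map d U)) (signed (j * sum_list (map d U))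
      (br (foldl br u (map a U)) (foldl br v (map a (m # W)))))) xs"
    using Cons.IH[OF Cons.prems(1) br_B[OF Cons.prems(2) am]] Cons.prems(3)
    by (simp add: signed_signed algebra_simps)
  also have "foldl br (br (br u (a m)) v) (map a xs) =
    split_sum d (\<lambda>U W. signed (j * sum_list (map d U))
      (br (foldl br u (map a (m # U))) (foldl br v (map a W)))) xs"
    using Cons.IH[OF br_B[OF Cons.prems(1) am] Cons.prems(2)] Cons.prems(3) by simp
  finally show ?case
    by (simp add: split_sum_signed signed_signed algebra_simps)
qed simp

text \<open>
  Elements of weight \<open>-1\<close> commute with each other, so the last one can be moved to the front.
\<close>

lemma br_foldl_br:
  assumes "u \<in> B i k" "x \<in> B e (- 1)" "\<And>m. m \<in> set W \<Longrightarrow> a m \<in> B (d m) (- 1)"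
  shows "br (foldl br u (map a W)) x = signed (e * sum_list (map d W)) (foldl br (br u x) (map a W))"
  using assms
proof (induction W arbitrary: u i k)
  case (Cons m W)
  have am: "a m \<in> B (d m) (- 1)"
    using Cons.prems by simp
  have sub: "set (map a W) \<subseteq> C"
    using Cons.prems B_in_C by fastforce
  have C: "u \<in> C" "x \<in> C" "a m \<in> C"
    using Cons.prems am B_in_C by blast+
  have "br (br u (a m)) x = signed (d m * e) (br (br u x) (a m))"
    using br_jacobi[OF Cons.prems(1) am Cons.prems(2)] br_weight_minus_one[OF am Cons.prems(2)] C
    by simp
  then show ?case
    using Cons.IH[OF br_B[OF Cons.prems(1) am] Cons.prems(2)] Cons.prems(3) sub C
    by (simp add: foldl_br_signed br_closed signed_signed algebra_simps)
qed simp

end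

text \<open>
  The equations say that \<open>\<Sum>a. \<delta> a\<close> is a Maurer-Cartan element, the \<open>m\<close>-th one being the component
  of weight \<open>m\<close>. Splitting by weight avoids infinite sums and a projection onto weight \<open>-1\<close>.
\<close>

locale Maurer_Cartan_family = bigraded_Lie_algebra scale C B br
  for scale :: "'k::field_char_0 \<Rightarrow> 'h::ab_group_add \<Rightarrow> 'h"
    and C :: "'h set" and B :: "int \<Rightarrow> int \<Rightarrow> 'h set" and br :: "'h \<Rightarrow> 'h \<Rightarrow> 'h" +
  fixes \<delta> :: "nat \<Rightarrow> 'h"
  assumes \<delta>_B: "\<delta> a \<in> B 1 (int a)"
    and Maurer_Cartan: "(\<Sum>a\<le>m. br (\<delta> a) (\<delta> (m - a))) = 0"
begin

text \<open>
  Each of the \<open>k\<close> arguments lowers the weight by one, so the component of weight \<open>k - 1\<close> of the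
  Maurer-Cartan element is the one that leads back to weight \<open>-1\<close>.
\<close>

definition derived :: "'h list \<Rightarrow> 'h" where
  "derived xs = foldl br (\<delta> (length xs - 1)) xs"

lemma derived_B:
  assumes "\<And>m. m \<in> set U \<Longrightarrow> a m \<in> B (d m) (- 1)" "U \<noteq> []"
  shows "derived (map a U) \<in> B (1 + sum_list (map d U)) (- 1)"
proof -
  have "int (length U - 1) - int (length U) = - 1"
    using assms(2) by (cases U) auto
  then show ?thesis
    using foldl_br_B[where a = a and d = d and U = U, OF \<delta>_B assms(1), of "length U - 1"]
    by (simp add: derived_def)
qed

text \<open>
  The inner operation is an element of weight \<open>-1\<close>. It can be moved to the end and then, by
  antisymmetry, to the left of the remaining bracket.
\<close>

lemma derived_Cons_derived:
  assumes U: "\<And>m. m \<in> set U \<Longrightarrow> a m \<in> B (d m) (- 1)" "U \<noteq> []"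
    and W: "\<And>m. m \<in> set W \<Longrightarrow> a m \<in> B (d m) (- 1)"
  shows "derived (derived (map a U) # map a W) = signed (sum_list (map d U))
    (br (derived (map a U)) (foldl br (\<delta> (length W)) (map a W)))"
proof -
  let ?x = "derived (map a U)" and ?N = "foldl br (\<delta> (length W)) (map a W)"
  let ?e = "1 + sum_list (map d U)"
  have x: "?x \<in> B ?e (- 1)"
    using derived_B[OF U] .
  have N: "?N \<in> B (1 + sum_list (map d W)) (int (length W) - int (length W))"
    by (intro foldl_br_B \<delta>_B W)
  have "derived (?x # map a W) = foldl br (br (\<delta> (length W)) ?x) (map a W)"
    by (simp add: derived_def[of "_ # _"])
  also have "\<dots> = signed (?e * sum_list (map d W)) (br ?N ?x)"
    by (subst br_foldl_br[where a = a and d = d, OF \<delta>_B x W]) (simp_all add: signed_def)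
  also have "br ?N ?x = - signed ((1 + sum_list (map d W)) * ?e) (br ?x ?N)"
    using br_antisym[OF N x] .
  finally show ?thesis
    by (auto simp: signed_def)
qed

text \<open>
  Take the iterated bracket of the equation \<open>\<Sum>b\<le>n. [\<delta> b, \<delta> (n - b)] = 0\<close> with all \<open>n + 1\<close>
  arguments. In the Leibniz expansion, a splitting \<open>(U, W)\<close> of the arguments leaves the weights
  \<open>b - |U|\<close> and \<open>n - b - |W|\<close> for the two factors. These add up to \<open>-1\<close> and neither can be below
  \<open>-1\<close>, hence one factor has weight \<open>-1\<close> and the other weight \<open>0\<close>. The two cases contribute the
  same by the symmetry of the bracket, and either of them is the sum over the nested operations.
\<close>

lemma derived_jacobi:
  assumes a: "\<And>m. m \<in> set xs \<Longrightarrow> a m \<in> B (d m) (- 1)"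
  shows "split_sum d (\<lambda>U W. if U \<noteq> [] then derived (derived (map a U) # map a W) else 0) xs = 0"
    (is "?J = 0")
proof (cases "xs = []")
  case False
  define n where "n = length xs - 1"
  have n: "length xs = Suc n"
    using False by (simp add: n_def)
  have sub: "set (map a xs) \<subseteq> C"
    using a B_in_C by fastforce
  define E\<^sub>1 where "E\<^sub>1 U W = (if U \<noteq> [] then signed (sum_list (map d U))
    (br (derived (map a U)) (foldl br (\<delta> (length W)) (map a W))) else 0)" for U W
  define E\<^sub>2 where "E\<^sub>2 U W = (if W \<noteq> [] then signed (sum_list (map d U))
    (br (foldl br (\<delta> (length U)) (map a U)) (derived (map a W))) else 0)" for U W
  have "0 = foldl br (\<Sum>b\<le>n. br (\<delta> b) (\<delta> (n - b))) (map a xs)"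
    using Maurer_Cartan sub by (simp add: foldl_br_zero)
  also have "\<dots> = (\<Sum>b\<le>n. foldl br (br (\<delta> b) (\<delta> (n - b))) (map a xs))"
    using sub by (intro foldl_br_sum) (auto intro: br_closed B_in_C[OF \<delta>_B])
  also have "\<dots> = split_sum d (\<lambda>U W. \<Sum>b\<le>n. signed (1 * sum_list (map d U))
      (br (foldl br (\<delta> b) (map a U)) (foldl br (\<delta> (n - b)) (map a W)))) xs"
    by (simp add: split_sum_sum foldl_br_of_br[where a = a and d = d and xs = xs, OF \<delta>_B \<delta>_B a])
  also have "\<dots> = split_sum d (\<lambda>U W. E\<^sub>1 U W + E\<^sub>2 U W) xs"
  proof (intro split_sum_cong)
    fix U W assume UW: "set U \<subseteq> set xs" "set W \<subseteq> set xs" "length U + length W = length xs"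
    let ?f = "\<lambda>b. signed (sum_list (map d U))
      (br (foldl br (\<delta> b) (map a U)) (foldl br (\<delta> (n - b)) (map a W)))"
    have aU: "\<And>m. m \<in> set U \<Longrightarrow> a m \<in> B (d m) (- 1)" and aW: "\<And>m. m \<in> set W \<Longrightarrow> a m \<in> B (d m) (- 1)"
      using UW a by auto
    have UB: "foldl br (\<delta> b) (map a U) \<in> B (1 + sum_list (map d U)) (int b - int (length U))" for b
      by (intro foldl_br_B \<delta>_B aU)
    have WB: "foldl br (\<delta> b) (map a W) \<in> B (1 + sum_list (map d W)) (int b - int (length W))" for b
      by (intro foldl_br_B \<delta>_B aW)
    \<comment> \<open>For all other \<open>b\<close>, one of the two factors would have weight at most \<open>-2\<close>.\<close>
    have zero: "?f b = 0" if "b \<le> n" "b + 1 \<noteq> length U" "b \<noteq> length U" for b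
    proof (cases "b < length U")
      case True
      then have "foldl br (\<delta> b) (map a U) = 0"
        using that by (intro B_low_weight[OF _ UB]) auto
      then show ?thesis
        using B_in_C[OF WB] by simp
    next
      case False
      then have "foldl br (\<delta> (n - b)) (map a W) = 0"
        using that UW(3) n by (intro B_low_weight[OF _ WB]) auto
      then show ?thesis
        using B_in_C[OF UB] by simp
    qed
    have "(\<Sum>b\<le>n. ?f b) = (\<Sum>b\<in>{b. b \<le> n \<and> (b + 1 = length U \<or> b = length U)}. ?f b)"
      using zero by (intro sum.mono_neutral_right) auto
    also have "{b. b \<le> n \<and> (b + 1 = length U \<or> b = length U)} =
        (if U \<noteq> [] then {length U - 1} else {}) \<union> (if W \<noteq> [] then {length U} else {})"
      using UW(3) n by (cases U; cases W) auto
    also have "(\<Sum>b\<in>\<dots>. ?f b) =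
        (\<Sum>b\<in>(if U \<noteq> [] then {length U - 1} else {}). ?f b) + (\<Sum>b\<in>(if W \<noteq> [] then {length U} else {}). ?f b)"
      by (intro sum.union_disjoint) (auto simp: neq_Nil_conv)
    also have "(\<Sum>b\<in>(if U \<noteq> [] then {length U - 1} else {}). ?f b) = E\<^sub>1 U W"
    proof (cases U)
      case (Cons _ U')
      then have "n - length U' = length W"
        using UW(3) n by simp
      with Cons show ?thesis
        by (simp add: E\<^sub>1_def derived_def)
    qed (simp add: E\<^sub>1_def)
    also have "(\<Sum>b\<in>(if W \<noteq> [] then {length U} else {}). ?f b) = E\<^sub>2 U W"
    proof (cases W)
      case (Cons _ W')
      then have "n - length U = length W'"
        using UW(3) n by simp
      with Cons show ?thesis
        by (simp add: E\<^sub>2_def derived_def)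
    qed (simp add: E\<^sub>2_def)
    finally show "(\<Sum>b\<le>n. signed (1 * sum_list (map d U))
      (br (foldl br (\<delta> b) (map a U)) (foldl br (\<delta> (n - b)) (map a W)))) = E\<^sub>1 U W + E\<^sub>2 U W"
      by simp
  qed
  also have "\<dots> = split_sum d E\<^sub>1 xs + split_sum d E\<^sub>2 xs"
    by (rule split_sum_add)
  \<comment> \<open>The sign of exchanging \<open>U\<close> and \<open>W\<close> combines with the one from antisymmetry, where both
    factors have degree one more than their arguments.\<close>
  also have "split_sum d E\<^sub>2 xs = split_sum d E\<^sub>1 xs"
    unfolding split_sum_swap[of d E\<^sub>2]
  proof (intro split_sum_cong)
    fix U W assume UW: "set U \<subseteq> set xs" "set W \<subseteq> set xs"
    show "signed (sum_list (map d U) * sum_list (map d W)) (E\<^sub>2 W U) = E\<^sub>1 U W"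
    proof (cases "U = []")
      case False
      have N: "foldl br (\<delta> (length W)) (map a W) \<in> B (1 + sum_list (map d W)) (int (length W) - int (length W))"
        using a UW by (intro foldl_br_B \<delta>_B) auto
      have "derived (map a U) \<in> B (1 + sum_list (map d U)) (- 1)"
        using a UW False by (intro derived_B) auto
      from br_antisym[OF N this] False show ?thesis
        by (auto simp: E\<^sub>1_def E\<^sub>2_def signed_def)
    qed (simp add: E\<^sub>1_def E\<^sub>2_def)
  qed
  also have "split_sum d E\<^sub>1 xs = ?J"
  proof (intro split_sum_cong)
    fix U W assume "set U \<subseteq> set xs" "set W \<subseteq> set xs"
    then have "\<And>m. m \<in> set U \<Longrightarrow> a m \<in> B (d m) (- 1)" "\<And>m. m \<in> set W \<Longrightarrow> a m \<in> B (d m) (- 1)"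
      using a by auto
    then show "E\<^sub>1 U W = (if U \<noteq> [] then derived (derived (map a U) # map a W) else 0)"
      using derived_Cons_derived[where a = a and d = d and U = U and W = W] by (simp add: E\<^sub>1_def)
  qed
  finally have "scale 2 ?J = 0"
    using scale_left_distrib[of 1 1 ?J] by simp
  then show ?thesis
    by simp
qed simp

lemma derived_swap:
  assumes "set pre \<subseteq> C" "x \<in> B i (- 1)" "y \<in> B j (- 1)" "set post \<subseteq> C"
    "\<And>m. m \<in> set pre \<Longrightarrow> \<exists>e. m \<in> B e (- 1)"
  shows "derived (pre @ x # y # post) = signed (i * j) (derived (pre @ y # x # post))"
proof -
  define n where "n = length pre + Suc (length post)"
  obtain e where "\<And>m. m \<in> set pre \<Longrightarrow> m \<in> B (e m) (- 1)"
    using assms(5) by metis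
  then have "foldl br (\<delta> n) (map id pre) \<in> B (1 + sum_list (map e pre)) (int n - int (length pre))"
    by (intro foldl_br_B \<delta>_B) auto
  then obtain p q where w: "foldl br (\<delta> n) pre \<in> B p q"
    by auto
  have "br (br (foldl br (\<delta> n) pre) x) y = signed (i * j) (br (br (foldl br (\<delta> n) pre) y) x)"
    using br_jacobi[OF w assms(2,3)] br_weight_minus_one[OF assms(2,3)] B_in_C[OF w] by simp
  then show ?thesis
    using assms(1,4) B_in_C[OF w] B_in_C[OF assms(2)] B_in_C[OF assms(3)]
    by (simp add: derived_def n_def foldl_br_signed br_closed)
qed

text \<open>
  Higher derived brackets: the operations \<open>[\<dots>[\<delta> (k - 1), x\<^sub>1], \<dots>, x\<^sub>k]\<close> on the abelian part. They are
  graded symmetric because neighbouring arguments commute, and they satisfy the generalized Jacobi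
  identities by the Maurer-Cartan equations.
\<close>

lemma L_infinity_derived:
  fixes l
  assumes l: "\<And>xs. xs \<noteq> [] \<Longrightarrow> set xs \<subseteq> C \<Longrightarrow> l xs = derived xs"
  shows "L_infinity_algebra scale (\<lambda>i. B i (- 1)) l"
proof -
  interpret graded_vector_space scale "\<lambda>i. B i (- 1)"
    by unfold_locales (rule subspace_B, rule B_independent)
  have total: "total_space \<subseteq> C"
    unfolding total_space_def using B_subset_C subspace_C by (intro span_minimal) auto
  have upd: "l (xs[i := y]) =
      foldl br (br (foldl br (\<delta> (length xs - 1)) (take i xs)) y) (drop (Suc i) xs)"
    if "set xs \<subseteq> C" "i < length xs" "y \<in> C" for xs i y
  proof -
    have "set (xs[i := y]) \<subseteq> C" "xs[i := y] \<noteq> []"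
      using that set_update_subset_insert[of xs i y] by auto
    then show ?thesis
      using that by (simp add: l derived_def upd_conv_take_nth_drop)
  qed
  have pre: "foldl br (\<delta> (length xs - 1)) (take i xs) \<in> C" if "set xs \<subseteq> C" for xs i
    using that set_take_subset[of i xs] by (intro foldl_br_C B_in_C[OF \<delta>_B]) auto
  have post: "set (drop i xs) \<subseteq> C" if "set xs \<subseteq> C" for xs i
    using that set_drop_subset[of i xs] by auto
  have xs_C: "set xs \<subseteq> C" if "\<And>i. i < length xs \<Longrightarrow> xs ! i \<in> B (d i) (- 1)" for xs d
    using that B_in_C by (fastforce simp: in_set_conv_nth)
  have map_nth_C: "set (map ((!) xs) U) \<subseteq> C"
    if "\<And>i. i < length xs \<Longrightarrow> xs ! i \<in> B (d i) (- 1)" "set U \<subseteq> {..<length xs}" for xs d U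
    using that B_in_C by fastforce
  show ?thesis
  proof unfold_locales
    fix xs i y z assume "set xs \<subseteq> total_space" "i < length xs" "y \<in> total_space" "z \<in> total_space"
    then have xs: "set xs \<subseteq> C" "i < length xs" "y \<in> C" "z \<in> C"
      using total by auto
    show "l (xs[i := y + z]) = l (xs[i := y]) + l (xs[i := z])"
      using xs pre[OF xs(1)] post[OF xs(1)]
      by (simp add: upd C_add br_add_right foldl_br_add br_closed)
  next
    fix xs i y c assume "set xs \<subseteq> total_space" "i < length xs" "y \<in> total_space"
    then have xs: "set xs \<subseteq> C" "i < length xs" "y \<in> C"
      using total by auto
    show "l (xs[i := scale c y]) = scale c (l (xs[i := y]))"
      using xs pre[OF xs(1)] post[OF xs(1)]
      by (simp add: upd C_scale br_scale_right foldl_br_scale br_closed)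
  next
    fix xs d assume xs: "xs \<noteq> []" "\<And>i. i < length xs \<Longrightarrow> xs ! i \<in> B (d i) (- 1)"
    have "derived (map ((!) xs) [0..<length xs]) \<in> B (1 + sum_list (map d [0..<length xs])) (- 1)"
      using xs by (intro derived_B) auto
    then have "l xs \<in> B (1 + (\<Sum>i<length xs. d i)) (- 1)"
      using xs xs_C[OF xs(2)] by (simp add: l map_nth interv_sum_list_conv_sum_set_nat atLeast0LessThan)
    then show "l xs \<in> B ((\<Sum>i<length xs. d i) + 1) (- 1)"
      by (simp add: add.commute)
  next
    fix xs d \<sigma>
    assume xs: "xs \<noteq> []" "\<And>i. i < length xs \<Longrightarrow> xs ! i \<in> B (d i) (- 1)" "\<sigma> permutes {..<length xs}"
    let ?n = "length xs"
    have l_perm: "l (permute_list \<sigma> xs) = derived (permute_list \<sigma> xs)" if "\<sigma> permutes {..<?n}" for \<sigma>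
      using xs(1) xs_C[OF xs(2)] set_permute_list[OF that]
      by (intro l) (auto simp: permute_list_def)
    have "derived (permute_list \<sigma> xs) = scale (of_int (koszul_sign ?n d \<sigma>)) (derived xs)"
      using xs(3)
    proof (induction rule: permutes_descent_induct)
      case (descent \<sigma> k)
      let ?a = "\<lambda>i. xs ! \<sigma> i" and ?t = "transpose k (Suc k)"
      have \<sigma>: "\<sigma> i < ?n" if "i < ?n" for i
        using permutes_in_image[OF descent(1)] that by auto
      have upt: "[0..<?n] = [0..<k] @ k # Suc k # [Suc (Suc k)..<?n]"
        using descent(2) by (metis Suc_lessD less_imp_le_nat upt_add_eq_append upt_conv_Cons
            le_add1 le_add_diff_inverse plus_nat.add_0 zero_le)
      have a: "?a i \<in> B (d (\<sigma> i)) (- 1)" if "i < ?n" for i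
        using xs(2) \<sigma> that by blast
      have "permute_list \<sigma> xs = map ?a [0..<k] @ ?a k # ?a (Suc k) # map ?a [Suc (Suc k)..<?n]"
        unfolding permute_list_def upt by simp
      moreover have "permute_list (\<sigma> \<circ> ?t) xs =
          map ?a [0..<k] @ ?a (Suc k) # ?a k # map ?a [Suc (Suc k)..<?n]"
        unfolding permute_list_def upt by (simp add: transpose_def)
      moreover have "derived (map ?a [0..<k] @ ?a k # ?a (Suc k) # map ?a [Suc (Suc k)..<?n]) =
        signed (d (\<sigma> k) * d (\<sigma> (Suc k)))
          (derived (map ?a [0..<k] @ ?a (Suc k) # ?a k # map ?a [Suc (Suc k)..<?n]))"
      proof (rule derived_swap)
        have "?a i \<in> C" if "i < ?n" for i
          using a[OF that] by (rule B_in_C)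
        then show "set (map ?a [0..<k]) \<subseteq> C" "set (map ?a [Suc (Suc k)..<?n]) \<subseteq> C"
          using descent(2) by auto
        show "\<exists>e. m \<in> B e (- 1)" if "m \<in> set (map ?a [0..<k])" for m
        proof -
          obtain i where "i < k" "m = ?a i"
            using \<open>m \<in> set (map ?a [0..<k])\<close> by auto
          then show ?thesis
            using a[of i] descent(2) by auto
        qed
      qed (use a descent(2) in auto)
      ultimately have "derived (permute_list \<sigma> xs) =
          signed (d (\<sigma> k) * d (\<sigma> (Suc k))) (derived (permute_list (\<sigma> \<circ> ?t) xs))"
        by simp
      then show ?case
        unfolding koszul_sign_descent[OF descent(2,3)] descent(4)
        by (simp add: signed_def)
    qed simp
    then show "l (permute_list \<sigma> xs) = scale (of_int (koszul_sign ?n d \<sigma>)) (l xs)"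
      using l_perm[OF xs(3)] xs xs_C[OF xs(2)] by (simp add: l)
  next
    fix xs d assume xs: "xs \<noteq> []" "\<And>i. i < length xs \<Longrightarrow> xs ! i \<in> B (d i) (- 1)"
    let ?n = "length xs" and ?a = "(!) xs"
    define G where "G U W = derived (derived (map ?a U) # map ?a W)" for U W
    have inner: "(\<Sum>\<sigma>\<in>shuffle_perms i (?n - i). scale (of_int (koszul_sign ?n d \<sigma>))
        (l (l (take i (permute_list \<sigma> xs)) # drop i (permute_list \<sigma> xs)))) =
      split_sum d (\<lambda>U W. if length U = i then G U W else 0) [0..<?n]" if i: "i \<in> {1..?n}" for i
    proof -
      have "(\<Sum>\<sigma>\<in>shuffle_perms i (?n - i). scale (of_int (koszul_sign ?n d \<sigma>))
        (l (l (take i (permute_list \<sigma> xs)) # drop i (permute_list \<sigma> xs)))) =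
        (\<Sum>\<sigma>\<in>shuffle_perms i (?n - i). scale (of_int (koszul_sign (i + (?n - i)) d \<sigma>))
          (G (map \<sigma> [0..<i]) (map \<sigma> [i..<i + (?n - i)])))"
      proof (intro sum.cong refl)
        fix \<sigma> assume "\<sigma> \<in> shuffle_perms i (?n - i)"
        then have "\<sigma> permutes {..<?n}"
          using i by (simp add: shuffle_perms_def)
        then have \<sigma>: "\<sigma> k < ?n" if "k < ?n" for k
          using permutes_in_image that by fastforce
        have td: "take i (permute_list \<sigma> xs) = map ?a (map \<sigma> [0..<i])"
          "drop i (permute_list \<sigma> xs) = map ?a (map \<sigma> [i..<?n])"
          using i by (auto simp: permute_list_def take_map drop_map)
        have U: "m < ?n" if "m \<in> set (map \<sigma> [0..<i])" for m
          using that \<sigma> i by auto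
        have W: "m < ?n" if "m \<in> set (map \<sigma> [i..<?n])" for m
          using that \<sigma> i by auto
        have "l (map ?a (map \<sigma> [0..<i])) = derived (map ?a (map \<sigma> [0..<i]))"
          using i U by (intro l map_nth_C[OF xs(2)]) auto
        moreover have "derived (map ?a (map \<sigma> [0..<i])) \<in> B (1 + sum_list (map d (map \<sigma> [0..<i]))) (- 1)"
          using xs U i by (intro derived_B) auto
        ultimately have "l (l (take i (permute_list \<sigma> xs)) # drop i (permute_list \<sigma> xs)) =
            G (map \<sigma> [0..<i]) (map \<sigma> [i..<?n])"
          unfolding td G_def
          using map_nth_C[OF xs(2), of "map \<sigma> [i..<?n]"] W B_in_C by (subst l) auto
        then show "scale (of_int (koszul_sign ?n d \<sigma>))
            (l (l (take i (permute_list \<sigma> xs)) # drop i (permute_list \<sigma> xs))) =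
          scale (of_int (koszul_sign (i + (?n - i)) d \<sigma>))
            (G (map \<sigma> [0..<i]) (map \<sigma> [i..<i + (?n - i)]))"
          using i by simp
      qed
      also have "\<dots> = split_sum d (\<lambda>U W. if length U = i then G U W else 0) [0..<?n]"
        unfolding sum_shuffle_perms using i by simp
      finally show ?thesis .
    qed
    have "(\<Sum>i=1..?n. \<Sum>\<sigma>\<in>shuffle_perms i (?n - i). scale (of_int (koszul_sign ?n d \<sigma>))
        (l (l (take i (permute_list \<sigma> xs)) # drop i (permute_list \<sigma> xs)))) =
      split_sum d (\<lambda>U W. \<Sum>i=1..?n. if length U = i then G U W else 0) [0..<?n]"
      by (subst split_sum_sum) (intro sum.cong refl inner)
    also have "\<dots> = split_sum d (\<lambda>U W. if U \<noteq> [] then G U W else 0) [0..<?n]"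
      by (intro split_sum_cong) (auto simp: Suc_le_eq)
    also have "\<dots> = 0"
      unfolding G_def using xs by (intro derived_jacobi) auto
    finally show "(\<Sum>i=1..?n. \<Sum>\<sigma>\<in>shuffle_perms i (?n - i). scale (of_int (koszul_sign ?n d \<sigma>))
        (l (l (take i (permute_list \<sigma> xs)) # drop i (permute_list \<sigma> xs)))) = 0" .
  qed
qed

end

context bigraded_Lie_algebra
begin

text \<open>
  The components of weight \<open>0\<close>, \<open>1\<close> and \<open>2\<close> of \<open>D + [D, t] + [[D, t], t] / 2\<close>, the image of \<open>D\<close>
  under the exponential of \<open>[\<cdot>, t]\<close>; the next term of the series vanishes for the elements \<open>t\<close> of
  interest.
\<close>

definition twisted_family :: "'h \<Rightarrow> 'h \<Rightarrow> nat \<Rightarrow> 'h" where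
  "twisted_family D t a =
     (if a = 0 then scale (1/2) (br (br D t) t) else if a = 1 then br D t else if a = 2 then D else 0)"

text \<open>
  As \<open>t\<close> has degree zero, \<open>[\<cdot>, t]\<close> is a derivation without signs. Applying it up to four times to
  \<open>[D, D] = 0\<close> yields the Maurer-Cartan equations of all weights, multiplied by nonzero numbers.
\<close>

lemma Maurer_Cartan_twisted_family:
  assumes D: "D \<in> B 1 2" "br D D = 0"
    and t: "t \<in> B 0 (- 1)" "br (br (br D t) t) t = 0"
  shows "Maurer_Cartan_family scale C B br (twisted_family D t)"
proof -
  define E where "E = br D t"
  define F where "F = br E t"
  have E: "E \<in> B 1 1"
    using br_B[OF D(1) t(1)] by (simp add: E_def)
  have F: "F \<in> B 1 0"
    using br_B[OF E t(1)] by (simp add: F_def)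
  have Ft: "br F t = 0"
    using t(2) by (simp add: E_def F_def)
  note DEF = D(1) E F
  have C: "D \<in> C" "E \<in> C" "F \<in> C" "t \<in> C"
    using DEF t(1) B_in_C by blast+
  have der: "br (br u v) t = br u (br v t) + br (br u t) v" if "u \<in> B 1 k" "v \<in> B 1 m" for u v k m
    using br_jacobi[OF that t(1)] by simp
  have sym: "br u v = br v u" if "u \<in> B 1 k" "v \<in> B 1 m" for u v k m
    using br_antisym[OF that] by simp
  have two: "x = 0" if "x + x = 0" for x :: 'h
    using that scale_left_distrib[of 1 1 x] by simp
  have "br D E + br D E = 0"
    using der[OF D(1) D(1)] sym[OF E D(1)] D(2) C by (simp add: E_def[symmetric])
  then have DE: "br D E = 0"
    by (rule two)
  have DF: "br D F + br E E = 0"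
    using der[OF D(1) E] DE C by (simp add: E_def[symmetric] F_def[symmetric])
  have "br (br D F + br E E) t = br E F + (br E F + br E F)"
    using C der[OF D(1) F] der[OF E E] Ft sym[OF E F]
    by (simp add: br_add_left br_closed E_def[symmetric] F_def[symmetric])
  then have "br E F + (br E F + br E F) = 0"
    using DF C by simp
  moreover have "br E F + (br E F + br E F) = scale 3 (br E F)"
    using scale_left_distrib[of 1 2 "br E F"] scale_left_distrib[of 1 1 "br E F"] by simp
  ultimately have EF: "br E F = 0"
    by simp
  have FF: "br F F = 0"
    using der[OF E F] EF Ft C by (simp add: F_def[symmetric])
  let ?\<delta> = "twisted_family D t"
  have \<delta>: "?\<delta> 0 = scale (1/2) F" "?\<delta> (Suc 0) = E" "?\<delta> 2 = D" "\<And>a. a \<ge> 3 \<Longrightarrow> ?\<delta> a = 0"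
    by (simp_all add: twisted_family_def E_def F_def)
  have \<delta>B: "?\<delta> a \<in> B 1 (int a)" for a
    using DEF subspace_B by (auto simp: twisted_family_def E_def[symmetric] F_def[symmetric] subspace_def)
  show ?thesis
  proof unfold_locales
    fix m :: nat
    define e where "e a b = br (?\<delta> a) (?\<delta> b)" for a b
    have high: "e a b = 0" if "a \<ge> 3 \<or> b \<ge> 3" for a b
      using that \<delta>(4) B_in_C[OF \<delta>B] by (auto simp: e_def)
    have half: "scale (1/2) x + scale (1/2) x = x" for x
      using scale_left_distrib[of "1/2" "1/2" x] by simp
    have e: "e 0 0 = 0" "e 0 1 = 0" "e 1 0 = 0" "e 1 2 = 0" "e 2 1 = 0" "e 2 2 = 0"
      "e 1 1 = br E E" "e 0 2 = scale (1/2) (br D F)" "e 2 0 = scale (1/2) (br D F)"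
      using FF EF DE D(2) sym[OF F E] sym[OF E D(1)] sym[OF F D(1)] C
      by (simp_all add: e_def \<delta> br_scale_left br_scale_right C_scale)
    consider "m = 0" | "m = 1" | "m = 2" | "m = 3" | "m = 4" | "m \<ge> 5"
      by linarith
    then have "(\<Sum>a\<le>m. e a (m - a)) = 0"
    proof cases
      case 6
      then have "a \<ge> 3 \<or> m - a \<ge> 3" for a
        by linarith
      then show ?thesis
        using high by (intro sum.neutral) blast
    next
      case 3
      have "{..2} = {0, 1, 2::nat}"
        by auto
      then have "(\<Sum>a\<le>m. e a (m - a)) = br D F + br E E"
        using 3 e half[of "br D F"] by (simp add: algebra_simps)
      then show ?thesis
        using DF by simp
    next
      case 4
      moreover have "{..3} = {0, 1, 2, 3::nat}"
        by auto
      ultimately show ?thesis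
        using e high by simp
    next
      case 5
      moreover have "{..4} = {0, 1, 2, 3, 4::nat}"
        by auto
      ultimately show ?thesis
        using e high by simp
    qed (use e in simp_all)
    then show "(\<Sum>a\<le>m. br (?\<delta> a) (?\<delta> (m - a))) = 0"
      by (simp add: e_def)
  qed (rule \<delta>B)
qed

end

section \<open>The pre-Lie product of cochains\<close>

text \<open>
  Fixing the first argument lowers the degree by one. Together with the following operations it
  allows cochains to be composed by recursion on the list of arguments.
\<close>

definition contract :: "'w \<times> 'w \<Rightarrow> ('w, 'w) cochain \<Rightarrow> ('w, 'w) cochain" where
  "contract Y P = (\<lambda>X. P (Y # X))"

definition alternate :: "('w, 'w::ab_group_add) cochain \<Rightarrow> ('w, 'w) cochain" where
  "alternate P = (\<lambda>X x. signed (int (length X)) (P X x))"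

text \<open>
  An endomorphism \<open>g\<close> of \<open>W\<close> acts on \<open>W \<otimes> W\<close> as the derivation \<open>g \<otimes> 1 + 1 \<otimes> g\<close>; the result of
  this action is inserted as the first argument of \<open>R\<close>.
\<close>

definition act :: "('w \<Rightarrow> 'w) \<Rightarrow> 'w \<times> 'w \<Rightarrow> ('w, 'w::ab_group_add) cochain \<Rightarrow> ('w, 'w) cochain" where
  "act g Y R = contract (g (fst Y), snd Y) R + contract (fst Y, g (snd Y)) R"

definition restrict_degree :: "nat \<Rightarrow> ('w, 'w::ab_group_add) cochain \<Rightarrow> ('w, 'w) cochain" where
  "restrict_degree n P = (\<lambda>X x. if length X = n then P X x else 0)"

definition of_degree :: "int \<Rightarrow> ('w, 'w::ab_group_add) cochain \<Rightarrow> bool" where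
  "of_degree p P \<longleftrightarrow> (\<forall>X x. int (length X) \<noteq> p \<longrightarrow> P X x = 0)"

text \<open>
  The composition \<open>P \<circ> Q\<close> without shuffles. The first argument \<open>Y\<close> either precedes \<open>Q\<close> as an
  argument of \<open>P\<close>, or it is the first argument of \<open>Q\<close>, or \<open>Q\<close> has no arguments from \<open>W \<otimes> W\<close> and
  acts on \<open>Y\<close> itself. In the first case \<open>Q\<close> is moved past the odd element \<open>Y\<close>, and this is the reason
  for \<^term>\<open>alternate\<close>. No degrees occur in the recursion, so it is meaningful for sums of
  homogeneous cochains, too.
\<close>

fun leib_comp ::
  "('w::ab_group_add, 'w) cochain \<Rightarrow> ('w, 'w) cochain \<Rightarrow> ('w, 'w) cochain" where
  "leib_comp P Q [] x = P [] (Q [] x)"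
| "leib_comp P Q (Y # X) x =
     leib_comp (contract Y P) (alternate Q) X x + leib_comp P (contract Y Q) X x + act (Q []) Y P X x"

lemma contract_apply [simp]: "contract Y P X x = P (Y # X) x"
  by (simp add: contract_def)

lemma act_apply: "act g Y R X x = R ((g (fst Y), snd Y) # X) x + R ((fst Y, g (snd Y)) # X) x"
  by (simp add: act_def)

lemma contract_add: "contract Y (P + Q) = contract Y P + contract Y Q"
  by (simp add: contract_def fun_eq_iff)

lemma alternate_add: "alternate (P + Q) = alternate P + alternate Q"
  by (simp add: alternate_def signed_add fun_eq_iff)

lemma contract_leib_comp:
  "contract Y (leib_comp P Q) =
     leib_comp (contract Y P) (alternate Q) + leib_comp P (contract Y Q) + act (Q []) Y P"
  by (simp add: fun_eq_iff)

lemma of_degree_contract: "of_degree p P \<Longrightarrow> of_degree (p - 1) (contract Y P)"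
  by (auto simp: of_degree_def)

lemma alternate_eq_signed: "of_degree p P \<Longrightarrow> alternate P = signed p P"
  by (auto simp: of_degree_def alternate_def fun_eq_iff signed_apply)

lemma of_degree_signed: "of_degree p P \<Longrightarrow> of_degree p (signed z P)"
  by (simp add: of_degree_def signed_apply)

lemma of_degree_alternate: "of_degree p P \<Longrightarrow> of_degree p (alternate P)"
  by (simp add: of_degree_def alternate_def)

lemma restrict_degree_of_degree:
  "of_degree p P \<Longrightarrow> restrict_degree n P = (if int n = p then P else 0)"
  by (auto simp: of_degree_def restrict_degree_def fun_eq_iff)

lemma leib_comp_add_left: "leib_comp (P + P') Q = leib_comp P Q + leib_comp P' Q"
proof -
  have "leib_comp (P + P') Q X x = leib_comp P Q X x + leib_comp P' Q X x" for X x
    by (induction X arbitrary: P P' Q) (simp_all add: contract_add act_apply algebra_simps)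
  then show ?thesis
    by (simp add: fun_eq_iff)
qed

lemma leib_comp_zero_left [simp]: "leib_comp 0 Q = 0"
  using leib_comp_add_left[of 0 0 Q] by simp

lemma leib_comp_minus_left: "leib_comp (- P) Q = - leib_comp P Q"
  using leib_comp_add_left[of P "- P" Q] by (simp add: eq_neg_iff_add_eq_0 add.commute)

lemma leib_comp_signed_left: "leib_comp (signed z P) Q = signed z (leib_comp P Q)"
  by (simp add: signed_def leib_comp_minus_left)

locale cochain_space = vector_space scale
  for scale :: "'k::field \<Rightarrow> 'b::ab_group_add \<Rightarrow> 'b"
begin

definition is_linear :: "('b \<Rightarrow> 'b) \<Rightarrow> bool" where
  "is_linear f \<longleftrightarrow> (\<forall>x y. f (x + y) = f x + f y) \<and> (\<forall>c x. f (scale c x) = scale c (f x))"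

lemma is_linearD:
  fixes x y :: 'b and z :: int
  assumes "is_linear f"
  shows "f (x + y) = f x + f y" "f (scale c x) = scale c (f x)" "f 0 = 0" "f (- x) = - f x"
    "f (signed z x) = signed z (f x)"
proof -
  show *: "f (x + y) = f x + f y" "f (scale c x) = scale c (f x)" for x y c
    using assms by (simp_all add: is_linear_def)
  show "f 0 = 0"
    using *(2)[of 0 0] by simp
  show m: "f (- x) = - f x" for x
    using *(2)[of "- 1" x] by simp
  show "f (signed z x) = signed z (f x)"
    by (simp add: signed_def m)
qed

lemma is_linear_add: "is_linear f \<Longrightarrow> is_linear g \<Longrightarrow> is_linear (\<lambda>x. f x + g x)"
  and is_linear_comp: "is_linear f \<Longrightarrow> is_linear g \<Longrightarrow> is_linear (\<lambda>x. f (g x))"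
  and is_linear_signed: "is_linear f \<Longrightarrow> is_linear (\<lambda>x. signed z (f x))"
  and is_linear_scale: "is_linear f \<Longrightarrow> is_linear (\<lambda>x. scale c (f x))"
  and is_linear_zero: "is_linear (\<lambda>x. 0)"
  by (simp_all add: is_linear_def signed_def algebra_simps mult.commute)

lemma is_linear_if: "(b \<Longrightarrow> is_linear f) \<Longrightarrow> is_linear (\<lambda>x. if b then f x else 0)"
  by (cases b) (simp_all add: is_linear_zero)

text \<open>
  Linearity in every argument, in all degrees at once. Writing the list of arguments as
  \<open>U @ Y # W\<close> makes the notion compatible with recursion on the list.
\<close>

definition multilinear :: "('b, 'b) cochain \<Rightarrow> bool" where
  "multilinear P \<longleftrightarrow> (\<forall>X. is_linear (P X)) \<and>
     (\<forall>U W a b x. is_linear (\<lambda>y. P (U @ (y, b) # W) x) \<and> is_linear (\<lambda>y. P (U @ (a, y) # W) x))"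

lemma multilinearI:
  assumes "\<And>X. is_linear (P X)"
    "\<And>U W b x. is_linear (\<lambda>y. P (U @ (y, b) # W) x)"
    "\<And>U W a x. is_linear (\<lambda>y. P (U @ (a, y) # W) x)"
  shows "multilinear P"
  using assms by (simp add: multilinear_def)

lemma multilinearD:
  assumes "multilinear P"
  shows "is_linear (P X)" "is_linear (\<lambda>y. P (U @ (y, b) # W) x)" "is_linear (\<lambda>y. P (U @ (a, y) # W) x)"
    "is_linear (\<lambda>y. P ((y, b) # W) x)" "is_linear (\<lambda>y. P ((a, y) # W) x)"
proof -
  show *: "is_linear (P X)" "is_linear (\<lambda>y. P (U @ (y, b) # W) x)" "is_linear (\<lambda>y. P (U @ (a, y) # W) x)" for U
    using assms by (simp_all add: multilinear_def)
  show "is_linear (\<lambda>y. P ((y, b) # W) x)" "is_linear (\<lambda>y. P ((a, y) # W) x)"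
    using *(2,3)[of "[]"] by simp_all
qed

lemma multilinear_apply:
  assumes "multilinear P"
  shows "P X (x + y) = P X x + P X y" "P X (scale c x) = scale c (P X x)" "P X 0 = 0"
    "P X (signed z x) = signed z (P X x)"
    "P ((a + a', b) # X) x = P ((a, b) # X) x + P ((a', b) # X) x"
    "P ((a, b + b') # X) x = P ((a, b) # X) x + P ((a, b') # X) x"
    "P ((scale c a, b) # X) x = scale c (P ((a, b) # X) x)"
    "P ((a, scale c b) # X) x = scale c (P ((a, b) # X) x)"
    "P ((0, b) # X) x = 0" "P ((a, 0) # X) x = 0"
  using is_linearD[OF multilinearD(1)[OF assms, of X]] is_linearD[OF multilinearD(4)[OF assms, of b X x]]
    is_linearD[OF multilinearD(5)[OF assms, of a X x]] by simp_all

lemma multilinear_contract: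
  assumes "multilinear P"
  shows "multilinear (contract Y P)"
proof (rule multilinearI)
  show "is_linear (contract Y P X)" for X
    using multilinearD(1)[OF assms, of "Y # X"] by (simp add: contract_def)
  show "is_linear (\<lambda>y. contract Y P (U @ (y, b) # W) x)" for U W b x
    using multilinearD(2)[OF assms, of "Y # U" b W x] by (simp add: contract_def)
  show "is_linear (\<lambda>y. contract Y P (U @ (a, y) # W) x)" for U W a x
    using multilinearD(3)[OF assms, of "Y # U" a W x] by (simp add: contract_def)
qed

lemma multilinear_zero: "multilinear 0"
  unfolding multilinear_def zero_fun_def by (simp add: is_linear_zero)

lemma multilinear_add: "multilinear P \<Longrightarrow> multilinear Q \<Longrightarrow> multilinear (P + Q)"
  unfolding multilinear_def plus_fun_def by (auto intro!: is_linear_add)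

lemma multilinear_scale: "multilinear P \<Longrightarrow> multilinear (cochain_scale scale c P)"
  unfolding multilinear_def cochain_scale_def by (auto intro!: is_linear_scale)

lemma multilinear_signed: "multilinear P \<Longrightarrow> multilinear (signed z P)"
  unfolding multilinear_def signed_apply by (auto intro!: is_linear_signed)

lemma multilinear_alternate: "multilinear P \<Longrightarrow> multilinear (alternate P)"
  unfolding multilinear_def alternate_def length_append length_Cons
  by (auto intro!: is_linear_signed)

lemma multilinear_act: "multilinear P \<Longrightarrow> multilinear (act g Y P)"
  unfolding act_def by (intro multilinear_add multilinear_contract)

lemma multilinear_restrict_degree: "multilinear P \<Longrightarrow> multilinear (restrict_degree n P)"
  unfolding multilinear_def restrict_degree_def length_append length_Cons
  by (auto intro!: is_linear_if)

lemma cochain_scale_apply: "cochain_scale scale c P X x = scale c (P X x)"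
  by (simp add: cochain_scale_def)

lemma leib_comp_scale_left: "leib_comp (cochain_scale scale c P) Q = cochain_scale scale c (leib_comp P Q)"
proof -
  have c: "contract Y (cochain_scale scale c P) = cochain_scale scale c (contract Y P)" for P Y
    by (simp add: cochain_scale_def contract_def)
  have "leib_comp (cochain_scale scale c P) Q X x = scale c (leib_comp P Q X x)" for X x
    by (induction X arbitrary: P Q) (simp_all add: c act_apply cochain_scale_apply scale_right_distrib)
  then show ?thesis
    by (simp add: fun_eq_iff cochain_scale_def)
qed

lemma leib_comp_add_right:
  assumes "multilinear P"
  shows "leib_comp P (Q + Q') = leib_comp P Q + leib_comp P Q'"
proof -
  have "\<forall>P Q Q' x. multilinear P \<longrightarrow> leib_comp P (Q + Q') X x = leib_comp P Q X x + leib_comp P Q' X x" for X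
  proof (induction X)
    case Nil
    show ?case
      by (simp add: multilinear_apply)
  next
    case (Cons Y X)
    show ?case
    proof (intro allI impI)
      fix P Q Q' :: "('b, 'b) cochain" and x
      assume P: "multilinear P"
      have "leib_comp (contract Y P) (alternate (Q + Q')) X x =
          leib_comp (contract Y P) (alternate Q) X x + leib_comp (contract Y P) (alternate Q') X x"
        unfolding alternate_add using Cons.IH multilinear_contract[OF P] by blast
      moreover have "leib_comp P (contract Y (Q + Q')) X x =
          leib_comp P (contract Y Q) X x + leib_comp P (contract Y Q') X x"
        unfolding contract_add using Cons.IH P by blast
      ultimately show "leib_comp P (Q + Q') (Y # X) x = leib_comp P Q (Y # X) x + leib_comp P Q' (Y # X) x"
        by (simp add: act_apply multilinear_apply[OF P])
    qed
  qed
  then show ?thesis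
    using assms by (simp add: fun_eq_iff)
qed

lemma leib_comp_scale_right:
  assumes "multilinear P"
  shows "leib_comp P (cochain_scale scale c Q) = cochain_scale scale c (leib_comp P Q)"
proof -
  have c: "contract Y (cochain_scale scale c P) = cochain_scale scale c (contract Y P)" for P Y
    by (simp add: cochain_scale_def contract_def)
  have a: "alternate (cochain_scale scale c P) = cochain_scale scale c (alternate P)" for P
    by (simp add: cochain_scale_def alternate_def signed_def fun_eq_iff)
  have "\<forall>P Q x. multilinear P \<longrightarrow> leib_comp P (cochain_scale scale c Q) X x = scale c (leib_comp P Q X x)" for X
  proof (induction X)
    case Nil
    show ?case
      by (simp add: multilinear_apply cochain_scale_apply)
  next
    case (Cons Y X)
    show ?case
    proof (intro allI impI)
      fix P Q :: "('b, 'b) cochain" and x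
      assume P: "multilinear P"
      have "leib_comp (contract Y P) (alternate (cochain_scale scale c Q)) X x =
          scale c (leib_comp (contract Y P) (alternate Q) X x)"
        unfolding a using Cons.IH multilinear_contract[OF P] by blast
      moreover have "leib_comp P (contract Y (cochain_scale scale c Q)) X x =
          scale c (leib_comp P (contract Y Q) X x)"
        unfolding c using Cons.IH P by blast
      moreover have "cochain_scale scale c Q [] = (\<lambda>v. scale c (Q [] v))"
        by (simp add: cochain_scale_def)
      ultimately show "leib_comp P (cochain_scale scale c Q) (Y # X) x = scale c (leib_comp P Q (Y # X) x)"
        by (simp add: act_apply multilinear_apply[OF P] scale_right_distrib)
    qed
  qed
  then show ?thesis
    using assms by (simp add: fun_eq_iff cochain_scale_apply)
qed

lemma leib_comp_zero_right: "multilinear P \<Longrightarrow> leib_comp P 0 = 0"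
  using leib_comp_add_right[of P 0 0] by simp

lemma leib_comp_minus_right: "multilinear P \<Longrightarrow> leib_comp P (- Q) = - leib_comp P Q"
  using leib_comp_add_right[of P Q "- Q"] leib_comp_zero_right[of P] by (simp add: eq_neg_iff_add_eq_0 add.commute)

lemma leib_comp_signed_right: "multilinear P \<Longrightarrow> leib_comp P (signed z Q) = signed z (leib_comp P Q)"
  by (simp add: signed_def leib_comp_minus_right)

text \<open>
  The case of an argument in first position rests on the bilinearity of the composition.
\<close>

lemma multilinear_leib_comp:
  assumes "multilinear P" "multilinear Q"
  shows "multilinear (leib_comp P Q)"
proof (rule multilinearI)
  note ml = multilinear_contract multilinear_alternate multilinear_act
  show "is_linear (leib_comp P Q X)" for X
    using assms
  proof (induction X arbitrary: P Q)
    case Nil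
    show ?case
      by (simp add: is_linear_def multilinear_apply[OF Nil(1)] multilinear_apply[OF Nil(2)])
  next
    case (Cons Y X)
    have "is_linear (leib_comp (contract Y P) (alternate Q) X)" "is_linear (leib_comp P (contract Y Q) X)"
      by (rule Cons.IH[OF ml(1)[OF Cons.prems(1)] ml(2)[OF Cons.prems(2)]]
          Cons.IH[OF Cons.prems(1) ml(1)[OF Cons.prems(2)]])+
    moreover have "is_linear (act (Q []) Y P X)"
      using multilinearD(1)[OF ml(3)[OF Cons.prems(1)]] .
    ultimately have "is_linear (\<lambda>x. leib_comp P Q (Y # X) x)"
      unfolding leib_comp.simps(2) by (intro is_linear_add)
    then show ?case .
  qed
  have base: "is_linear (\<lambda>y. leib_comp P Q ((y, b) # W) x)"
    "is_linear (\<lambda>y. leib_comp P Q ((a, y) # W) x)"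
    if PQ: "multilinear P" "multilinear Q" for P Q W a b x
  proof -
    have contract_linear:
      "contract (y + y', b) R = contract (y, b) R + contract (y', b) R"
      "contract (a, y + y') R = contract (a, y) R + contract (a, y') R"
      "contract (scale c y, b) R = cochain_scale scale c (contract (y, b) R)"
      "contract (a, scale c y) R = cochain_scale scale c (contract (a, y) R)"
      if "multilinear R" for R y y' c a b
      by (simp_all add: fun_eq_iff cochain_scale_apply multilinear_apply[OF that])
    note simps = contract_linear leib_comp_add_left leib_comp_add_right leib_comp_scale_left leib_comp_scale_right
      multilinear_contract
    have 1: "is_linear (\<lambda>y. leib_comp (contract (y, b) P) (alternate Q) W x)"
      "is_linear (\<lambda>y. leib_comp (contract (a, y) P) (alternate Q) W x)"
      "is_linear (\<lambda>y. leib_comp P (contract (y, b) Q) W x)"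
      "is_linear (\<lambda>y. leib_comp P (contract (a, y) Q) W x)"
      using PQ by (simp_all add: is_linear_def simps) (simp_all add: cochain_scale_def)
    have Q: "is_linear (Q [])"
      using PQ(2) by (rule multilinearD(1))
    have 2: "is_linear (\<lambda>y. act (Q []) (y, b) P W x)" "is_linear (\<lambda>y. act (Q []) (a, y) P W x)"
      unfolding act_apply fst_conv snd_conv
      by (rule is_linear_add multilinearD(4,5)[OF PQ(1)] is_linear_comp[OF multilinearD(4)[OF PQ(1)] Q]
          is_linear_comp[OF multilinearD(5)[OF PQ(1)] Q])+
    show "is_linear (\<lambda>y. leib_comp P Q ((y, b) # W) x)" "is_linear (\<lambda>y. leib_comp P Q ((a, y) # W) x)"
      unfolding leib_comp.simps(2) by (intro is_linear_add 1 2)+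
  qed
  show "is_linear (\<lambda>y. leib_comp P Q (U @ (y, b) # W) x)" for U W b x
    using assms
  proof (induction U arbitrary: P Q)
    case (Cons Y U)
    have "is_linear (\<lambda>y. leib_comp (contract Y P) (alternate Q) (U @ (y, b) # W) x)"
      "is_linear (\<lambda>y. leib_comp P (contract Y Q) (U @ (y, b) # W) x)"
      by (rule Cons.IH[OF ml(1)[OF Cons.prems(1)] ml(2)[OF Cons.prems(2)]]
          Cons.IH[OF Cons.prems(1) ml(1)[OF Cons.prems(2)]])+
    moreover have "is_linear (\<lambda>y. act (Q []) Y P (U @ (y, b) # W) x)"
      using multilinearD(2)[OF ml(3)[OF Cons.prems(1)]] .
    ultimately show ?case
      unfolding append_Cons leib_comp.simps(2) by (intro is_linear_add)
  qed (use base in simp)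
  show "is_linear (\<lambda>y. leib_comp P Q (U @ (a, y) # W) x)" for U W a x
    using assms
  proof (induction U arbitrary: P Q)
    case (Cons Y U)
    have "is_linear (\<lambda>y. leib_comp (contract Y P) (alternate Q) (U @ (a, y) # W) x)"
      "is_linear (\<lambda>y. leib_comp P (contract Y Q) (U @ (a, y) # W) x)"
      by (rule Cons.IH[OF ml(1)[OF Cons.prems(1)] ml(2)[OF Cons.prems(2)]]
          Cons.IH[OF Cons.prems(1) ml(1)[OF Cons.prems(2)]])+
    moreover have "is_linear (\<lambda>y. act (Q []) Y P (U @ (a, y) # W) x)"
      using multilinearD(3)[OF ml(3)[OF Cons.prems(1)]] .
    ultimately show ?case
      unfolding append_Cons leib_comp.simps(2) by (intro is_linear_add)
  qed (use base in simp)
qed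

lemma of_degree_leib_comp:
  assumes "multilinear P" "of_degree p P" "of_degree q Q"
  shows "of_degree (p + q) (leib_comp P Q)"
proof -
  have "leib_comp P Q X x = 0" if "int (length X) \<noteq> p + q" for X x
    using assms that
  proof (induction X arbitrary: P Q p q)
    case Nil
    show ?case
    proof (cases "p = 0")
      case True
      then have "Q [] x = 0"
        using Nil by (simp add: of_degree_def)
      then show ?thesis
        using Nil by (simp add: multilinear_apply)
    next
      case False
      then show ?thesis
        using Nil by (simp add: of_degree_def)
    qed
  next
    case (Cons Y X)
    have "leib_comp (contract Y P) (alternate Q) X x = 0"
      using Cons.prems
      by (intro Cons.IH[where p = "p - 1" and q = q] multilinear_contract of_degree_contract of_degree_alternate) auto
    moreover have "leib_comp P (contract Y Q) X x = 0"
      using Cons.prems by (intro Cons.IH[where p = p and q = "q - 1"] of_degree_contract) auto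
    moreover have "act (Q []) Y P X x = 0"
    proof (cases "q = 0")
      case True
      then have "int (length ((a, b) # X)) \<noteq> p" for a b
        using Cons.prems(4) by simp
      then show ?thesis
        using Cons.prems(2) unfolding of_degree_def act_apply by (metis add_0)
    next
      case False
      then have "Q [] y = 0" for y
        using Cons.prems(3) by (simp add: of_degree_def)
      then show ?thesis
        by (simp add: act_apply multilinear_apply[OF Cons.prems(1)])
    qed
    ultimately show ?case
      by simp
  qed
  then show ?thesis
    by (simp add: of_degree_def)
qed

definition associator ::
  "('b, 'b) cochain \<Rightarrow> ('b, 'b) cochain \<Rightarrow> ('b, 'b) cochain \<Rightarrow> ('b, 'b) cochain" where
  "associator R P Q = leib_comp (leib_comp R P) Q - leib_comp R (leib_comp P Q)"

text \<open>
  The recursion for the associator. The terms in which \<open>P\<close> acts on the result of \<open>Q\<close> acting on \<open>Y\<close>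
  cancel, and so do those in which a contraction of \<open>P\<close> with \<open>Q\<close> acting on \<open>Y\<close> is composed with \<open>R\<close>.
  What is left is symmetric in \<open>P\<close> and \<open>Q\<close> up to sign.
\<close>

lemma associator_Cons:
  assumes ml: "multilinear R" "multilinear P" "multilinear Q"
    and deg: "of_degree p P" "of_degree q Q"
  shows "associator R P Q (Y # X) x =
      signed (p + q) (associator (contract Y R) P Q X x)
    + signed q (associator R (contract Y P) Q X x)
    + associator R P (contract Y Q) X x
    + (signed q (leib_comp (act (P []) Y R) Q X x) + signed p (leib_comp (act (Q []) Y R) P X x))
    + (R ((P [] (fst Y), Q [] (snd Y)) # X) x + R ((Q [] (fst Y), P [] (snd Y)) # X) x)"
proof -
  note mls = ml multilinear_contract multilinear_act multilinear_leib_comp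
  have alt: "alternate P = signed p P" "alternate Q = signed q Q"
    "alternate (leib_comp P Q) = signed (p + q) (leib_comp P Q)"
    using deg of_degree_leib_comp[OF ml(2) deg] by (simp_all add: alternate_eq_signed)
  have lhs1: "leib_comp (leib_comp R P) Q (Y # X) x =
      signed (p + q) (leib_comp (leib_comp (contract Y R) P) Q X x)
    + signed q (leib_comp (leib_comp R (contract Y P)) Q X x)
    + signed q (leib_comp (act (P []) Y R) Q X x)
    + leib_comp (leib_comp R P) (contract Y Q) X x
    + (signed p (leib_comp (contract (Q [] (fst Y), snd Y) R) P X x)
        + leib_comp R (contract (Q [] (fst Y), snd Y) P) X x
        + act (P []) (Q [] (fst Y), snd Y) R X x)
    + (signed p (leib_comp (contract (fst Y, Q [] (snd Y)) R) P X x)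
        + leib_comp R (contract (fst Y, Q [] (snd Y)) P) X x
        + act (P []) (fst Y, Q [] (snd Y)) R X x)"
    by (simp add: contract_leib_comp alt leib_comp_add_left leib_comp_signed_left leib_comp_signed_right mls
        signed_apply signed_signed signed_add act_apply[of "Q []"] add_ac)
  have lhs2: "leib_comp R (leib_comp P Q) (Y # X) x =
      signed (p + q) (leib_comp (contract Y R) (leib_comp P Q) X x)
    + signed q (leib_comp R (leib_comp (contract Y P) Q) X x)
    + leib_comp R (leib_comp P (contract Y Q)) X x
    + (leib_comp R (contract (Q [] (fst Y), snd Y) P) X x
      + leib_comp R (contract (fst Y, Q [] (snd Y)) P) X x)
    + (R ((P [] (Q [] (fst Y)), snd Y) # X) x + R ((fst Y, P [] (Q [] (snd Y))) # X) x)"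
    by (simp add: contract_leib_comp alt leib_comp_add_right leib_comp_signed_left leib_comp_signed_right mls
        signed_apply signed_signed signed_add act_def add_ac)
  show ?thesis
    unfolding associator_def fun_diff_def lhs1 lhs2
    by (simp add: signed_diff signed_add act_def leib_comp_add_left algebra_simps)
qed

text \<open>
  The composition is a graded pre-Lie product: the associator only contains the terms in which \<open>P\<close>
  and \<open>Q\<close> are inserted into \<open>R\<close> independently of each other.
\<close>

lemma pre_Lie_identity:
  assumes "multilinear R" "multilinear P" "multilinear Q" "of_degree p P" "of_degree q Q"
  shows "associator R P Q = signed (p * q) (associator R Q P)"
proof -
  have "associator R P Q X x = signed (p * q) (associator R Q P X x)" for X x
    using assms
  proof (induction X arbitrary: R P Q p q)
    case Nil
    then show ?case
      by (simp add: associator_def)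
  next
    case (Cons Y X)
    note ml = Cons.prems(1-3) and deg = Cons.prems(4,5)
    have 1: "associator (contract Y R) P Q X x = signed (p * q) (associator (contract Y R) Q P X x)"
      using ml deg by (intro Cons.IH multilinear_contract)
    have 2: "associator R (contract Y P) Q X x = signed ((p - 1) * q) (associator R Q (contract Y P) X x)"
      using ml deg by (intro Cons.IH multilinear_contract of_degree_contract)
    have 3: "associator R P (contract Y Q) X x = signed (p * (q - 1)) (associator R (contract Y Q) P X x)"
      using ml deg by (intro Cons.IH multilinear_contract of_degree_contract)
    have act_zero: "act (S []) Y R = 0" if "s \<noteq> 0" "of_degree s S" for S s
    proof -
      have "S [] y = 0" for y
        using that by (simp add: of_degree_def)
      then show ?thesis
        by (simp add: fun_eq_iff act_apply multilinear_apply[OF ml(1)])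
    qed
    \<comment> \<open>The remaining terms vanish unless the cochains evaluated at the empty list have degree zero,
      in which case the sign \<open>p q\<close> is even.\<close>
    have 4: "leib_comp (act (P []) Y R) Q X x = signed (p * q) (leib_comp (act (P []) Y R) Q X x)"
      using act_zero[OF _ deg(1)] by (cases "p = 0") simp_all
    have 5: "leib_comp (act (Q []) Y R) P X x = signed (p * q) (leib_comp (act (Q []) Y R) P X x)"
      using act_zero[OF _ deg(2)] by (cases "q = 0") simp_all
    have 6: "R ((P [] a, Q [] b) # X) x = signed (p * q) (R ((P [] a, Q [] b) # X) x)" for a b
    proof (cases "p = 0")
      case False
      then have "P [] a = 0"
        using deg(1) by (simp add: of_degree_def)
      then show ?thesis
        by (simp add: multilinear_apply[OF ml(1)])
    qed simp
    have 7: "R ((Q [] a, P [] b) # X) x = signed (p * q) (R ((Q [] a, P [] b) # X) x)" for a b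
    proof (cases "p = 0")
      case False
      then have "P [] b = 0"
        using deg(1) by (simp add: of_degree_def)
      then show ?thesis
        by (simp add: multilinear_apply[OF ml(1)])
    qed simp
    have "associator R P Q (Y # X) x =
        signed (p + q + p * q) (associator (contract Y R) Q P X x)
      + signed (q + (p - 1) * q) (associator R Q (contract Y P) X x)
      + signed (p * (q - 1)) (associator R (contract Y Q) P X x)
      + (signed (q + p * q) (leib_comp (act (P []) Y R) Q X x) + signed (p + p * q) (leib_comp (act (Q []) Y R) P X x))
      + (signed (p * q) (R ((P [] (fst Y), Q [] (snd Y)) # X) x) + signed (p * q) (R ((Q [] (fst Y), P [] (snd Y)) # X) x))"
      by (simp only: associator_Cons[OF ml deg] 1 2 3 signed_signed 4[symmetric] 5[symmetric]
          6[symmetric] 7[symmetric] flip: signed_signed)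
    also have "\<dots> = signed (p * q) (associator R Q P (Y # X) x)"
    proof -
      have "signed (q + (p - 1) * q) v = signed (p * q) v" "signed (p * (q - 1)) v = signed (p * q + p) v" for v :: 'b
        by (auto intro!: signed_cong simp: algebra_simps)
      then show ?thesis
        by (simp only: associator_Cons[OF ml(1,3,2) deg(2,1)] signed_add signed_signed) (simp add: algebra_simps)
    qed
    finally show ?case .
  qed
  then show ?thesis
    by (simp add: fun_eq_iff signed_apply)
qed

end

section \<open>The graded Lie bracket of cochains\<close>

text \<open>
  The classical fact that the graded commutator of a pre-Lie product satisfies the Jacobi identity,
  written in terms of the twelve threefold products involved.
\<close>

lemma jacobi_from_pre_Lie:
  fixes pq_r :: "'v::ab_group_add"
  assumes "pq_r - p_qr = signed (q * r) (pr_q - p_rq)"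
    and "qp_r - q_pr = signed (p * r) (qr_p - q_rp)"
    and "rp_q - r_pq = signed (p * q) (rq_p - r_qp)"
  shows "(pq_r - signed (p * q) qp_r) - signed ((p + q) * r) (r_pq - signed (p * q) r_qp) =
      ((p_qr - signed (q * r) p_rq) - signed (p * (q + r)) (qr_p - signed (q * r) rq_p))
    + signed (q * r) ((pr_q - signed (p * r) rp_q) - signed ((p + r) * q) (q_pr - signed (p * r) q_rp))"
proof -
  have eqs: "pq_r = p_qr + signed (q * r) (pr_q - p_rq)" "qp_r = q_pr + signed (p * r) (qr_p - q_rp)"
    "rp_q = r_pq + signed (p * q) (rq_p - r_qp)"
    using assms by (simp_all add: algebra_simps)
  show ?thesis
    unfolding eqs by (cases "even p"; cases "even q"; cases "even r") (simp_all add: signed_def)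
qed

lemma leib_comp_diff_left: "leib_comp (P - P') Q = leib_comp P Q - leib_comp P' Q"
  using leib_comp_add_left[of P "- P'" Q] by (simp add: leib_comp_minus_left)

lemma of_degreeD: "of_degree p P \<Longrightarrow> int (length X) \<noteq> p \<Longrightarrow> P X x = 0"
  by (simp add: of_degree_def)

lemma of_degree_add: "of_degree p P \<Longrightarrow> of_degree p Q \<Longrightarrow> of_degree p (P + Q)"
  by (simp add: of_degree_def)

lemma of_degree_diff: "of_degree p P \<Longrightarrow> of_degree p Q \<Longrightarrow> of_degree p (P - Q)"
  by (simp add: of_degree_def)

lemma of_degree_negative: "of_degree p P \<Longrightarrow> p < 0 \<Longrightarrow> P = 0"
  by (auto simp: of_degree_def fun_eq_iff)

context cochain_space
begin

lemma multilinear_diff: "multilinear P \<Longrightarrow> multilinear Q \<Longrightarrow> multilinear (P - Q)"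
  using multilinear_add[of P "signed 1 Q"] multilinear_signed[of Q 1] by simp

lemma leib_comp_diff_right: "multilinear P \<Longrightarrow> leib_comp P (Q - Q') = leib_comp P Q - leib_comp P Q'"
  using leib_comp_add_right[of P Q "- Q'"] by (simp add: leib_comp_minus_right)

lemma multilinear_insert:
  assumes "multilinear P"
  shows "P (U @ (signed z a, b) # W) x = signed z (P (U @ (a, b) # W) x)"
    "P (U @ (a, signed z b) # W) x = signed z (P (U @ (a, b) # W) x)"
    "P (U @ (0, b) # W) x = 0" "P (U @ (a, 0) # W) x = 0"
  using is_linearD(3,5)[OF multilinearD(2)[OF assms, of U b W x]]
    is_linearD(3,5)[OF multilinearD(3)[OF assms, of U a W x]] by simp_all

text \<open>
  The terms in which \<open>Q\<close> acts on the argument in position \<open>m\<close>, after consuming the arguments \<open>W\<close>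
  out of the first \<open>m\<close> ones.
\<close>

definition insertion ::
  "('b, 'b) cochain \<Rightarrow> ('b, 'b) cochain \<Rightarrow> ('b \<times> 'b) list \<Rightarrow> nat \<Rightarrow> 'b \<Rightarrow>
    ('b \<times> 'b) list \<Rightarrow> ('b \<times> 'b) list \<Rightarrow> 'b" where
  "insertion P Q X m x U W =
     P (U @ (Q W (fst (X ! m)), snd (X ! m)) # drop (Suc m) X) x
   + P (U @ (fst (X ! m), Q W (snd (X ! m))) # drop (Suc m) X) x"

text \<open>
  Unfolding the recursion: the last argument used by \<open>Q\<close> is either one in some position \<open>m\<close> or the
  final vector \<open>x\<close>, and the other ones form a subsequence of those before it.
\<close>

lemma leib_comp_eq_split_sum:
  assumes "multilinear P"
  shows "leib_comp P Q X x =
    (\<Sum>m<length X. split_sum (\<lambda>_. 1)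
      (\<lambda>U W. signed (int (length U) * int (length W)) (insertion P Q X m x U W)) (take m X))
    + split_sum (\<lambda>_. 1) (\<lambda>U W. signed (int (length U) * int (length W)) (P U (Q W x))) X"
  using assms
proof (induction X arbitrary: P Q)
  case Nil
  show ?case
    by simp
next
  case (Cons Y X)
  let ?s = "\<lambda>U W. signed (int (length U) * int (length W))"
  have alt: "?s U W (insertion (contract Y P) (alternate Q) X m x U W) =
      ?s (Y # U) W (insertion P Q (Y # X) (Suc m) x (Y # U) W)" for U W m
    using multilinear_insert(1,2)[OF Cons.prems, of "Y # U"]
    by (simp add: insertion_def alternate_def contract_def signed_add signed_signed algebra_simps)
  have alt': "?s U W (contract Y P U (alternate Q W x)) = ?s (Y # U) W (P (Y # U) (Q W x))" for U W
    by (simp add: alternate_def contract_def multilinear_apply[OF Cons.prems] signed_signed algebra_simps)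
  have ins: "?s U W (insertion P (contract Y Q) X m x U W) =
      signed (int (length U)) (?s U (Y # W) (insertion P Q (Y # X) (Suc m) x U (Y # W)))" for U W m
    by (simp add: insertion_def contract_def signed_signed) (rule signed_cong, simp add: algebra_simps)
  have ins': "?s U W (P U (contract Y Q W x)) =
      signed (int (length U)) (?s U (Y # W) (P U (Q (Y # W) x)))" for U W
    by (simp add: contract_def signed_signed) (rule signed_cong, simp add: algebra_simps)
  have len: "sum_list (map (\<lambda>_. 1::int) U) = int (length U)" for U :: "('b \<times> 'b) list"
    by (induction U) simp_all
  have "leib_comp P Q (Y # X) x =
    (\<Sum>m<length X. split_sum (\<lambda>_. 1) (\<lambda>U W. ?s (Y # U) W (insertion P Q (Y # X) (Suc m) x (Y # U) W)) (take m X))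
    + split_sum (\<lambda>_. 1) (\<lambda>U W. ?s (Y # U) W (P (Y # U) (Q W x))) X
    + ((\<Sum>m<length X. split_sum (\<lambda>_. 1) (\<lambda>U W. signed (int (length U))
        (?s U (Y # W) (insertion P Q (Y # X) (Suc m) x U (Y # W)))) (take m X))
      + split_sum (\<lambda>_. 1) (\<lambda>U W. signed (int (length U)) (?s U (Y # W) (P U (Q (Y # W) x)))) X)
    + insertion P Q (Y # X) 0 x [] []"
    unfolding leib_comp.simps(2) Cons.IH[OF multilinear_contract[OF Cons.prems]] Cons.IH[OF Cons.prems]
      alt alt' ins ins' by (simp add: insertion_def act_apply)
  also have "\<dots> = (\<Sum>m<Suc (length X). split_sum (\<lambda>_. 1)
      (\<lambda>U W. ?s U W (insertion P Q (Y # X) m x U W)) (take m (Y # X)))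
    + split_sum (\<lambda>_. 1) (\<lambda>U W. ?s U W (P U (Q W x))) (Y # X)"
    unfolding sum.lessThan_Suc_shift
    by (simp only: o_def take_Suc_Cons take_0 split_sum.simps len mult_1 sum.distrib) (simp add: add_ac)
  finally show ?case
    by simp
qed

lemma sum_shuffle_perms_sign:
  assumes "length L = i + j"
  shows "(\<Sum>\<sigma>\<in>shuffle_perms i j. scale (of_int (sign \<sigma>))
      (F (take i (permute_list \<sigma> L)) (drop i (permute_list \<sigma> L)))) =
    split_sum (\<lambda>_. 1) (\<lambda>U W. if length U = i then F U W else 0) L"
proof -
  let ?F = "\<lambda>U W. F (map ((!) L) U) (map ((!) L) W)"
  have "(\<Sum>\<sigma>\<in>shuffle_perms i j. scale (of_int (sign \<sigma>))
      (F (take i (permute_list \<sigma> L)) (drop i (permute_list \<sigma> L)))) =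
    (\<Sum>\<sigma>\<in>shuffle_perms i j. scale (of_int (koszul_sign (i + j) (\<lambda>_. 1) \<sigma>))
      (?F (map \<sigma> [0..<i]) (map \<sigma> [i..<i + j])))"
  proof (intro sum.cong refl)
    fix \<sigma> assume "\<sigma> \<in> shuffle_perms i j"
    then have "sign \<sigma> = koszul_sign (i + j) (\<lambda>_. 1) \<sigma>"
      by (intro sign_eq_koszul_sign) (simp add: shuffle_perms_def)
    moreover have "take i (permute_list \<sigma> L) = map ((!) L) (map \<sigma> [0..<i])"
      "drop i (permute_list \<sigma> L) = map ((!) L) (map \<sigma> [i..<i + j])"
      using assms by (simp_all add: permute_list_def take_map drop_map)
    ultimately show "scale (of_int (sign \<sigma>)) (F (take i (permute_list \<sigma> L)) (drop i (permute_list \<sigma> L))) =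
      scale (of_int (koszul_sign (i + j) (\<lambda>_. 1) \<sigma>)) (?F (map \<sigma> [0..<i]) (map \<sigma> [i..<i + j]))"
      by simp
  qed
  also have "\<dots> = split_sum (\<lambda>_. 1) (\<lambda>U W. if length U = i then ?F U W else 0) [0..<i + j]"
    by (rule sum_shuffle_perms)
  also have "\<dots> = split_sum (\<lambda>_. 1) (\<lambda>U W. if length U = i then F U W else 0) (map ((!) L) [0..<i + j])"
    unfolding split_sum_map by (simp add: o_def)
  also have "map ((!) L) [0..<i + j] = L"
    using map_nth[of L] assms by simp
  finally show ?thesis .
qed

text \<open>
  The restriction to the degrees \<open>p\<close> and \<open>q\<close> selects, among all splittings of the first \<open>m\<close>
  arguments, those corresponding to \<open>(k, q)\<close>-shuffles with \<open>m = k + q\<close>.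
\<close>

lemma circ_eq_leib_comp:
  assumes P: "multilinear P" and X: "length X = p + q"
  shows "circ scale p q P Q X x = leib_comp (restrict_degree p P) (restrict_degree q Q) X x"
proof -
  let ?P = "restrict_degree p P" and ?Q = "restrict_degree q Q"
  let ?s = "\<lambda>U W. signed (int (length U) * int (length W))"
  let ?I = "\<lambda>m. split_sum (\<lambda>_. 1) (\<lambda>U W. ?s U W (insertion ?P ?Q X m x U W)) (take m X)"
  have ml: "multilinear ?P"
    using P by (rule multilinear_restrict_degree)
  have ins0: "insertion ?P ?Q X m x U W = 0" if "length W \<noteq> q" for m U W
    using that multilinear_insert(3,4)[OF ml] by (simp add: insertion_def restrict_degree_def[of q])
  have low: "?I m = 0" if "m < q" for m
  proof -
    have "?I m = split_sum (\<lambda>_. 1) (\<lambda>U W. 0) (take m X)"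
      using that X by (intro split_sum_cong) (subst ins0, auto)
    then show ?thesis
      by simp
  qed
  have high: "scale ((-1) ^ (k * q)) (\<Sum>\<sigma>\<in>shuffle_perms k q. scale (of_int (sign \<sigma>))
        (let Y = permute_list \<sigma> (take (k + q) X); (a, b) = X ! (k + q)
         in P (take k Y @ [(Q (drop k Y) a, b)] @ drop (k + q + 1) X) x))
    + scale ((-1) ^ (k * q)) (\<Sum>\<sigma>\<in>shuffle_perms k q. scale (of_int (sign \<sigma>))
        (let Y = permute_list \<sigma> (take (k + q) X); (a, b) = X ! (k + q)
         in P (take k Y @ [(a, Q (drop k Y) b)] @ drop (k + q + 1) X) x)) = ?I (k + q)"
    (is "scale _ ?A + scale _ ?B = _") if k: "k < p" for k
  proof -
    obtain a b where ab: "X ! (k + q) = (a, b)"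
      by force
    have len: "length (take (k + q) X) = k + q"
      using k X by simp
    have "?A = split_sum (\<lambda>_. 1)
        (\<lambda>U W. if length U = k then P (U @ (Q W a, b) # drop (Suc (k + q)) X) x else 0) (take (k + q) X)"
      using sum_shuffle_perms_sign[OF len, of "\<lambda>U W. P (U @ (Q W a, b) # drop (Suc (k + q)) X) x"]
      by (simp add: ab Let_def)
    moreover have "?B = split_sum (\<lambda>_. 1)
        (\<lambda>U W. if length U = k then P (U @ (a, Q W b) # drop (Suc (k + q)) X) x else 0) (take (k + q) X)"
      using sum_shuffle_perms_sign[OF len, of "\<lambda>U W. P (U @ (a, Q W b) # drop (Suc (k + q)) X) x"]
      by (simp add: ab Let_def)
    ultimately have "scale ((-1) ^ (k * q)) ?A + scale ((-1) ^ (k * q)) ?B =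
      split_sum (\<lambda>_. 1) (\<lambda>U W. signed (int (k * q))
        ((if length U = k then P (U @ (Q W a, b) # drop (Suc (k + q)) X) x else 0)
        + (if length U = k then P (U @ (a, Q W b) # drop (Suc (k + q)) X) x else 0))) (take (k + q) X)"
      by (simp only: scale_minus_one_power split_sum_signed[symmetric] split_sum_add signed_add)
    also have "\<dots> = ?I (k + q)"
    proof (intro split_sum_cong)
      fix U W :: "('b \<times> 'b) list"
      assume "length U + length W = length (take (k + q) X)"
      then have UW: "length U + length W = k + q"
        using len by simp
      show "signed (int (k * q))
        ((if length U = k then P (U @ (Q W a, b) # drop (Suc (k + q)) X) x else 0)
        + (if length U = k then P (U @ (a, Q W b) # drop (Suc (k + q)) X) x else 0)) =
        ?s U W (insertion ?P ?Q X (k + q) x U W)"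
      proof (cases "length U = k")
        case True
        then have "length W = q"
          using UW by simp
        with True show ?thesis
          using k X by (simp add: insertion_def restrict_degree_def ab)
      next
        case False
        then have "length W \<noteq> q"
          using UW by simp
        with False show ?thesis
          by (simp add: ins0)
      qed
    qed
    finally show ?thesis .
  qed
  have last: "(\<Sum>\<sigma>\<in>shuffle_perms p q. scale ((-1) ^ (p * q)) (scale (of_int (sign \<sigma>))
        (let Y = permute_list \<sigma> X in P (take p Y) (Q (drop p Y) x)))) =
    split_sum (\<lambda>_. 1) (\<lambda>U W. ?s U W (?P U (?Q W x))) X"
  proof -
    have "(\<Sum>\<sigma>\<in>shuffle_perms p q. scale ((-1) ^ (p * q)) (scale (of_int (sign \<sigma>))
        (let Y = permute_list \<sigma> X in P (take p Y) (Q (drop p Y) x)))) =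
      signed (int (p * q)) (split_sum (\<lambda>_. 1) (\<lambda>U W. if length U = p then P U (Q W x) else 0) X)"
      unfolding sum_shuffle_perms_sign[OF X, symmetric]
      by (simp only: scale_minus_one_power signed_sum Let_def)
    also have "\<dots> = split_sum (\<lambda>_. 1) (\<lambda>U W. ?s U W (?P U (?Q W x))) X"
      unfolding split_sum_signed
      by (intro split_sum_cong) (auto simp: restrict_degree_def X)
    finally show ?thesis .
  qed
  have "circ scale p q P Q X x = (\<Sum>k<p. ?I (k + q)) + split_sum (\<lambda>_. 1) (\<lambda>U W. ?s U W (?P U (?Q W x))) X"
    unfolding circ_def last[symmetric] sum.distrib[symmetric]
    by (intro arg_cong2[of _ _ _ _ "(+)"] sum.cong refl high) simp
  also have "(\<Sum>k<p. ?I (k + q)) = (\<Sum>m<length X. ?I m)"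
  proof -
    have "(\<Sum>k<p. ?I (k + q)) = (\<Sum>m\<in>{q..<p + q}. ?I m)"
      using sum.shift_bounds_nat_ivl[of ?I 0 q p] by (simp add: atLeast0LessThan)
    also have "\<dots> = (\<Sum>m<length X. ?I m)"
      using low X by (intro sum.mono_neutral_left) auto
    finally show ?thesis .
  qed
  finally show ?thesis
    unfolding leib_comp_eq_split_sum[OF ml] .
qed

text \<open>
  A cochain that agrees with the bracket on lists of length \<open>n\<close>. Multilinearity only compares lists
  of equal length, so it can be transferred from here to the bracket itself.
\<close>

definition leib_bracket :: "nat \<Rightarrow> ('b, 'b) cochain \<Rightarrow> ('b, 'b) cochain \<Rightarrow> ('b, 'b) cochain" where
  "leib_bracket n P Q = (\<Sum>p\<le>n. leib_comp (restrict_degree p P) (restrict_degree (n - p) Q)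
     - signed (int p * int (n - p)) (leib_comp (restrict_degree (n - p) Q) (restrict_degree p P)))"

lemma bracket_eq_leib_bracket:
  assumes "multilinear P" "multilinear Q"
  shows "bracket_3Leib scale P Q X x = leib_bracket (length X) P Q X x"
proof -
  have apply_sum: "(\<Sum>i\<in>I. f i) X x = (\<Sum>i\<in>I. f i X x)" for f :: "nat \<Rightarrow> ('b, 'b) cochain" and I
    by (induction I rule: infinite_finite_induct) simp_all
  show ?thesis
    unfolding bracket_3Leib_def leib_bracket_def apply_sum
  proof (intro sum.cong refl)
    fix p assume "p \<in> {..length X}"
    then show "(let q = length X - p in circ scale p q P Q X x - scale ((- 1) ^ (p * q)) (circ scale q p Q P X x)) =
      (leib_comp (restrict_degree p P) (restrict_degree (length X - p) Q)
     - signed (int p * int (length X - p)) (leib_comp (restrict_degree (length X - p) Q) (restrict_degree p P))) X x"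
      using assms by (simp add: Let_def circ_eq_leib_comp scale_minus_one_power signed_apply)
  qed
qed

lemma multilinear_sum: "(\<And>i. i \<in> I \<Longrightarrow> multilinear (f i)) \<Longrightarrow> multilinear (\<Sum>i\<in>I. f i)"
  by (induction I rule: infinite_finite_induct) (auto intro: multilinear_zero multilinear_add)

lemma multilinear_leib_bracket:
  assumes "multilinear P" "multilinear Q"
  shows "multilinear (leib_bracket n P Q)"
  unfolding leib_bracket_def using assms
  by (intro multilinear_sum multilinear_diff multilinear_signed multilinear_leib_comp multilinear_restrict_degree)

lemma multilinear_bracket:
  assumes "multilinear P" "multilinear Q"
  shows "multilinear (bracket_3Leib scale P Q)"
proof (rule multilinearI)
  note ml = multilinear_leib_bracket[OF assms]
  show "is_linear (bracket_3Leib scale P Q X)" for X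
    using multilinearD(1)[OF ml[of "length X"], of X] bracket_eq_leib_bracket[OF assms, of X]
    by (simp add: is_linear_def)
  show "is_linear (\<lambda>y. bracket_3Leib scale P Q (U @ (y, b) # W) x)" for U W b x
    unfolding bracket_eq_leib_bracket[OF assms] length_append length_Cons by (rule multilinearD(2)[OF ml])
  show "is_linear (\<lambda>y. bracket_3Leib scale P Q (U @ (a, y) # W) x)" for U W a x
    unfolding bracket_eq_leib_bracket[OF assms] length_append length_Cons by (rule multilinearD(3)[OF ml])
qed

lemma restrict_degree_add: "restrict_degree n (P + Q) = restrict_degree n P + restrict_degree n Q"
  by (auto simp: restrict_degree_def fun_eq_iff)

lemma restrict_degree_scale:
  "restrict_degree n (cochain_scale scale c P) = cochain_scale scale c (restrict_degree n P)"
  by (auto simp: restrict_degree_def cochain_scale_def fun_eq_iff)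

lemma bracket_add_left:
  assumes "multilinear P" "multilinear P'" "multilinear Q"
  shows "bracket_3Leib scale (P + P') Q = bracket_3Leib scale P Q + bracket_3Leib scale P' Q"
proof -
  have "leib_bracket n (P + P') Q = leib_bracket n P Q + leib_bracket n P' Q" for n
    unfolding leib_bracket_def restrict_degree_add leib_comp_add_left
      leib_comp_add_right[OF multilinear_restrict_degree[OF assms(3)]] sum.distrib[symmetric]
    by (intro sum.cong refl) (simp add: signed_add)
  then show ?thesis
    using assms by (simp add: fun_eq_iff bracket_eq_leib_bracket multilinear_add)
qed

lemma bracket_add_right:
  assumes "multilinear P" "multilinear Q" "multilinear Q'"
  shows "bracket_3Leib scale P (Q + Q') = bracket_3Leib scale P Q + bracket_3Leib scale P Q'"
proof -
  have "leib_bracket n P (Q + Q') = leib_bracket n P Q + leib_bracket n P Q'" for n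
    unfolding leib_bracket_def restrict_degree_add leib_comp_add_left
      leib_comp_add_right[OF multilinear_restrict_degree[OF assms(1)]] sum.distrib[symmetric]
    by (intro sum.cong refl) (simp add: signed_add)
  then show ?thesis
    using assms by (simp add: fun_eq_iff bracket_eq_leib_bracket multilinear_add)
qed

lemma cochain_scale_simps:
  "cochain_scale scale c (P - Q) = cochain_scale scale c P - cochain_scale scale c Q"
  "cochain_scale scale c (signed z P) = signed z (cochain_scale scale c P)"
  "cochain_scale scale c (\<Sum>i\<in>I. f i) = (\<Sum>i\<in>I. cochain_scale scale c (f i))"
proof -
  have add: "cochain_scale scale c (P + Q) = cochain_scale scale c P + cochain_scale scale c Q" for P Q
    by (simp add: cochain_scale_def fun_eq_iff scale_right_distrib)
  show "cochain_scale scale c (P - Q) = cochain_scale scale c P - cochain_scale scale c Q"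
    by (simp add: cochain_scale_def fun_eq_iff scale_right_diff_distrib)
  show "cochain_scale scale c (signed z P) = signed z (cochain_scale scale c P)"
    by (simp add: cochain_scale_def fun_eq_iff signed_def)
  have "cochain_scale scale c 0 = 0"
    by (simp add: cochain_scale_def fun_eq_iff)
  then show "cochain_scale scale c (\<Sum>i\<in>I. f i) = (\<Sum>i\<in>I. cochain_scale scale c (f i))"
    by (induction I rule: infinite_finite_induct) (simp_all add: add)
qed

lemma bracket_scale:
  assumes "multilinear P" "multilinear Q"
  shows "bracket_3Leib scale (cochain_scale scale c P) Q = cochain_scale scale c (bracket_3Leib scale P Q)"
    and "bracket_3Leib scale P (cochain_scale scale c Q) = cochain_scale scale c (bracket_3Leib scale P Q)"
proof -
  have "leib_bracket n (cochain_scale scale c P) Q = cochain_scale scale c (leib_bracket n P Q)"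
    "leib_bracket n P (cochain_scale scale c Q) = cochain_scale scale c (leib_bracket n P Q)" for n
    unfolding leib_bracket_def restrict_degree_scale leib_comp_scale_left
      leib_comp_scale_right[OF multilinear_restrict_degree[OF assms(1)]]
      leib_comp_scale_right[OF multilinear_restrict_degree[OF assms(2)]] cochain_scale_simps
    by (rule refl)+
  then show "bracket_3Leib scale (cochain_scale scale c P) Q = cochain_scale scale c (bracket_3Leib scale P Q)"
    "bracket_3Leib scale P (cochain_scale scale c Q) = cochain_scale scale c (bracket_3Leib scale P Q)"
    using assms by (simp_all add: fun_eq_iff bracket_eq_leib_bracket multilinear_scale cochain_scale_apply)
qed

text \<open>
  For homogeneous cochains, the sum over all degrees collapses to the usual graded commutator.
\<close>

lemma bracket_of_degree:
  assumes ml: "multilinear P" "multilinear Q" and deg: "of_degree p P" "of_degree q Q"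
  shows "bracket_3Leib scale P Q = leib_comp P Q - signed (p * q) (leib_comp Q P)"
proof (intro ext)
  fix X :: "('b \<times> 'b) list" and x
  let ?n = "length X"
  let ?R = "leib_comp P Q - signed (p * q) (leib_comp Q P)"
  have R: "of_degree (p + q) ?R"
    using of_degree_leib_comp[OF ml(1) deg] of_degree_leib_comp[OF ml(2) deg(2,1)]
    by (intro of_degree_diff of_degree_signed) (simp_all add: add.commute)
  have summand: "leib_comp (restrict_degree a P) (restrict_degree b Q)
     - signed (int a * int b) (leib_comp (restrict_degree b Q) (restrict_degree a P)) =
     (if int a = p \<and> int b = q then ?R else 0)" for a b
    using ml by (auto simp: restrict_degree_of_degree[OF deg(1)] restrict_degree_of_degree[OF deg(2)]
        leib_comp_zero_right)
  have "leib_bracket ?n P Q X x = ?R X x"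
  proof (cases "p \<ge> 0 \<and> q \<ge> 0 \<and> int ?n = p + q")
    case True
    then obtain a where a: "a \<le> ?n" "int a = p" "int (?n - a) = q"
      by (intro that[of "nat p"]) auto
    have "leib_bracket ?n P Q = (\<Sum>b\<le>?n. if b = a then ?R else 0)"
      unfolding leib_bracket_def summand using a by (intro sum.cong) auto
    then show ?thesis
      using a by simp
  next
    case False
    have "leib_bracket ?n P Q = (\<Sum>b\<le>?n. 0)"
      unfolding leib_bracket_def summand using False by (intro sum.cong) auto
    moreover have "?R X x = 0"
    proof (cases "int ?n = p + q")
      case True
      with False have "P = 0 \<or> Q = 0"
        using of_degree_negative deg by fastforce
      then show ?thesis
        using ml leib_comp_zero_right by auto
    next
      case False
      then show ?thesis
        using R unfolding of_degree_def by blast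
    qed
    ultimately show ?thesis
      by simp
  qed
  then show "bracket_3Leib scale P Q X x = ?R X x"
    using ml by (simp add: bracket_eq_leib_bracket)
qed

lemma of_degree_bracket:
  assumes "multilinear P" "multilinear Q" "of_degree p P" "of_degree q Q"
  shows "of_degree (p + q) (bracket_3Leib scale P Q)"
  unfolding bracket_of_degree[OF assms]
  using of_degree_leib_comp[OF assms(1,3,4)] of_degree_leib_comp[OF assms(2,4,3)]
  by (intro of_degree_diff of_degree_signed) (simp_all add: add.commute)

lemma bracket_antisym:
  assumes "multilinear P" "multilinear Q" "of_degree p P" "of_degree q Q"
  shows "bracket_3Leib scale P Q = - signed (p * q) (bracket_3Leib scale Q P)"
  unfolding bracket_of_degree[OF assms] bracket_of_degree[OF assms(2,1,4,3)]
  by (simp add: signed_def)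

lemma bracket_jacobi:
  assumes ml: "multilinear P" "multilinear Q" "multilinear R"
    and deg: "of_degree p P" "of_degree q Q" "of_degree r R"
  shows "bracket_3Leib scale (bracket_3Leib scale P Q) R =
      bracket_3Leib scale P (bracket_3Leib scale Q R)
    + signed (q * r) (bracket_3Leib scale (bracket_3Leib scale P R) Q)"
proof -
  have 1: "bracket_3Leib scale (bracket_3Leib scale P Q) R =
      (leib_comp (leib_comp P Q) R - signed (p * q) (leib_comp (leib_comp Q P) R))
      - signed ((p + q) * r) (leib_comp R (leib_comp P Q) - signed (p * q) (leib_comp R (leib_comp Q P)))"
    if "multilinear P" "multilinear Q" "multilinear R" "of_degree p P" "of_degree q Q" "of_degree r R"
    for P Q R p q r
    unfolding bracket_of_degree[OF multilinear_bracket[OF that(1,2)] that(3) of_degree_bracket[OF that(1,2,4,5)] that(6)]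
    unfolding bracket_of_degree[OF that(1,2,4,5)] leib_comp_diff_left leib_comp_diff_right[OF that(3)]
      leib_comp_signed_left leib_comp_signed_right[OF that(3)] by (rule refl)
  have 2: "bracket_3Leib scale P (bracket_3Leib scale Q R) =
      (leib_comp P (leib_comp Q R) - signed (q * r) (leib_comp P (leib_comp R Q)))
      - signed (p * (q + r)) (leib_comp (leib_comp Q R) P - signed (q * r) (leib_comp (leib_comp R Q) P))"
    unfolding bracket_of_degree[OF ml(1) multilinear_bracket[OF ml(2,3)] deg(1) of_degree_bracket[OF ml(2,3) deg(2,3)]]
    unfolding bracket_of_degree[OF ml(2,3) deg(2,3)] leib_comp_diff_left leib_comp_diff_right[OF ml(1)]
      leib_comp_signed_left leib_comp_signed_right[OF ml(1)] by (rule refl)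
  show ?thesis
    unfolding 1[OF ml deg] 1[OF ml(1,3,2) deg(1,3,2)] 2
    by (rule jacobi_from_pre_Lie)
      (use pre_Lie_identity[OF ml(1,2,3) deg(2,3)] pre_Lie_identity[OF ml(2,1,3) deg(1,3)]
        pre_Lie_identity[OF ml(3,1,2) deg(1,2)] in \<open>simp_all add: associator_def\<close>)
qed

end

section \<open>The weight grading\<close>

text \<open>
  The space \<open>\<gg>\<close> for \<open>i = 1\<close>, the space \<open>V\<close> for \<open>i = 0\<close>, and the zero space for all other integers.
\<close>

definition component :: "int \<Rightarrow> ('g::zero \<times> 'v::zero) set" where
  "component i = {a. (i \<noteq> 1 \<longrightarrow> fst a = 0) \<and> (i \<noteq> 0 \<longrightarrow> snd a = 0)}"

text \<open>
  Lists in which each vector lies in \<open>\<gg>\<close> or in \<open>V\<close>, with \<open>m\<close> counting those in \<open>\<gg>\<close>.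
\<close>

inductive pure_tensor :: "int \<Rightarrow> (('g::zero \<times> 'v::zero) \<times> ('g \<times> 'v)) list \<Rightarrow> bool" where
  "pure_tensor 0 []"
| "\<lbrakk>a \<in> component i; b \<in> component j; pure_tensor m X\<rbrakk> \<Longrightarrow> pure_tensor (i + j + m) ((a, b) # X)"

text \<open>
  The weight of a cochain is the number of its inputs from \<open>\<gg>\<close> minus the number of its outputs in
  \<open>\<gg>\<close>. It is \<open>2\<close> for \<open>\<mu> \<boxplus> \<rho>\<close> and \<open>-1\<close> for the elements of \<open>C\<^sup>*(V, \<gg>)\<close>.
\<close>

definition of_weight ::
  "int \<Rightarrow> ('g::zero \<times> 'v::zero, 'g \<times> 'v) cochain \<Rightarrow> bool" where
  "of_weight k P \<longleftrightarrow>
     (\<forall>m X n x. pure_tensor m X \<longrightarrow> x \<in> component n \<longrightarrow> P X x \<in> component (m + n - k))"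

definition drop_fst :: "'g::zero \<times> 'v \<Rightarrow> 'g \<times> 'v" where
  "drop_fst a = (0, snd a)"

lemma drop_fst_simps [simp]: "fst (drop_fst a) = 0" "snd (drop_fst a) = snd a" "drop_fst (g, v) = (0, v)"
  by (simp_all add: drop_fst_def)

lemma component_add: "a \<in> component i \<Longrightarrow> b \<in> component i \<Longrightarrow> a + b \<in> component i"
  for a b :: "'g::ab_group_add \<times> 'v::ab_group_add"
  by (auto simp: component_def)

lemma component_diff: "a \<in> component i \<Longrightarrow> b \<in> component i \<Longrightarrow> a - b \<in> component i"
  for a b :: "'g::ab_group_add \<times> 'v::ab_group_add"
  by (auto simp: component_def)

lemma component_signed: "a \<in> component i \<Longrightarrow> signed z a \<in> component i"
  for a :: "'g::ab_group_add \<times> 'v::ab_group_add"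
  by (auto simp: component_def signed_def)

lemma component_zero: "0 \<in> component i"
  by (simp add: component_def)

lemma component_outside: "a \<in> component i \<Longrightarrow> i \<noteq> 0 \<Longrightarrow> i \<noteq> 1 \<Longrightarrow> a = 0"
  by (simp add: component_def prod_eq_iff)

lemma component_one: "(g, 0) \<in> component 1" and component_null: "(0, v) \<in> component 0"
  by (simp_all add: component_def)

lemma of_weight_contract:
  fixes P :: "('g::zero \<times> 'v::zero, 'g \<times> 'v) cochain"
  assumes "of_weight k P" "a \<in> component i" "b \<in> component j"
  shows "of_weight (k - i - j) (contract (a, b) P)"
  unfolding of_weight_def
proof (intro allI impI)
  fix m n and x :: "'g \<times> 'v" and X :: "(('g \<times> 'v) \<times> ('g \<times> 'v)) list"
  assume X: "pure_tensor m X" "x \<in> component n"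
  have "P ((a, b) # X) x \<in> component ((i + j + m) + n - k)"
    using assms X pure_tensor.intros(2) unfolding of_weight_def by blast
  moreover have "(i + j + m) + n - k = m + n - (k - i - j)"
    by simp
  ultimately show "contract (a, b) P X x \<in> component (m + n - (k - i - j))"
    by (simp only: contract_apply)
qed

lemma of_weight_alternate: "of_weight k P \<Longrightarrow> of_weight k (alternate P)"
  for P :: "('g::ab_group_add \<times> 'v::ab_group_add, 'g \<times> 'v) cochain"
  by (simp add: of_weight_def alternate_def component_signed)

lemma of_weight_signed: "of_weight k P \<Longrightarrow> of_weight k (signed z P)"
  for P :: "('g::ab_group_add \<times> 'v::ab_group_add, 'g \<times> 'v) cochain"
  by (simp add: of_weight_def signed_apply component_signed)

lemma of_weight_diff: "of_weight k P \<Longrightarrow> of_weight k Q \<Longrightarrow> of_weight k (P - Q)"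
  for P :: "('g::ab_group_add \<times> 'v::ab_group_add, 'g \<times> 'v) cochain"
  by (auto simp: of_weight_def intro!: component_diff)

text \<open>
  The output of one cochain becomes an input of the other, so that it is counted once with each sign.
\<close>

lemma of_weight_leib_comp:
  fixes P :: "('g::ab_group_add \<times> 'v::ab_group_add, 'g \<times> 'v) cochain"
  assumes "of_weight k P" "of_weight l Q"
  shows "of_weight (k + l) (leib_comp P Q)"
proof -
  have "leib_comp P Q X x \<in> component (m + n - (k + l))" if "pure_tensor m X" "x \<in> component n" for m X n x
    using that assms
  proof (induction m X arbitrary: P Q k l rule: pure_tensor.induct)
    case 1
    then have "Q [] x \<in> component (0 + n - l)"
      using pure_tensor.intros(1) unfolding of_weight_def by blast
    then have "P [] (Q [] x) \<in> component (0 + (0 + n - l) - k)"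
      using 1 pure_tensor.intros(1) unfolding of_weight_def by blast
    then show ?case
      by (simp add: algebra_simps)
  next
    case (2 a i b j m X)
    have "leib_comp (contract (a, b) P) (alternate Q) X x \<in> component (m + n - (k - i - j + l))"
      using 2 by (intro "2.IH" of_weight_contract of_weight_alternate)
    moreover have "leib_comp P (contract (a, b) Q) X x \<in> component (m + n - (k + (l - i - j)))"
      using 2 by (intro "2.IH" of_weight_contract)
    moreover have "act (Q []) (a, b) P X x \<in> component (m + n - (k - (i - l) - j))"
    proof -
      have Q: "Q [] c \<in> component (0 + h - l)" if "c \<in> component h" for c h
        using that 2 pure_tensor.intros(1) unfolding of_weight_def by blast
      have "of_weight (k - (0 + i - l) - j) (contract (Q [] a, b) P)"
        using 2 Q by (intro of_weight_contract) auto
      moreover have "of_weight (k - i - (0 + j - l)) (contract (a, Q [] b) P)"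
        using 2 Q by (intro of_weight_contract) auto
      moreover have "k - i - (0 + j - l) = k - (0 + i - l) - j"
        by simp
      ultimately have "contract (Q [] a, b) P X x + contract (a, Q [] b) P X x
          \<in> component (m + n - (k - (0 + i - l) - j))"
        using 2 unfolding of_weight_def by (intro component_add) metis+
      then show ?thesis
        by (simp add: act_apply)
    qed
    ultimately show ?case
      by (simp add: component_add algebra_simps)
  qed
  then show ?thesis
    by (simp add: of_weight_def)
qed

locale cochain_pair = vector_space_prod scaleG scaleV
  for scaleG :: "'k::field_char_0 \<Rightarrow> 'g::ab_group_add \<Rightarrow> 'g"
    and scaleV :: "'k \<Rightarrow> 'v::ab_group_add \<Rightarrow> 'v"
begin

sublocale W: cochain_space "scale_sum scaleG scaleV"
  by (rule cochain_space.intro) (rule p.vector_space_axioms)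

lemma multilinear_decompose:
  fixes P :: "('g \<times> 'v, 'g \<times> 'v) cochain"
  assumes "W.multilinear P"
  shows "P (((g, v), (h, w)) # X) x =
    P (((g, 0), (h, 0)) # X) x + P (((g, 0), (0, w)) # X) x
    + P (((0, v), (h, 0)) # X) x + P (((0, v), (0, w)) # X) x"
    "P X (g, v) = P X (g, 0) + P X (0, v)"
proof -
  have split: "(g, v) = (g, 0) + (0, v)" for g :: 'g and v :: 'v
    by simp
  show "P (((g, v), (h, w)) # X) x =
    P (((g, 0), (h, 0)) # X) x + P (((g, 0), (0, w)) # X) x
    + P (((0, v), (h, 0)) # X) x + P (((0, v), (0, w)) # X) x"
    unfolding split[of g v] split[of h w] W.multilinear_apply[OF assms] by (simp only: add_ac)
  show "P X (g, v) = P X (g, 0) + P X (0, v)"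
    unfolding split[of g v] W.multilinear_apply[OF assms] by (rule refl)
qed

text \<open>
  A cochain of weight at most \<open>-2\<close> would need more than one output in \<open>\<gg>\<close>.
\<close>

lemma low_weight_zero:
  assumes "W.multilinear P" "of_weight k P" "k \<le> - 2"
  shows "P = 0"
proof -
  have "P X x = 0" for X x
    using assms
  proof (induction X arbitrary: P k)
    case Nil
    have "P [] y = 0" if "y \<in> component n" "n \<in> {0, 1}" for y n
    proof -
      have "P [] y \<in> component (0 + n - k)"
        using Nil that pure_tensor.intros(1) unfolding of_weight_def by blast
      then show ?thesis
        using that Nil by (intro component_outside) auto
    qed
    then have "P [] (fst x, 0) = 0" "P [] (0, snd x) = 0"
      using component_one component_null by blast+
    then show ?case
      using multilinear_decompose(2)[OF Nil(1), of "[]" "fst x" "snd x"] by simp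
  next
    case (Cons Y X)
    have zero: "P ((a, b) # X) x = 0"
      if "a \<in> component i" "b \<in> component j" "i \<in> {0, 1}" "j \<in> {0, 1}" for a b i j
    proof -
      have "contract (a, b) P X x = 0"
        using that Cons.prems by (intro Cons.IH[OF W.multilinear_contract of_weight_contract]) auto
      then show ?thesis
        by simp
    qed
    obtain g v h w where Y: "Y = ((g, v), (h, w))"
      by (rule that[of "fst (fst Y)" "snd (fst Y)" "fst (snd Y)" "snd (snd Y)"]) simp
    have "P (((g, 0), (h, 0)) # X) x = 0" "P (((g, 0), (0, w)) # X) x = 0"
      "P (((0, v), (h, 0)) # X) x = 0" "P (((0, v), (0, w)) # X) x = 0"
      by (rule zero[OF component_one component_one] zero[OF component_one component_null]
          zero[OF component_null component_one] zero[OF component_null component_null]; simp)+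
    then show ?case
      using multilinear_decompose(1)[OF Cons.prems(1), of g v h w X x] unfolding Y by simp
  qed
  then show ?thesis
    by (simp add: fun_eq_iff)
qed

text \<open>
  An intrinsic description of the image of \<open>C\<^sup>*(V, \<gg>)\<close>: only the \<open>V\<close>-components of the arguments
  matter, and the values lie in \<open>\<gg>\<close>.
\<close>

definition horizontal :: "('g \<times> 'v, 'g \<times> 'v) cochain \<Rightarrow> bool" where
  "horizontal P \<longleftrightarrow>
     (\<forall>X x. P X x = P (map (map_prod drop_fst drop_fst) X) (drop_fst x) \<and> snd (P X x) = 0)"

lemma horizontalD:
  assumes "horizontal P"
  shows "P X x = P (map (map_prod drop_fst drop_fst) X) (drop_fst x)" "snd (P X x) = 0"
  using assms unfolding horizontal_def by blast+

lemma horizontal_contract: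
  assumes "horizontal P"
  shows "horizontal (contract (a, b) P)"
proof -
  have "P ((a, b) # X) x = P ((a, b) # map (map_prod drop_fst drop_fst) X) (drop_fst x)" for X x
  proof -
    have "P ((a, b) # X) x = P (map (map_prod drop_fst drop_fst) ((a, b) # X)) (drop_fst x)"
      using assms unfolding horizontal_def by blast
    also have "\<dots> = P (map (map_prod drop_fst drop_fst)
        ((a, b) # map (map_prod drop_fst drop_fst) X)) (drop_fst (drop_fst x))"
      by (simp add: o_def map_prod_def case_prod_unfold drop_fst_def)
    also have "\<dots> = P ((a, b) # map (map_prod drop_fst drop_fst) X) (drop_fst x)"
      using assms unfolding horizontal_def by metis
    finally show ?thesis .
  qed
  then show ?thesis
    using assms by (simp add: horizontal_def)
qed

text \<open>
  For weight \<open>-1\<close>, the output lies in \<open>\<gg>\<close> when all inputs are in \<open>V\<close>, and an input from \<open>\<gg>\<close> leaves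
  a contraction of weight at most \<open>-2\<close>.
\<close>

lemma horizontal_if_of_weight:
  assumes "W.multilinear P" "of_weight (- 1) P"
  shows "horizontal P"
proof -
  have "P X x = P (map (map_prod drop_fst drop_fst) X) (drop_fst x) \<and> snd (P X x) = 0" for X x
    using assms
  proof (induction X arbitrary: P)
    case Nil
    have "P [] (fst x, 0) \<in> component (0 + 1 - - 1)" "P [] (0, snd x) \<in> component (0 + 0 - - 1)"
      using Nil pure_tensor.intros(1) component_one component_null unfolding of_weight_def by blast+
    then have "P [] (fst x, 0) = 0" "snd (P [] (0, snd x)) = 0"
      by (auto simp: component_def prod_eq_iff)
    then show ?case
      using multilinear_decompose(2)[OF Nil(1), of "[]" "fst x" "snd x"] by (simp add: drop_fst_def)
  next
    case (Cons Y X)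
    have zero: "P ((a, b) # X) x = 0"
      if "a \<in> component i" "b \<in> component j" "i + j \<ge> 1" for a b i j
    proof -
      have "contract (a, b) P = 0"
        using that Cons.prems
        by (intro low_weight_zero[OF W.multilinear_contract of_weight_contract]) auto
      then have "contract (a, b) P X x = 0"
        by simp
      then show ?thesis
        by simp
    qed
    obtain g v h w where Y: "Y = ((g, v), (h, w))"
      by (rule that[of "fst (fst Y)" "snd (fst Y)" "fst (snd Y)" "snd (snd Y)"]) simp
    have "of_weight (- 1 - 0 - 0) (contract ((0, v), (0, w)) P)"
      using Cons.prems component_null by (intro of_weight_contract)
    then have "of_weight (- 1) (contract ((0, v), (0, w)) P)"
      by (simp del: contract_apply)
    then have IH: "contract ((0, v), (0, w)) P X x =
        contract ((0, v), (0, w)) P (map (map_prod drop_fst drop_fst) X) (drop_fst x) \<and>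
      snd (contract ((0, v), (0, w)) P X x) = 0"
      using Cons.prems(1) by (intro Cons.IH W.multilinear_contract)
    have "P (((g, 0), (h, 0)) # X) x = 0" "P (((g, 0), (0, w)) # X) x = 0"
      "P (((0, v), (h, 0)) # X) x = 0"
      by (rule zero[OF component_one component_one] zero[OF component_one component_null]
          zero[OF component_null component_one]; simp)+
    then have "P (Y # X) x = P (((0, v), (0, w)) # X) x"
      using multilinear_decompose(1)[OF Cons.prems(1), of g v h w X x] unfolding Y by simp
    moreover have "P (map (map_prod drop_fst drop_fst) (Y # X)) (drop_fst x) =
        contract ((0, v), (0, w)) P (map (map_prod drop_fst drop_fst) X) (drop_fst x)"
      by (simp add: Y)
    ultimately show ?case
      using IH by (metis contract_apply)
  qed
  then show ?thesis
    by (simp add: horizontal_def)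
qed

lemma of_weight_if_horizontal:
  assumes "W.multilinear P" "horizontal P"
  shows "of_weight (- 1) P"
proof -
  have "P X x \<in> component (m + n - - 1)" if "pure_tensor m X" "x \<in> component n" for m X n x
    using that assms
  proof (induction m X arbitrary: P rule: pure_tensor.induct)
    case 1
    show ?case
    proof (cases "n = 0")
      case True
      then show ?thesis
        using 1 horizontalD(2)[OF 1(3)] by (simp add: component_def)
    next
      case False
      then have "drop_fst x = 0"
        using 1 by (simp add: component_def drop_fst_def zero_prod_def)
      moreover have "P [] x = P [] (drop_fst x)"
        using horizontalD(1)[OF 1(3), of "[]" x] by simp
      ultimately show ?thesis
        by (simp add: W.multilinear_apply[OF 1(2)] component_zero)
    qed
  next
    case (2 a i b j m X)
    show ?case
    proof (cases "i = 0 \<and> j = 0")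
      case True
      have "contract (a, b) P X x \<in> component (m + n - - 1)"
        using "2.prems" by (intro "2.IH" W.multilinear_contract horizontal_contract)
      with True show ?thesis
        by simp
    next
      case False
      then have "drop_fst a = 0 \<or> drop_fst b = 0"
        using "2.hyps" by (auto simp: component_def drop_fst_def zero_prod_def)
      moreover have "P ((a, b) # X) x =
          P ((drop_fst a, drop_fst b) # map (map_prod drop_fst drop_fst) X) (drop_fst x)"
        using horizontalD(1)[OF "2.prems"(3), of "(a, b) # X" x] by simp
      ultimately show ?thesis
        using W.multilinear_apply(9,10)[OF "2.prems"(2)] by (metis component_zero)
    qed
  qed
  then show ?thesis
    by (simp add: of_weight_def)
qed

lemma linear_iff_VG: "Vector_Spaces.linear scaleV scaleG f \<longleftrightarrow>
    (\<forall>x y. f (x + y) = f x + f y) \<and> (\<forall>c x. f (scaleV c x) = scaleG c (f x))"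
  using vs1.vector_space_axioms vs2.vector_space_axioms by (auto simp: Vector_Spaces.linear_iff)

lemma lift_cochain_properties:
  assumes "P \<in> cochains scaleV scaleG n"
  shows "W.multilinear (lift_cochain P)" "of_degree (int n) (lift_cochain P)" "horizontal (lift_cochain P)"
proof -
  have zero: "P X x = 0" if "length X \<noteq> n" for X x
    using assms that by (simp add: cochains_def)
  have 1: "Vector_Spaces.linear scaleV scaleG (P X)" for X
    using assms zero[of X] by (cases "length X = n") (auto simp: cochains_def linear_iff_VG)
  have slot: "Vector_Spaces.linear scaleV scaleG (\<lambda>y. P (X[i := (y, b)]) x)"
    "Vector_Spaces.linear scaleV scaleG (\<lambda>y. P (X[i := (a, y)]) x)"
    if "length X = n" "i < n" for X i a b x
    using assms that unfolding cochains_def by blast+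
  have 2: "Vector_Spaces.linear scaleV scaleG (\<lambda>y. P (U @ (y, b) # W) x)"
    "Vector_Spaces.linear scaleV scaleG (\<lambda>y. P (U @ (a, y) # W) x)" for U W a b x
  proof -
    have upd: "(U @ (a, b) # W)[length U := c] = U @ c # W" for c
      by simp
    have "Vector_Spaces.linear scaleV scaleG (\<lambda>y. P (U @ (y, b) # W) x) \<and>
        Vector_Spaces.linear scaleV scaleG (\<lambda>y. P (U @ (a, y) # W) x)"
    proof (cases "length (U @ (a, b) # W) = n")
      case True
      then have "length U < n"
        by auto
      then show ?thesis
        using slot[OF True, of "length U"] unfolding upd by blast
    next
      case False
      then show ?thesis
        using zero by (simp add: linear_iff_VG)
    qed
    then show "Vector_Spaces.linear scaleV scaleG (\<lambda>y. P (U @ (y, b) # W) x)"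
      "Vector_Spaces.linear scaleV scaleG (\<lambda>y. P (U @ (a, y) # W) x)"
      by blast+
  qed
  show "W.multilinear (lift_cochain P)"
    using 1 2 by (intro W.multilinearI)
      (simp_all add: lift_cochain_def W.is_linear_def linear_iff_VG scale_def)
  show "of_degree (int n) (lift_cochain P)"
    using zero by (simp add: of_degree_def lift_cochain_def zero_prod_def)
  have "map_prod snd snd \<circ> map_prod drop_fst drop_fst = (map_prod snd snd :: ('g \<times> 'v) \<times> ('g \<times> 'v) \<Rightarrow> _)"
    by (auto simp: fun_eq_iff)
  then show "horizontal (lift_cochain P)"
    by (simp add: horizontal_def lift_cochain_def)
qed

lemma horizontal_in_lift_cochain:
  assumes ml: "W.multilinear P" and deg: "of_degree (int n) P" and P: "horizontal P"
  shows "P \<in> lift_cochain ` cochains scaleV scaleG n"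
proof -
  define P' where "P' X x = fst (P (map (map_prod (Pair 0) (Pair 0)) X) (0, x))" for X :: "('v \<times> 'v) list" and x
  have lin: "f (0, x + y) = f (0, x) + f (0, y)" "f (0, scaleV c x) = scale_sum scaleG scaleV c (f (0, x))"
    if "W.is_linear f" for f x y c
    using W.is_linearD(1)[OF that, of "(0, x)" "(0, y)"] W.is_linearD(2)[OF that, of c "(0, x)"]
    by (simp_all add: scale_def)
  have fst_scale: "fst (scale_sum scaleG scaleV c a) = scaleG c (fst a)" for c a
    by (simp add: scale_def)
  have "P' \<in> cochains scaleV scaleG n"
    unfolding cochains_def
  proof (intro CollectI conjI allI impI)
    show "P' X x = 0" if "length X \<noteq> n" for X x
      using that deg by (simp add: of_degree_def P'_def)
    show "Vector_Spaces.linear scaleV scaleG (P' X)" for X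
      unfolding linear_iff_VG P'_def
      by (simp add: lin[OF W.multilinearD(1)[OF ml]] fst_scale)
    fix X :: "('v \<times> 'v) list" and x i a b assume i: "length X = n" "i < n"
    let ?m = "map (map_prod (Pair 0) (Pair 0)) :: _ \<Rightarrow> (('g \<times> 'v) \<times> ('g \<times> 'v)) list"
    have upd: "X[i := c] = take i X @ c # drop (Suc i) X" for c
      using i by (simp add: upd_conv_take_nth_drop)
    show "Vector_Spaces.linear scaleV scaleG (\<lambda>y. P' (X[i := (y, b)]) x)"
      unfolding linear_iff_VG P'_def upd
      by (simp add: lin[OF W.multilinearD(2)[OF ml, of "?m (take i X)" "(0, b)" "?m (drop (Suc i) X)" "(0, x)"]]
          fst_scale)
    show "Vector_Spaces.linear scaleV scaleG (\<lambda>y. P' (X[i := (a, y)]) x)"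
      unfolding linear_iff_VG P'_def upd
      by (simp add: lin[OF W.multilinearD(3)[OF ml, of "?m (take i X)" "(0, a)" "?m (drop (Suc i) X)" "(0, x)"]]
          fst_scale)
  qed
  moreover have "P = lift_cochain P'"
  proof (intro ext)
    fix X x
    have "map_prod (Pair 0) (Pair 0) \<circ> map_prod snd snd =
        (map_prod drop_fst drop_fst :: ('g \<times> 'v) \<times> ('g \<times> 'v) \<Rightarrow> _)"
      by (auto simp: fun_eq_iff)
    moreover have "P X x = P (map (map_prod drop_fst drop_fst) X) (drop_fst x)" "snd (P X x) = 0"
      using P unfolding horizontal_def by blast+
    ultimately show "P X x = lift_cochain P' X x"
      by (simp add: lift_cochain_def P'_def prod_eq_iff drop_fst_def)
  qed
  ultimately show ?thesis
    by blast
qed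

definition bigraded :: "int \<Rightarrow> int \<Rightarrow> ('g \<times> 'v, 'g \<times> 'v) cochain set" where
  "bigraded i k = {P. W.multilinear P \<and> of_degree i P \<and> of_weight k P}"

text \<open>
  This identifies the graded space of the theorem with the abelian part of a bigraded Lie algebra.
\<close>

lemma graded_cochains_eq_bigraded: "graded_cochains scaleG scaleV i = bigraded i (- 1)"
proof (cases "i < 0")
  case True
  have "of_weight k (0 :: ('g \<times> 'v, 'g \<times> 'v) cochain)" for k
    by (simp add: of_weight_def component_zero)
  with True show ?thesis
    using of_degree_negative[of i]
    by (auto simp: graded_cochains_def bigraded_def W.multilinear_zero) (simp add: of_degree_def)
next
  case False
  then have "lift_cochain ` cochains scaleV scaleG (nat i) = bigraded i (- 1)"
    using lift_cochain_properties[of _ "nat i"] horizontal_in_lift_cochain[of _ "nat i"]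
      horizontal_if_of_weight of_weight_if_horizontal
    by (auto simp: bigraded_def)
  with False show ?thesis
    by (simp add: graded_cochains_def)
qed

abbreviation br :: "('g \<times> 'v, 'g \<times> 'v) cochain \<Rightarrow> ('g \<times> 'v, 'g \<times> 'v) cochain \<Rightarrow> ('g \<times> 'v, 'g \<times> 'v) cochain" where
  "br \<equiv> bracket_3Leib (scale_sum scaleG scaleV)"

lemma vector_space_cochains: "vector_space (cochain_scale (scale_sum scaleG scaleV))"
  by unfold_locales (simp_all add: cochain_scale_def fun_eq_iff p.scale_right_distrib p.scale_left_distrib)

sublocale bigraded_Lie_algebra "cochain_scale (scale_sum scaleG scaleV)" "Collect W.multilinear" bigraded br
proof -
  interpret C: vector_space "cochain_scale (scale_sum scaleG scaleV)"
    by (rule vector_space_cochains)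
  have weight_add: "of_weight k (P + Q)" if "of_weight k P" "of_weight k Q"
    for k and P Q :: "('g \<times> 'v, 'g \<times> 'v) cochain"
    using that by (auto simp: of_weight_def intro!: component_add)
  have weight_scale: "of_weight k (cochain_scale (scale_sum scaleG scaleV) c P)" if "of_weight k P" for k c P
    using that by (auto simp: of_weight_def cochain_scale_def component_def scale_def)
  have degree_scale: "of_degree i (cochain_scale (scale_sum scaleG scaleV) c P)" if "of_degree i P" for i c P
    using that by (simp add: of_degree_def cochain_scale_def)
  have zero: "0 \<in> bigraded i k" for i k
    by (simp add: bigraded_def W.multilinear_zero of_degree_def of_weight_def component_zero)
  show "bigraded_Lie_algebra (cochain_scale (scale_sum scaleG scaleV)) (Collect W.multilinear) bigraded br"
  proof (intro bigraded_Lie_algebra.intro bigraded_Lie_algebra_axioms.intro vector_space_cochains)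
    show "C.subspace (Collect W.multilinear)"
      by (simp add: C.subspace_def W.multilinear_zero W.multilinear_add W.multilinear_scale)
    show "C.subspace (bigraded i k)" for i k
      unfolding C.subspace_def using zero
      by (simp add: bigraded_def W.multilinear_add W.multilinear_scale of_degree_add degree_scale
          weight_add weight_scale)
    show "bigraded i k \<subseteq> Collect W.multilinear" for i k
      by (auto simp: bigraded_def)
    show "P = 0" if "k \<le> - 2" "P \<in> bigraded i k" for k i P
      using that low_weight_zero by (auto simp: bigraded_def)
    show "f i = 0" if "finite I" "\<And>i. i \<in> I \<Longrightarrow> f i \<in> bigraded i k" "(\<Sum>i\<in>I. f i) = 0" "i \<in> I" for I f k i
    proof (intro ext)
      fix X x
      have deg: "of_degree j (f j)" if "j \<in> I" for j
        using \<open>\<And>i. i \<in> I \<Longrightarrow> f i \<in> bigraded i k\<close>[OF that] by (simp add: bigraded_def)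
      have apply_sum: "(\<Sum>j\<in>J. f j) X x = (\<Sum>j\<in>J. f j X x)" for J
        by (induction J rule: infinite_finite_induct) simp_all
      show "f i X x = 0 X x"
      proof (cases "int (length X) = i")
        case True
        have "f j X x = 0" if "j \<in> I" "j \<noteq> i" for j
          using deg[OF that(1)] that(2) True by (intro of_degreeD[of j]) auto
        then have "(\<Sum>j\<in>I. f j X x) = f i X x"
          using that by (subst sum.remove[of I i]) auto
        then show ?thesis
          using that(3) apply_sum[of I] by simp
      next
        case False
        then show ?thesis
          using of_degreeD[OF deg[OF that(4)]] by simp
      qed
    qed
    show "br P Q \<in> bigraded (i + j) (k + l)" if "P \<in> bigraded i k" "Q \<in> bigraded j l" for P i k Q j l
    proof -
      have ml: "W.multilinear P" "W.multilinear Q" and deg: "of_degree i P" "of_degree j Q"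
        and wt: "of_weight k P" "of_weight l Q"
        using that by (simp_all add: bigraded_def)
      have "of_weight (k + l) (br P Q)"
        unfolding W.bracket_of_degree[OF ml deg]
        using of_weight_leib_comp[OF wt] of_weight_leib_comp[OF wt(2,1)]
        by (intro of_weight_diff of_weight_signed) (simp_all add: add.commute)
      then show ?thesis
        using W.multilinear_bracket[OF ml] W.of_degree_bracket[OF ml deg] by (simp add: bigraded_def)
    qed
    show "br P Q = - signed (i * j) (br Q P)" if "P \<in> bigraded i k" "Q \<in> bigraded j l" for P i k Q j l
      using that by (intro W.bracket_antisym) (auto simp: bigraded_def)
    show "br (br P Q) R = br P (br Q R) + signed (j * m) (br (br P R) Q)"
      if "P \<in> bigraded i k" "Q \<in> bigraded j l" "R \<in> bigraded m n" for P i k Q j l R m n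
      using that by (intro W.bracket_jacobi[where p = i]) (auto simp: bigraded_def)
  qed (simp_all add: W.multilinear_bracket W.bracket_add_left W.bracket_add_right W.bracket_scale)
qed

end

section \<open>Embedding tensors as Maurer-Cartan elements\<close>

context cochain_pair
begin

context
  fixes \<mu> :: "'g \<Rightarrow> 'g \<Rightarrow> 'g \<Rightarrow> 'g" and \<rho> :: "'g \<Rightarrow> 'g \<Rightarrow> 'v \<Rightarrow> 'v" and T :: "'v \<Rightarrow> 'g"
  assumes embedding: "embedding_tensor scaleG \<mu> scaleV \<rho> T"
begin

interpretation E: embedding_tensor scaleG \<mu> scaleV \<rho> T
  by (rule embedding)

lemma mu_simps:
  "\<mu> (x + x') y z = \<mu> x y z + \<mu> x' y z" "\<mu> x (y + y') z = \<mu> x y z + \<mu> x y' z"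
  "\<mu> x y (z + z') = \<mu> x y z + \<mu> x y z'" "\<mu> (scaleG c x) y z = scaleG c (\<mu> x y z)"
  "\<mu> x (scaleG c y) z = scaleG c (\<mu> x y z)" "\<mu> x y (scaleG c z) = scaleG c (\<mu> x y z)"
  "\<mu> 0 y z = 0" "\<mu> x 0 z = 0" "\<mu> x y 0 = 0"
proof -
  show *: "\<mu> (x + x') y z = \<mu> x y z + \<mu> x' y z" "\<mu> x (y + y') z = \<mu> x y z + \<mu> x y' z"
    "\<mu> x y (z + z') = \<mu> x y z + \<mu> x y z'" "\<mu> (scaleG c x) y z = scaleG c (\<mu> x y z)"
    "\<mu> x (scaleG c y) z = scaleG c (\<mu> x y z)" "\<mu> x y (scaleG c z) = scaleG c (\<mu> x y z)"
    for x x' y y' z z' c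
    using E.bracket_linear(1)[of y z] E.bracket_linear(2)[of x z] E.bracket_linear(3)[of x y]
    by (simp_all add: Vector_Spaces.linear_iff)
  show "\<mu> 0 y z = 0" "\<mu> x 0 z = 0" "\<mu> x y 0 = 0"
    using *(1)[of 0 0 y z] *(2)[of x 0 0 z] *(3)[of x y 0 0] by simp_all
qed

lemma rho_simps:
  "\<rho> (x + x') y v = \<rho> x y v + \<rho> x' y v" "\<rho> x (y + y') v = \<rho> x y v + \<rho> x y' v"
  "\<rho> x y (v + v') = \<rho> x y v + \<rho> x y v'" "\<rho> (scaleG c x) y v = scaleV c (\<rho> x y v)"
  "\<rho> x (scaleG c y) v = scaleV c (\<rho> x y v)" "\<rho> x y (scaleV c v) = scaleV c (\<rho> x y v)"
  "\<rho> 0 y v = 0" "\<rho> x 0 v = 0" "\<rho> x y 0 = 0"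
proof -
  show *: "\<rho> (x + x') y v = \<rho> x y v + \<rho> x' y v" "\<rho> x (y + y') v = \<rho> x y v + \<rho> x y' v"
    "\<rho> x y (v + v') = \<rho> x y v + \<rho> x y v'" "\<rho> (scaleG c x) y v = scaleV c (\<rho> x y v)"
    "\<rho> x (scaleG c y) v = scaleV c (\<rho> x y v)" "\<rho> x y (scaleV c v) = scaleV c (\<rho> x y v)"
    for x x' y y' v v' c
    using E.rho_linear(1)[of x y] E.rho_linear(2)[of y v] E.rho_linear(3)[of x v]
    by (simp_all add: Vector_Spaces.linear_iff)
  show "\<rho> 0 y v = 0" "\<rho> x 0 v = 0" "\<rho> x y 0 = 0"
    using *(1)[of 0 0 y v] *(2)[of x 0 0 v] *(3)[of x y 0 0] by simp_all
qed

lemma T_simps: "T (u + v) = T u + T v" "T (scaleV c u) = scaleG c (T u)" "T 0 = 0" "T (- u) = - T u"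
  "T (u - v) = T u - T v"
proof -
  show *: "T (u + v) = T u + T v" "T (scaleV c u) = scaleG c (T u)" for u v c
    using E.T_linear by (simp_all add: Vector_Spaces.linear_iff)
  show "T 0 = 0"
    using *(1)[of 0 0] by simp
  then show "T (- u) = - T u" for u
    using *(1)[of u "- u"] by (simp add: eq_neg_iff_add_eq_0 add.commute)
  then show "T (u - v) = T u - T v"
    using *(1)[of u "- v"] by simp
qed

abbreviation \<Delta> where "\<Delta> \<equiv> semidirect_cochain \<mu> \<rho>"

abbreviation T_lift where "T_lift \<equiv> lift_cochain (cochain_of_map T) :: ('g \<times> 'v, 'g \<times> 'v) cochain"

lemma semidirect_cochain_single:
  "\<Delta> [Y] z = (\<mu> (fst (fst Y)) (fst (snd Y)) (fst z), \<rho> (fst (fst Y)) (fst (snd Y)) (snd z))"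
  by (cases Y; cases z; cases "fst Y"; cases "snd Y") (simp add: semidirect_cochain_def)

lemma of_degree_semidirect_cochain: "of_degree 1 \<Delta>"
proof -
  have "\<Delta> X x = 0" if "length X \<noteq> 1" for X x
    using that by (cases X rule: remdups_adj.cases) (auto simp: semidirect_cochain_def split_def)
  then show ?thesis
    by (simp add: of_degree_def)
qed

lemma multilinear_semidirect_cochain: "W.multilinear \<Delta>"
proof (rule W.multilinearI)
  note zero = of_degreeD[OF of_degree_semidirect_cochain]
  show "W.is_linear (\<Delta> X)" for X
  proof (cases "length X = 1")
    case True
    then obtain Y where "X = [Y]"
      by (auto simp: length_Suc_conv)
    then show ?thesis
      by (simp add: W.is_linear_def semidirect_cochain_single mu_simps rho_simps scale_def)
  qed (simp add: W.is_linear_def zero)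
  show "W.is_linear (\<lambda>y. \<Delta> (U @ (y, b) # W) x)" for U W b x
  proof (cases "U = [] \<and> W = []")
    case True
    then show ?thesis
      by (simp add: W.is_linear_def semidirect_cochain_single mu_simps rho_simps scale_def)
  next
    case False
    then have "int (length (U @ Z # W)) \<noteq> 1" for Z :: "('g \<times> 'v) \<times> ('g \<times> 'v)"
      by (cases U; cases W) auto
    then have "\<Delta> (U @ Z # W) x = 0" for Z
      by (rule zero)
    then show ?thesis
      by (simp only: W.is_linear_zero)
  qed
  show "W.is_linear (\<lambda>y. \<Delta> (U @ (a, y) # W) x)" for U W a x
  proof (cases "U = [] \<and> W = []")
    case True
    then show ?thesis
      by (simp add: W.is_linear_def semidirect_cochain_single mu_simps rho_simps scale_def)
  next
    case False
    then have "int (length (U @ Z # W)) \<noteq> 1" for Z :: "('g \<times> 'v) \<times> ('g \<times> 'v)"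
      by (cases U; cases W) auto
    then have "\<Delta> (U @ Z # W) x = 0" for Z
      by (rule zero)
    then show ?thesis
      by (simp only: W.is_linear_zero)
  qed
qed

lemma of_weight_semidirect_cochain: "of_weight 2 \<Delta>"
  unfolding of_weight_def
proof (intro allI impI)
  fix m n and x :: "'g \<times> 'v" and X :: "(('g \<times> 'v) \<times> ('g \<times> 'v)) list"
  assume X: "pure_tensor m X" and x: "x \<in> component n"
  show "\<Delta> X x \<in> component (m + n - 2)"
  proof (cases "length X = 1")
    case True
    then obtain Y where Y: "X = [Y]"
      by (auto simp: length_Suc_conv)
    from X[unfolded Y] obtain a b i j where ij: "Y = (a, b)" "a \<in> component i" "b \<in> component j" "m = i + j"
      by (auto elim!: pure_tensor.cases[of m "[Y]"] elim: pure_tensor.cases[of _ "[]"])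
    show ?thesis
    proof (cases "i = 1 \<and> j = 1")
      case True
      then show ?thesis
        using ij x by (auto simp: Y semidirect_cochain_single component_def mu_simps rho_simps)
    next
      case False
      then have "fst a = 0 \<or> fst b = 0"
        using ij by (auto simp: component_def)
      then have "\<Delta> X x = 0"
        by (auto simp: Y ij(1) semidirect_cochain_single mu_simps rho_simps zero_prod_def)
      then show ?thesis
        by (simp add: component_zero)
    qed
  qed (simp add: of_degreeD[OF of_degree_semidirect_cochain] component_zero)
qed

lemma semidirect_cochain_bigraded: "\<Delta> \<in> bigraded 1 2"
  by (simp add: bigraded_def of_degree_semidirect_cochain multilinear_semidirect_cochain
      of_weight_semidirect_cochain)

lemma T_lift_bigraded: "T_lift \<in> bigraded 0 (- 1)"
proof -
  have "cochain_of_map T \<in> cochains scaleV scaleG 0"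
    by (auto simp: cochains_def cochain_of_map_def linear_iff_VG T_simps)
  then have "T_lift \<in> graded_cochains scaleG scaleV 0"
    by (simp add: graded_cochains_def)
  then show ?thesis
    by (simp only: graded_cochains_eq_bigraded)
qed

text \<open>
  Evaluated on two pairs and a vector, \<open>(\<mu> \<boxplus> \<rho>) \<circ> (\<mu> \<boxplus> \<rho>)\<close> is the defect of the fundamental
  identity in the \<open>\<gg>\<close>-component and of the commutator rule for \<open>\<rho>\<close> in the \<open>V\<close>-component.
\<close>

lemma br_semidirect_cochain: "br \<Delta> \<Delta> = 0"
proof -
  note \<Delta> = multilinear_semidirect_cochain of_degree_semidirect_cochain
  have "leib_comp \<Delta> \<Delta> X x = 0" for X x
  proof (cases "length X = 2")
    case True
    then obtain Y Z where X: "X = [Y, Z]"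
      by (auto simp: length_Suc_conv numeral_2_eq_2)
    have zero: "\<Delta> [] z = 0" "\<Delta> [Y, Z] z = 0" for Y Z z
      by (simp_all add: of_degreeD[OF \<Delta>(2)])
    have "leib_comp \<Delta> \<Delta> [Y, Z] x =
        - \<Delta> [Y] (\<Delta> [Z] x) + \<Delta> [Z] (\<Delta> [Y] x)
        + (\<Delta> [(\<Delta> [Y] (fst Z), snd Z)] x + \<Delta> [(fst Z, \<Delta> [Y] (snd Z))] x)"
      by (simp add: alternate_def act_apply zero W.multilinear_apply[OF \<Delta>(1)]
          W.is_linearD(4)[OF W.multilinearD(1)[OF \<Delta>(1)]])
    also have "\<dots> = 0"
      by (simp add: semidirect_cochain_single zero_prod_def
          E.fundamental_identity[of "fst (fst Y)" "fst (snd Y)" "fst (fst Z)" "fst (snd Z)"]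
          E.rho_commutator[of "fst (fst Y)" "fst (snd Y)" "fst (fst Z)" "fst (snd Z)"])
    finally show ?thesis
      by (simp add: X)
  next
    case False
    then show ?thesis
      using of_degreeD[OF W.of_degree_leib_comp[OF \<Delta> \<Delta>(2)], of X x] by simp
  qed
  then have "leib_comp \<Delta> \<Delta> = 0"
    by (simp add: fun_eq_iff)
  then show ?thesis
    by (simp add: W.bracket_of_degree[OF \<Delta>(1) \<Delta>(1) \<Delta>(2) \<Delta>(2)])
qed

text \<open>
  Bracketing with a linear map \<open>T\<close> inserts it in turn into each of the three arguments, and subtracts
  its application to the result.
\<close>

lemma br_T_lift:
  assumes A: "A \<in> bigraded 1 k"
  shows "br A T_lift [Y] x = A [Y] (T (snd x), 0) + A [((T (snd (fst Y)), 0), snd Y)] x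
    + A [(fst Y, (T (snd (snd Y)), 0))] x - (T (snd (A [Y] x)), 0)"
proof -
  have ml: "W.multilinear A" "W.multilinear T_lift" and deg: "of_degree 1 A" "of_degree 0 T_lift"
    using A T_lift_bigraded by (simp_all add: bigraded_def)
  have T: "T_lift [] z = (T (snd z), 0)" "T_lift [Z] z = 0" for z Z
    by (simp_all add: lift_cochain_def cochain_of_map_def zero_prod_def)
  have "A [] z = 0" for z
    using of_degreeD[OF deg(1)] by simp
  then show ?thesis
    by (simp add: W.bracket_of_degree[OF ml deg] alternate_def act_apply T)
qed

text \<open>
  Inserting \<open>T\<close> into all three arguments gives \<open>6 [T u, T v, T w]\<close>. Applying it to the result is only
  possible once, since \<open>T\<close> vanishes on \<open>\<gg>\<close>, and then contributes \<open>-6 T (\<rho> (T u, T v) w)\<close>. So the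
  Maurer-Cartan equation for \<open>T\<close> is the defining property of an embedding tensor.
\<close>

lemma br_T_lift_three: "br (br (br \<Delta> T_lift) T_lift) T_lift = 0"
proof -
  have 1: "br \<Delta> T_lift \<in> bigraded 1 1"
    using br_B[OF semidirect_cochain_bigraded T_lift_bigraded] by simp
  have 2: "br (br \<Delta> T_lift) T_lift \<in> bigraded 1 0"
    using br_B[OF 1 T_lift_bigraded] by simp
  let ?A = "br (br (br \<Delta> T_lift) T_lift) T_lift"
  have A: "?A \<in> bigraded 1 (- 1)"
    using br_B[OF 2 T_lift_bigraded] by simp
  have "?A X x = 0" for X x
  proof (cases "length X = 1")
    case True
    then obtain Y where X: "X = [Y]"
      by (auto simp: length_Suc_conv)
    obtain u v w where uvw: "u = snd (fst Y)" "v = snd (snd Y)" "w = snd x"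
      by blast
    have "horizontal ?A"
      using A by (intro horizontal_if_of_weight) (simp_all add: bigraded_def)
    from horizontalD(1)[OF this, of X x]
    have "?A X x = ?A [((0, u), (0, v))] (0, w)"
      by (simp add: X uvw map_prod_def case_prod_unfold drop_fst_def)
    also have "\<dots> = 0"
      by (simp add: br_T_lift[OF 2] br_T_lift[OF 1] br_T_lift[OF semidirect_cochain_bigraded]
          semidirect_cochain_single mu_simps rho_simps T_simps E.T_embedding zero_prod_def)
    finally show ?thesis .
  next
    case False
    then show ?thesis
      using A of_degreeD[of 1 ?A X x] by (simp add: bigraded_def)
  qed
  then show ?thesis
    by (simp add: fun_eq_iff)
qed

text \<open>
  The iterated brackets of \<open>twisted_family \<Delta> T\<close> are the operations of the theorem: one argument
  meets \<open>[[\<Delta>, T], T] / 2\<close>, two arguments meet \<open>[\<Delta>, T]\<close>, and three arguments meet \<open>\<Delta>\<close>.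
\<close>

lemma L_infinity_twisted_operations:
  "L_infinity_algebra (cochain_scale (scale_sum scaleG scaleV)) (graded_cochains scaleG scaleV)
     (twisted_operations scaleG \<mu> scaleV \<rho> T)"
proof -
  let ?\<delta> = "twisted_family \<Delta> T_lift"
  interpret MC: Maurer_Cartan_family "cochain_scale (scale_sum scaleG scaleV)" "Collect W.multilinear"
    bigraded br ?\<delta>
    by (intro Maurer_Cartan_twisted_family semidirect_cochain_bigraded br_semidirect_cochain
        T_lift_bigraded br_T_lift_three)
  have ml: "W.multilinear \<Delta>" "W.multilinear T_lift"
    using semidirect_cochain_bigraded T_lift_bigraded by (simp_all add: bigraded_def)
  have "twisted_operations scaleG \<mu> scaleV \<rho> T xs = MC.derived xs"
    if xs: "xs \<noteq> []" "set xs \<subseteq> Collect W.multilinear" for xs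
  proof -
    consider P where "xs = [P]" | P Q where "xs = [P, Q]" | P Q R where "xs = [P, Q, R]"
      | P Q R S xs' where "xs = P # Q # R # S # xs'"
      using xs(1) by (cases xs; cases "tl xs"; cases "tl (tl xs)"; cases "tl (tl (tl xs))") auto
    then show ?thesis
    proof cases
      case (1 P)
      then show ?thesis
        using xs ml by (simp add: MC.derived_def twisted_family_def tri_bracket_def Let_def
            W.bracket_scale W.multilinear_bracket)
    next
      case (2 P Q)
      then show ?thesis
        by (simp add: MC.derived_def twisted_family_def tri_bracket_def Let_def)
    next
      case (3 P Q R)
      then show ?thesis
        by (simp add: MC.derived_def twisted_family_def tri_bracket_def Let_def)
    next
      case (4 P Q R S xs')
      then have "?\<delta> (length xs - 1) = 0"
        by (simp add: twisted_family_def)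
      then have "MC.derived xs = 0"
        using foldl_br_zero[OF xs(2)] by (simp only: MC.derived_def)
      with 4 show ?thesis
        by simp
    qed
  qed
  then have "L_infinity_algebra (cochain_scale (scale_sum scaleG scaleV)) (\<lambda>i. bigraded i (- 1))
     (twisted_operations scaleG \<mu> scaleV \<rho> T)"
    by (rule MC.L_infinity_derived)
  then show ?thesis
    by (simp only: graded_cochains_eq_bigraded[symmetric])
qed

end

end

section \<open>The twisted structure on the cochains\<close>

theorem proposition3p12:
  fixes scaleG :: "'k::{alg_closed_field, field_char_0} \<Rightarrow> 'g::ab_group_add \<Rightarrow> 'g"
    and \<mu> :: "'g \<Rightarrow> 'g \<Rightarrow> 'g \<Rightarrow> 'g"
    and scaleV :: "'k \<Rightarrow> 'v::ab_group_add \<Rightarrow> 'v"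
    and \<rho> :: "'g \<Rightarrow> 'g \<Rightarrow> 'v \<Rightarrow> 'v"
    and T :: "'v \<Rightarrow> 'g"
  assumes "three_Lie_algebra scaleG \<mu>"
    and "three_Lie_representation scaleG \<mu> scaleV \<rho>"
    and "embedding_tensor scaleG \<mu> scaleV \<rho> T"
  shows "L_infinity_algebra
           (cochain_scale (scale_sum scaleG scaleV))
           (graded_cochains scaleG scaleV)
           (twisted_operations scaleG \<mu> scaleV \<rho> T)"
proof -
  interpret R: three_Lie_representation scaleG \<mu> scaleV \<rho>
    by (rule assms(2))
  interpret P: cochain_pair scaleG scaleV
    by unfold_locales
  show ?thesis
    using assms(3) by (rule P.L_infinity_twisted_operations)
qed

end
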